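(* Let $F$ be an algebraically closed field of characteristic zero and let $J=K_{10}$ be the Kac Jordan superalgebra over $F$. The fine gradings on $J$ are, up to equivalence, the following (components not listed are zero): (1) The toral $\mathbb Z\times\mathbb Z$-grading $J^{(0,0)}=\langle 1,e\otimes e\rangle$, $J^{(1,1)}=\langle x\otimes x\rangle$, $J^{(1,-1)}=\langle x\otimes y\rangle$, $J^{(-1,1)}=\langle y\otimes x\rangle$, $J^{(-1,-1)}=\langle y\otimes y\rangle$, $J^{(0,1)}=\langle e\otimes x\rangle$, $J^{(1,0)}=\langle x\otimes e\rangle$, $J^{(0,-1)}=\langle e\otimes y\rangle$, $J^{(-1,0)}=\langle y\otimes e\rangle$. This is of type $(8,1)$. (2) The nontoral $\mathbb Z\times\mathbb Z_2$-grading $J^{(0,0)}=\langle 1,e\otimes e,x\otimes y-y\otimes x\rangle$, $J^{(-1,1)}=\langle e\otimes y-y\otimes e\rangle$, $J^{(2,1)}=\langle x\otimes x\rangle$, $J^{(-2,1)}=\langle y\otimes y\rangle$, $J^{(1,1)}=\langle e\otimes x-x\otimes e\rangle$, $J^{(0,1)}=\langle x\otimes y+y\otimes x\rangle$, $J^{(1,0)}=\langle e\otimes x+x\otimes e\rangle$, $J^{(-1,0)}=\langle e\otimes y+y\otimes e\rangle$. This is of type $(7,0,1)$.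
   Context: Kaplansky superalgebra: $K=K_0\oplus K_1$ with $K_0=Fe$, $K_1=Fx\oplus Fy$ and product $e^2=e$, $ex=xe=\tfrac12x$, $ey=ye=\tfrac12y$, $xy=e=-yx$, $x^2=y^2=0$. It carries the bilinear form $(\cdot|\cdot)$ with $(e|e)=\tfrac12$, $(x|y)=1=-(y|x)$, $(x|x)=(y|y)=0$, $(K_0|K_1)=(K_1|K_0)=0$. For homogeneous $a\in K_i$ write $\bar a=i$. Kac superalgebra: $K_{10}=F\cdot 1\oplus(K\otimes_F K)$ with $1$ the identity element and, for homogeneous $a,b,c,d\in K$, $$(a\otimes b)(c\otimes d)=(-1)^{\bar b\bar c}\Big(ac\otimes bd-\tfrac34(a|c)(b|d)\,1\Big).$$ Its even part is $\langle 1,e\otimes e,x\otimes x,x\otimes y,y\otimes x,y\otimes y\rangle$ and its odd part is $\langle e\otimes x,x\otimes e,e\otimes y,y\otimes e\rangle$. Here $\langle\cdot\rangle$ denotes linear span. Gradings: a grading on a superalgebra $J=J_0\oplus J_1$ is a decomposition $J=\bigoplus_{g\in G}J^g$ into subspaces, with $G$ a finitely generated abelian group, such that $J^gJ^h\subset J^{gh}$ (additive notation is used for the concrete groups), $G$ is generated by the support $\{g: J^g\ne0\}$, and the grading is compatible with the superalgebra structure: $J^g=(J^g\cap J_0)\oplus(J^g\cap J_1)$ for all $g$. An automorphism of $J$ means an algebra automorphism preserving $J_0$ and $J_1$; $\mathrm{Aut}(J)$ is the (linear algebraic) group of these. Two gradings $J=\bigoplus_{g\in G} U^g$ and $J=\bigoplus_{h\in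 H} V^h$ are equivalent if there are a bijection $\sigma$ between their supports and $\varphi\in\mathrm{Aut}(J)$ with $\varphi(U^g)=V^{\sigma(g)}$ for every $g$ in the support of the first. A grading is produced by a set of commuting diagonalizable automorphisms if its nonzero homogeneous components are exactly the simultaneous eigenspaces of that set. A grading is toral if it is produced by automorphisms lying in a torus of $\mathrm{Aut}(J)$, and nontoral otherwise. A grading is fine if it admits no proper refinement (no other grading, each of whose components is contained in a component of the given one, with at least one inclusion strict). A grading has type $(h_1,h_2,\dots,h_r)$ if it has exactly $h_i$ homogeneous components of dimension $i$ for each $i\le r$, and none of dimension greater than $r$. $\mathbb Z_2=\mathbb Z/2\mathbb Z$. *)

theory Defs
  imports
    "HOL-Analysis.Determinants"
    "HOL-Algebra.Elementary_Groups"
    "HOL-Algebra.Weak_Morphisms"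
    "HOL-Computational_Algebra.Polynomial"
    "HOL-Library.Countable_Set"
begin

section \<open>The Kaplansky superalgebra\<close>

datatype kap_index = Ie | Ix | Iy

lemma UNIV_kap_index: "(UNIV :: kap_index set) = {Ie, Ix, Iy}"
  by (auto intro: kap_index.exhaust)

instance kap_index :: finite
  by standard (simp add: UNIV_kap_index)

type_synonym 'a kap = "'a ^ kap_index"

definition kap_e :: "'a::field kap" where "kap_e = axis Ie 1"
definition kap_x :: "'a::field kap" where "kap_x = axis Ix 1"
definition kap_y :: "'a::field kap" where "kap_y = axis Iy 1"

text \<open>The bilinear extension of \<open>e\<^sup>2 = e\<close>, \<open>ex = xe = x/2\<close>, \<open>ey = ye = y/2\<close>, \<open>xy = e = -yx\<close>,
  \<open>x\<^sup>2 = y\<^sup>2 = 0\<close>; see \<open>kap_mult_table\<close>.\<close>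

definition kap_mult :: "'a::field kap \<Rightarrow> 'a kap \<Rightarrow> 'a kap" where
  "kap_mult a b = (\<chi> i. case i of
      Ie \<Rightarrow> a $ Ie * b $ Ie + a $ Ix * b $ Iy - a $ Iy * b $ Ix
    | Ix \<Rightarrow> (a $ Ie * b $ Ix + a $ Ix * b $ Ie) / 2
    | Iy \<Rightarrow> (a $ Ie * b $ Iy + a $ Iy * b $ Ie) / 2)"

definition kap_form :: "'a::field kap \<Rightarrow> 'a kap \<Rightarrow> 'a" where
  "kap_form a b = a $ Ie * b $ Ie / 2 + a $ Ix * b $ Iy - a $ Iy * b $ Ix"

definition kap_part :: "nat \<Rightarrow> 'a::field kap set" where
  "kap_part p = (if p = 0 then vec.span {kap_e} else vec.span {kap_x, kap_y})"

lemma kap_mult_table: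
  fixes e x y :: "'a::field kap"
  defines "e \<equiv> kap_e" and "x \<equiv> kap_x" and "y \<equiv> kap_y"
  shows "kap_mult e e = e"
    "kap_mult e x = (1/2) *s x" "kap_mult x e = (1/2) *s x"
    "kap_mult e y = (1/2) *s y" "kap_mult y e = (1/2) *s y"
    "kap_mult x y = e" "kap_mult y x = - e"
    "kap_mult x x = 0" "kap_mult y y = 0"
  unfolding e_def x_def y_def
  by (simp_all add: vec_eq_iff kap_mult_def kap_e_def kap_x_def kap_y_def axis_def
      split: kap_index.split)

lemma kap_form_table:
  fixes e x y :: "'a::field kap"
  defines "e \<equiv> kap_e" and "x \<equiv> kap_x" and "y \<equiv> kap_y"
  shows "kap_form e e = 1/2" "kap_form x y = 1" "kap_form y x = -1"
    "kap_form x x = 0" "kap_form y y = 0"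
    "kap_form e x = 0" "kap_form x e = 0" "kap_form e y = 0" "kap_form y e = 0"
  unfolding e_def x_def y_def
  by (simp_all add: kap_form_def kap_e_def kap_x_def kap_y_def axis_def)

fun kap_parity :: "kap_index \<Rightarrow> nat" where
  "kap_parity Ie = 0"
| "kap_parity Ix = 1"
| "kap_parity Iy = 1"


section \<open>The Kac superalgebra\<close>

text \<open>The coordinate \<open>None\<close> belongs to the identity element, and \<open>Some (i, j)\<close> to the tensor product
  of the basis vectors of index \<open>i\<close> and \<open>j\<close>.\<close>

type_synonym 'a kac = "'a ^ (kap_index \<times> kap_index) option"

definition kac_one :: "'a::field kac" where
  "kac_one = axis None 1"

definition kac_tensor :: "'a::field kap \<Rightarrow> 'a kap \<Rightarrow> 'a kac" (infixl \<open>\<^bold>\<otimes>\<close> 75) where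
  "a \<^bold>\<otimes> b = (\<chi> k. case k of None \<Rightarrow> 0 | Some (i, j) \<Rightarrow> a $ i * b $ j)"

fun kac_basis_mult ::
  "(kap_index \<times> kap_index) option \<Rightarrow> (kap_index \<times> kap_index) option \<Rightarrow> 'a::field kac" where
  "kac_basis_mult None l = axis l 1"
| "kac_basis_mult k None = axis k 1"
| "kac_basis_mult (Some (i, j)) (Some (k, l)) =
     (-1) ^ (kap_parity j * kap_parity k) *s
       (kap_mult (axis i 1) (axis k 1) \<^bold>\<otimes> kap_mult (axis j 1) (axis l 1)
        - (3/4 * kap_form (axis i 1) (axis k 1) * kap_form (axis j 1) (axis l 1)) *s kac_one)"

text \<open>The bilinear extension of \<open>kac_basis_mult\<close>; \<open>kac_mult_tensor\<close> gives the product of arbitrary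
  tensors of homogeneous elements.\<close>

definition kac_mult :: "'a::field kac \<Rightarrow> 'a kac \<Rightarrow> 'a kac" where
  "kac_mult u v = (\<Sum>k\<in>UNIV. \<Sum>l\<in>UNIV. (u $ k * v $ l) *s kac_basis_mult k l)"

lemma sum_UNIV_kap_index: "(\<Sum>i\<in>UNIV. f i) = f Ie + f Ix + (f Iy :: 'b::comm_monoid_add)"
  by (simp add: UNIV_kap_index add.assoc)

lemma sum_UNIV_kac_index:
  fixes f :: "(kap_index \<times> kap_index) option \<Rightarrow> 'b::comm_monoid_add"
  shows "(\<Sum>k\<in>UNIV. f k) = f None + (\<Sum>i\<in>UNIV. \<Sum>j\<in>UNIV. f (Some (i, j)))"
proof -
  have "(\<Sum>k\<in>UNIV. f k) = f None + (\<Sum>k\<in>range Some. f k)"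
    unfolding UNIV_option_conv by (rule sum.insert) auto
  also have "(\<Sum>k\<in>range Some. f k) = (\<Sum>p\<in>UNIV. f (Some p))"
    by (subst sum.reindex) auto
  also have "\<dots> = (\<Sum>i\<in>UNIV. \<Sum>j\<in>UNIV. f (Some (i, j)))"
    by (simp add: sum.cartesian_product UNIV_Times_UNIV[symmetric] del: UNIV_Times_UNIV)
  finally show ?thesis .
qed

lemma kap_part_components:
  assumes "a \<in> kap_part p"
  shows "p = 0 \<Longrightarrow> a $ Ix = 0" "p = 0 \<Longrightarrow> a $ Iy = 0" "p \<noteq> 0 \<Longrightarrow> a $ Ie = 0"
proof -
  have "a $ Ix = 0 \<and> a $ Iy = 0" if "a \<in> vec.span {kap_e}"
    using that by (induction rule: vec.span_induct_alt) (auto simp: kap_e_def axis_def)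
  moreover have "a $ Ie = 0" if "a \<in> vec.span {kap_x, kap_y}"
    using that by (induction rule: vec.span_induct_alt) (auto simp: kap_x_def kap_y_def axis_def)
  ultimately show "p = 0 \<Longrightarrow> a $ Ix = 0" "p = 0 \<Longrightarrow> a $ Iy = 0" "p \<noteq> 0 \<Longrightarrow> a $ Ie = 0"
    using assms by (auto simp: kap_part_def split: if_splits)
qed

lemma kac_mult_tensor:
  fixes a b c d :: "'a::field_char_0 kap"
  assumes "b \<in> kap_part p" "c \<in> kap_part q" "p \<le> 1" "q \<le> 1"
  shows "kac_mult (a \<^bold>\<otimes> b) (c \<^bold>\<otimes> d) =
    (-1) ^ (p * q) *s (kap_mult a c \<^bold>\<otimes> kap_mult b d - (3/4 * kap_form a c * kap_form b d) *s kac_one)"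
proof -
  have pq: "p = 0 \<or> p = 1" "q = 0 \<or> q = 1"
    using assms by auto
  show ?thesis
    unfolding vec_eq_iff
  proof
    fix k :: "(kap_index \<times> kap_index) option"
    have k: "k = None \<or> (\<exists>i j. k = Some (i, j))"
      by (metis option.exhaust surj_pair)
    note B = kap_part_components[OF assms(1)] and C = kap_part_components[OF assms(2)]
    note S = kac_mult_def kac_tensor_def sum_UNIV_kac_index sum_UNIV_kap_index kac_one_def axis_def
      kap_mult_def kap_form_def diff_divide_distrib add_divide_distrib algebra_simps
    show "kac_mult (a \<^bold>\<otimes> b) (c \<^bold>\<otimes> d) $ k = ((-1) ^ (p * q) *s
        (kap_mult a c \<^bold>\<otimes> kap_mult b d - (3/4 * kap_form a c * kap_form b d) *s kac_one)) $ k"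
      using pq k
      apply (elim disjE exE)
      subgoal using B C by (simp add: S)
      subgoal for i j using B C by (cases i; cases j) (simp_all add: S)
      subgoal using B C by (simp add: S)
      subgoal for i j using B C by (cases i; cases j) (simp_all add: S)
      subgoal using B C by (simp add: S)
      subgoal for i j using B C by (cases i; cases j) (simp_all add: S)
      subgoal using B C by (simp add: S)
      subgoal for i j using B C by (cases i; cases j) (simp_all add: S)
      done
  qed
qed

lemma kac_mult_one:
  fixes v :: "'a::field kac"
  shows "kac_mult kac_one v = v" "kac_mult v kac_one = v"
proof -
  have v: "v = (\<Sum>k\<in>UNIV. v $ k *s axis k 1)"
    by (simp add: basis_expansion)
  have r: "kac_basis_mult k None = axis k 1" for k
    by (cases k) auto
  have "(\<Sum>l\<in>UNIV. ((kac_one :: 'a kac) $ k * v $ l) *s kac_basis_mult k l) =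
      (if k = None then (\<Sum>l\<in>UNIV. v $ l *s axis l 1) else 0)" for k
    by (simp add: kac_one_def axis_def)
  then have "kac_mult kac_one v = (\<Sum>l\<in>UNIV. v $ l *s axis l 1)"
    by (simp add: kac_mult_def)
  with v show "kac_mult kac_one v = v" by simp
  have "(\<Sum>l\<in>UNIV. (v $ k * (kac_one :: 'a kac) $ l) *s kac_basis_mult k l) =
      (\<Sum>l\<in>(UNIV :: (kap_index \<times> kap_index) option set). if l = None then v $ k *s axis k 1 else 0)" for k
    by (rule sum.cong) (auto simp: kac_one_def axis_def r)
  then have "kac_mult v kac_one = (\<Sum>k\<in>UNIV. v $ k *s axis k 1)"
    by (simp add: kac_mult_def)
  with v show "kac_mult v kac_one = v" by simp
qed

definition kac_even :: "'a::field kac set" where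
  "kac_even = vec.span {kac_one, kap_e \<^bold>\<otimes> kap_e, kap_x \<^bold>\<otimes> kap_x, kap_x \<^bold>\<otimes> kap_y,
     kap_y \<^bold>\<otimes> kap_x, kap_y \<^bold>\<otimes> kap_y}"

definition kac_odd :: "'a::field kac set" where
  "kac_odd = vec.span {kap_e \<^bold>\<otimes> kap_x, kap_x \<^bold>\<otimes> kap_e, kap_e \<^bold>\<otimes> kap_y, kap_y \<^bold>\<otimes> kap_e}"

definition kac_Aut :: "('a::field kac \<Rightarrow> 'a kac) set" where
  "kac_Aut = {\<phi>. Vector_Spaces.linear (*s) (*s) \<phi> \<and> bij \<phi>
      \<and> (\<forall>u v. \<phi> (kac_mult u v) = kac_mult (\<phi> u) (\<phi> v))
      \<and> \<phi> ` kac_even = kac_even \<and> \<phi> ` kac_odd = kac_odd}"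


section \<open>Gradings\<close>

definition support :: "('g, 'm) monoid_scheme \<Rightarrow> ('g \<Rightarrow> 'a::field kac set) \<Rightarrow> 'g set" where
  "support G U = {g \<in> carrier G. U g \<noteq> {0}}"

definition direct_decomposition :: "'g set \<Rightarrow> ('g \<Rightarrow> 'a::field kac set) \<Rightarrow> bool" where
  "direct_decomposition I U \<longleftrightarrow>
     (\<forall>g\<in>I. vec.subspace (U g)) \<and>
     (\<forall>v. \<exists>!w. (\<forall>g\<in>I. w g \<in> U g) \<and> (\<forall>g. g \<notin> I \<longrightarrow> w g = 0) \<and>
              finite {g. w g \<noteq> 0} \<and> v = (\<Sum>g | w g \<noteq> 0. w g))"

definition kac_grading :: "('g, 'm) monoid_scheme \<Rightarrow> ('g \<Rightarrow> 'a::field kac set) \<Rightarrow> bool" where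
  "kac_grading G U \<longleftrightarrow>
     comm_group G \<and>
     (\<exists>S. finite S \<and> S \<subseteq> carrier G \<and> generate G S = carrier G) \<and>
     direct_decomposition (carrier G) U \<and>
     (\<forall>g\<in>carrier G. \<forall>h\<in>carrier G. \<forall>u\<in>U g. \<forall>v\<in>U h. kac_mult u v \<in> U (g \<otimes>\<^bsub>G\<^esub> h)) \<and>
     generate G (support G U) = carrier G \<and>
     (\<forall>g\<in>carrier G. U g = {a + b | a b. a \<in> U g \<inter> kac_even \<and> b \<in> U g \<inter> kac_odd})"

definition equivalent_gradings ::
  "('g, 'm) monoid_scheme \<Rightarrow> ('g \<Rightarrow> 'a::field kac set) \<Rightarrow>
   ('h, 'n) monoid_scheme \<Rightarrow> ('h \<Rightarrow> 'a kac set) \<Rightarrow> bool" where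
  "equivalent_gradings G U H V \<longleftrightarrow>
     (\<exists>\<sigma> \<phi>. bij_betw \<sigma> (support G U) (support H V) \<and> \<phi> \<in> kac_Aut \<and>
            (\<forall>g\<in>support G U. \<phi> ` U g = V (\<sigma> g)))"

text \<open>\<open>proper_refinement H V G U\<close> says that the grading \<open>V\<close> properly refines \<open>U\<close>. Components are the
  nonzero ones: a zero component would be strictly contained in every other.\<close>

definition proper_refinement ::
  "('h, 'n) monoid_scheme \<Rightarrow> ('h \<Rightarrow> 'a::field kac set) \<Rightarrow>
   ('g, 'm) monoid_scheme \<Rightarrow> ('g \<Rightarrow> 'a kac set) \<Rightarrow> bool" where
  "proper_refinement H V G U \<longleftrightarrow>
     (\<forall>h\<in>support H V. \<exists>g\<in>support G U. V h \<subseteq> U g) \<and>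
     (\<exists>h\<in>support H V. \<exists>g\<in>support G U. V h \<subset> U g)"

text \<open>A definition cannot quantify over the type of group elements, so refinements range over groups
  with carrier in \<^typ>\<open>nat\<close>. This loses nothing because finitely generated groups are countable: by
  \<open>fine_grading_no_refinement\<close>, a fine grading has no proper refinement over any type.\<close>

definition fine_grading :: "('g, 'm) monoid_scheme \<Rightarrow> ('g \<Rightarrow> 'a::field kac set) \<Rightarrow> bool" where
  "fine_grading G U \<longleftrightarrow>
     kac_grading G U \<and>
     \<not> (\<exists>(H :: nat monoid) V. kac_grading H V \<and> proper_refinement H V G U)"

lemma finitely_generated_countable:
  assumes "group G" "finite S" "S \<subseteq> carrier G" "generate G S = carrier G"
  shows "countable (carrier G)"
proof -
  interpret group G by fact
  define T where "T = S \<union> m_inv G ` S"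
  define f where "f = (\<lambda>xs. foldr (mult G) xs (one G))"
  have T: "T \<subseteq> carrier G" using assms(3) by (auto simp: T_def)
  have fc: "f xs \<in> carrier G" if "xs \<in> lists T" for xs
    using that T by (induction xs) (auto simp: f_def)
  have app: "f (xs @ ys) = f xs \<otimes>\<^bsub>G\<^esub> f ys" if "xs \<in> lists T" "ys \<in> lists T" for xs ys
    using that
  proof (induction xs)
    case Nil
    then show ?case using fc[of ys] by (simp add: f_def)
  next
    case (Cons x xs)
    then have "x \<in> carrier G" "f xs \<in> carrier G" "f ys \<in> carrier G" "xs \<in> lists T"
      using T fc by auto
    then show ?case using Cons by (simp add: f_def m_assoc)
  qed
  have "g \<in> f ` lists T" if "g \<in> generate G S" for g
    using that
  proof (induction rule: generate.induct)
    case one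
    have "f [] = \<one>\<^bsub>G\<^esub>" by (simp add: f_def)
    then show ?case by (metis imageI lists.Nil)
  next
    case (incl h)
    then have "f [h] = h" "[h] \<in> lists T" using assms(3) by (auto simp: f_def T_def)
    then show ?case by (metis imageI)
  next
    case (inv h)
    then have "f [inv\<^bsub>G\<^esub> h] = inv\<^bsub>G\<^esub> h" "[inv\<^bsub>G\<^esub> h] \<in> lists T"
      using assms(3) by (auto simp: f_def T_def)
    then show ?case by (metis imageI)
  next
    case (eng h1 h2)
    then obtain xs ys where "xs \<in> lists T" "ys \<in> lists T" "h1 = f xs" "h2 = f ys" by blast
    then have "h1 \<otimes>\<^bsub>G\<^esub> h2 = f (xs @ ys)" "xs @ ys \<in> lists T" by (auto simp: app)
    then show ?case by blast
  qed
  then have "carrier G \<subseteq> f ` lists T" using assms(4) by blast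
  moreover have "countable (lists T)"
    using assms(2) by (intro countable_lists countable_finite) (simp add: T_def)
  ultimately show ?thesis by (meson countable_image countable_subset)
qed

lemma generate_hom_image:
  assumes "group G" "group H" "h \<in> hom G H" "S \<subseteq> carrier G" "generate G S = carrier G"
  shows "h ` carrier G \<subseteq> generate H (h ` S)"
proof -
  interpret group_hom G H h using assms by (simp add: group_hom_def group_hom_axioms_def)
  show ?thesis
    using generate_img[OF assms(4)] assms(5) by auto
qed

lemma kac_grading_nat:
  fixes U :: "'g \<Rightarrow> 'a::field kac set"
  assumes "kac_grading G U"
  obtains H :: "nat monoid" and V where "kac_grading H V" and "V ` support H V = U ` support G U"
proof -
  let ?I = "carrier G"
  interpret comm_group G using assms by (simp add: kac_grading_def)
  obtain S where S: "finite S" "S \<subseteq> ?I" "generate G S = ?I"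
    using assms by (auto simp: kac_grading_def)
  have "countable ?I" by (rule finitely_generated_countable[OF is_group S])
  then obtain h :: "'g \<Rightarrow> nat" where h: "inj_on h ?I"
    by (auto simp: countable_def)
  define H where "H = image_group h G"
  define k where "k = inv_into ?I h"
  define V where "V n = U (k n)" for n
  have iso: "h \<in> iso G H" unfolding H_def by (rule inj_imp_image_group_iso[OF h])
  have grpH: "group H" unfolding H_def by (rule inj_imp_image_group_is_group[OF h])
  have comm: "comm_group H"
    using iso grpH by (intro iso_imp_comm_group) (auto simp: is_iso_def group.is_monoid)
  have cH: "carrier H = h ` ?I" by (simp add: H_def image_group_def)
  have kh: "k (h g) = g" if "g \<in> ?I" for g using that h by (simp add: k_def)
  have hk: "h (k n) = n" "k n \<in> ?I" if "n \<in> carrier H" for n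
    using that kh by (auto simp: cH)
  have multH: "h a \<otimes>\<^bsub>H\<^esub> h b = h (a \<otimes>\<^bsub>G\<^esub> b)" if "a \<in> ?I" "b \<in> ?I" for a b
    using iso that by (auto simp: iso_def hom_def)
  have supp: "support H V = h ` support G U"
  proof -
    have "support H V = {n \<in> h ` ?I. V n \<noteq> {0}}" by (simp only: support_def cH)
    also have "\<dots> = h ` {g \<in> ?I. V (h g) \<noteq> {0}}" by blast
    also have "{g \<in> ?I. V (h g) \<noteq> {0}} = {g \<in> ?I. U g \<noteq> {0}}"
      using kh by (intro Collect_cong conj_cong refl) (simp only: V_def)
    finally show ?thesis by (simp only: support_def)
  qed
  have hom: "h \<in> hom G H" using iso by (simp add: iso_def)
  have gen: "generate H (h ` A) = carrier H" if "A \<subseteq> ?I" "generate G A = ?I" for A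
  proof
    show "generate H (h ` A) \<subseteq> carrier H"
      by (rule group.generate_incl[OF grpH]) (use that cH in auto)
    show "carrier H \<subseteq> generate H (h ` A)"
      unfolding cH by (rule generate_hom_image[OF is_group grpH hom that])
  qed
  have dec: "direct_decomposition (carrier H) V"
    unfolding direct_decomposition_def
  proof (intro conjI ballI allI)
    have sub: "\<forall>g\<in>?I. vec.subspace (U g)"
      and ex: "\<And>v. \<exists>!w. (\<forall>g\<in>?I. w g \<in> U g) \<and> (\<forall>g. g \<notin> ?I \<longrightarrow> w g = 0) \<and>
              finite {g. w g \<noteq> 0} \<and> v = (\<Sum>g | w g \<noteq> 0. w g)"
      using assms by (auto simp: kac_grading_def direct_decomposition_def)
    show "vec.subspace (V n)" if "n \<in> carrier H" for n
      using that sub hk by (simp add: V_def)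
    fix v :: "'a kac"
    let ?P = "\<lambda>w. (\<forall>g\<in>?I. w g \<in> U g) \<and> (\<forall>g. g \<notin> ?I \<longrightarrow> w g = 0) \<and>
              finite {g. w g \<noteq> 0} \<and> v = (\<Sum>g | w g \<noteq> 0. w g)"
    let ?Q = "\<lambda>w. (\<forall>g\<in>carrier H. w g \<in> V g) \<and> (\<forall>g. g \<notin> carrier H \<longrightarrow> w g = 0) \<and>
              finite {g. w g \<noteq> 0} \<and> v = (\<Sum>g | w g \<noteq> 0. w g)"
    define to :: "('g \<Rightarrow> 'a kac) \<Rightarrow> nat \<Rightarrow> 'a kac"
      where "to w n = (if n \<in> carrier H then w (k n) else 0)" for w n
    define fro :: "(nat \<Rightarrow> 'a kac) \<Rightarrow> 'g \<Rightarrow> 'a kac"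
      where "fro w g = (if g \<in> ?I then w (h g) else 0)" for w g
    have PQ: "?Q (to w)" if P: "?P w" for w
    proof -
      have nz: "{n. to w n \<noteq> 0} = h ` {g. w g \<noteq> 0}"
      proof (intro Set.set_eqI iffI)
        fix n assume "n \<in> {n. to w n \<noteq> 0}"
        then have "n \<in> carrier H" "w (k n) \<noteq> 0" by (auto simp: to_def split: if_splits)
        then show "n \<in> h ` {g. w g \<noteq> 0}" using hk(1) by force
      next
        fix n assume "n \<in> h ` {g. w g \<noteq> 0}"
        then obtain g where "n = h g" "w g \<noteq> 0" by auto
        moreover have "g \<in> ?I" using P \<open>w g \<noteq> 0\<close> by blast
        ultimately show "n \<in> {n. to w n \<noteq> 0}" by (simp add: to_def cH kh)
      qed
      have inI: "{g. w g \<noteq> 0} \<subseteq> ?I" using P by blast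
      have "(\<Sum>n | to w n \<noteq> 0. to w n) = (\<Sum>g | w g \<noteq> 0. to w (h g))"
        unfolding nz by (rule sum.reindex_cong[OF inj_on_subset[OF h inI]]) auto
      also have "\<dots> = (\<Sum>g | w g \<noteq> 0. w g)"
      proof (rule sum.cong[OF refl])
        fix g assume "g \<in> {g. w g \<noteq> 0}"
        then have "g \<in> ?I" using inI by blast
        then show "to w (h g) = w g" by (simp add: to_def cH kh)
      qed
      finally have "v = (\<Sum>n | to w n \<noteq> 0. to w n)" using P by simp
      moreover have "finite {n. to w n \<noteq> 0}" unfolding nz using P by blast
      moreover have "\<forall>g\<in>carrier H. to w g \<in> V g" using P hk by (simp add: to_def V_def)
      ultimately show ?thesis by (simp add: to_def)
    qed
    have QP: "?P (fro w)" if Q: "?Q w" for w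
    proof -
      have nz: "{n. w n \<noteq> 0} = h ` {g. fro w g \<noteq> 0}"
      proof (intro Set.set_eqI iffI)
        fix n assume n: "n \<in> {n. w n \<noteq> 0}"
        then have "n \<in> carrier H" using Q by blast
        then have "n = h (k n)" "fro w (k n) \<noteq> 0" using hk n by (auto simp: fro_def)
        then show "n \<in> h ` {g. fro w g \<noteq> 0}" by blast
      qed (auto simp: fro_def split: if_splits)
      have inI: "{g. fro w g \<noteq> 0} \<subseteq> ?I" by (auto simp: fro_def)
      have inj: "inj_on h {g. fro w g \<noteq> 0}" by (rule inj_on_subset[OF h inI])
      have "(\<Sum>n | w n \<noteq> 0. w n) = (\<Sum>g | fro w g \<noteq> 0. w (h g))"
        unfolding nz by (rule sum.reindex_cong[OF inj]) auto
      also have "\<dots> = (\<Sum>g | fro w g \<noteq> 0. fro w g)"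
        using inI by (intro sum.cong refl) (auto simp: fro_def)
      finally have "v = (\<Sum>g | fro w g \<noteq> 0. fro w g)" using Q by simp
      moreover have "finite {g. fro w g \<noteq> 0}"
        using Q unfolding nz by (auto dest: finite_imageD[OF _ inj])
      moreover have "\<forall>g\<in>?I. fro w g \<in> U g" using Q kh by (auto simp: fro_def V_def cH)
      ultimately show ?thesis by (simp add: fro_def)
    qed
    have tofro: "to (fro w) = w" if "?Q w" for w
    proof
      fix n
      show "to (fro w) n = w n"
        using that hk[of n] by (cases "n \<in> carrier H") (simp_all add: to_def fro_def)
    qed
    from ex[of v] obtain w where w: "?P w" "\<And>w'. ?P w' \<Longrightarrow> w' = w" by (elim ex1E) blast
    show "\<exists>!w. ?Q w"
    proof (rule ex1I)
      show "?Q (to w)" by (rule PQ[OF w(1)])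
      fix w' assume "?Q w'"
      then show "w' = to w" using w(2)[OF QP] tofro by metis
    qed
  qed
  have "kac_grading H V"
    unfolding kac_grading_def
  proof (intro conjI comm dec ballI)
    show "\<exists>S. finite S \<and> S \<subseteq> carrier H \<and> generate H S = carrier H"
      using S gen[OF S(2,3)] by (intro exI[of _ "h ` S"]) (auto simp: cH)
    show "kac_mult u v \<in> V (m \<otimes>\<^bsub>H\<^esub> n)"
      if "m \<in> carrier H" "n \<in> carrier H" "u \<in> V m" "v \<in> V n" for m n u v
    proof -
      have "k (m \<otimes>\<^bsub>H\<^esub> n) = k m \<otimes>\<^bsub>G\<^esub> k n"
        using multH[of "k m" "k n"] hk that kh by simp
      then show ?thesis using assms hk that by (simp add: kac_grading_def V_def)
    qed
    show "generate H (support H V) = carrier H"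
      unfolding supp using assms by (intro gen) (auto simp: kac_grading_def support_def)
    show "V n = {a + b | a b. a \<in> V n \<inter> kac_even \<and> b \<in> V n \<inter> kac_odd}" if "n \<in> carrier H" for n
    proof -
      have "\<forall>g\<in>?I. U g = {a + b | a b. a \<in> U g \<inter> kac_even \<and> b \<in> U g \<inter> kac_odd}"
        using assms unfolding kac_grading_def by blast
      then show ?thesis unfolding V_def using hk(2)[OF that] by blast
    qed
  qed
  moreover have "V ` support H V = U ` support G U"
  proof -
    have "V (h g) = U g" if "g \<in> support G U" for g
      using that by (simp add: V_def kh support_def)
    then show ?thesis unfolding supp by (simp add: image_image)
  qed
  ultimately show ?thesis by (rule that)
qed

lemma fine_grading_no_refinement:
  assumes "fine_grading G U" "kac_grading H V"
  shows "\<not> proper_refinement H V G U"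
proof
  assume ref: "proper_refinement H V G U"
  obtain N :: "nat monoid" and W where N: "kac_grading N W" "W ` support N W = V ` support H V"
    by (rule kac_grading_nat[OF assms(2)])
  have "\<exists>g\<in>support G U. W n \<subseteq> U g" if "n \<in> support N W" for n
  proof -
    from that N(2) obtain h where "h \<in> support H V" "W n = V h" by (metis imageE imageI)
    with ref show ?thesis by (auto simp: proper_refinement_def)
  qed
  moreover have "\<exists>n\<in>support N W. \<exists>g\<in>support G U. W n \<subset> U g"
  proof -
    from ref obtain h g where h: "h \<in> support H V" "g \<in> support G U" "V h \<subset> U g"
      unfolding proper_refinement_def by blast
    with N(2) obtain n where "n \<in> support N W" "W n = V h" by (metis imageE imageI)
    with h show ?thesis by metis
  qed
  ultimately have "proper_refinement N W G U"
    by (simp add: proper_refinement_def)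
  then show False using assms(1) N(1) by (auto simp: fine_grading_def)
qed

text \<open>The list \<open>hs\<close> is the type \<open>(h\<^sub>1, \<dots>, h\<^sub>r)\<close>, hence the shift of the index.\<close>

definition grading_type ::
  "('g, 'm) monoid_scheme \<Rightarrow> ('g \<Rightarrow> 'a::field kac set) \<Rightarrow> nat list \<Rightarrow> bool" where
  "grading_type G U hs \<longleftrightarrow>
     finite (support G U) \<and>
     (\<forall>i\<in>{1..length hs}. card {g \<in> support G U. vec.dim (U g) = i} = hs ! (i - 1)) \<and>
     (\<forall>g\<in>support G U. vec.dim (U g) \<le> length hs)"


section \<open>Tori and toral gradings\<close>

definition diagonalizable :: "('a::field kac \<Rightarrow> 'a kac) \<Rightarrow> bool" where
  "diagonalizable f \<longleftrightarrow>
     (\<exists>B. vec.independent B \<and> vec.span B = UNIV \<and> (\<forall>v\<in>B. \<exists>c. f v = c *s v))"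

definition simultaneous_eigenspace ::
  "('a::field kac \<Rightarrow> 'a kac) set \<Rightarrow> (('a kac \<Rightarrow> 'a kac) \<Rightarrow> 'a) \<Rightarrow> 'a kac set" where
  "simultaneous_eigenspace S c = {v. \<forall>f\<in>S. f v = c f *s v}"

definition produced_by ::
  "('a::field kac \<Rightarrow> 'a kac) set \<Rightarrow> ('g, 'm) monoid_scheme \<Rightarrow> ('g \<Rightarrow> 'a kac set) \<Rightarrow> bool" where
  "produced_by S G U \<longleftrightarrow>
     S \<subseteq> kac_Aut \<and> (\<forall>f\<in>S. diagonalizable f) \<and> (\<forall>f\<in>S. \<forall>g\<in>S. f \<circ> g = g \<circ> f) \<and>
     U ` support G U = {E. E \<noteq> {0} \<and> (\<exists>c. E = simultaneous_eigenspace S c)}"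

text \<open>The algebra of functions generated by a set \<open>S\<close> of functions. A regular function on an affine
  variety is an element of the algebra generated by its coordinate functions.\<close>

inductive_set fun_algebra :: "('x \<Rightarrow> 'a::field) set \<Rightarrow> ('x \<Rightarrow> 'a) set"
  for S :: "('x \<Rightarrow> 'a) set" where
  const: "(\<lambda>_. c) \<in> fun_algebra S"
| gen: "p \<in> S \<Longrightarrow> p \<in> fun_algebra S"
| add: "p \<in> fun_algebra S \<Longrightarrow> q \<in> fun_algebra S \<Longrightarrow> (\<lambda>z. p z + q z) \<in> fun_algebra S"
| mult: "p \<in> fun_algebra S \<Longrightarrow> q \<in> fun_algebra S \<Longrightarrow> (\<lambda>z. p z * q z) \<in> fun_algebra S"

text \<open>The coordinate ring of \<open>GL(K\<^bsub>10\<^esub>)\<close> is generated by the matrix entries and \<open>1/det\<close>; that of its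
  closed subgroup \<^const>\<open>kac_Aut\<close> consists of the restrictions.\<close>

definition GL_regular :: "(('a::field kac \<Rightarrow> 'a kac) \<Rightarrow> 'a) set" where
  "GL_regular = fun_algebra ({\<lambda>f. matrix f $ i $ j | i j. True} \<union> {\<lambda>f. inverse (det (matrix f))})"

definition zariski_closed_in_Aut :: "('a::field kac \<Rightarrow> 'a kac) set \<Rightarrow> bool" where
  "zariski_closed_in_Aut T \<longleftrightarrow> (\<exists>P\<subseteq>GL_regular. T = {f \<in> kac_Aut. \<forall>p\<in>P. p f = 0})"

text \<open>\<open>split_torus m\<close> is \<open>(F\<^sup>\<times>)\<^sup>m\<close> with pointwise multiplication, a tuple being padded with ones from
  position \<open>m\<close> on.\<close>

definition split_torus :: "nat \<Rightarrow> (nat \<Rightarrow> 'a::field) set" where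
  "split_torus m = {t. (\<forall>i<m. t i \<noteq> 0) \<and> (\<forall>i\<ge>m. t i = 1)}"

definition split_torus_regular :: "nat \<Rightarrow> ((nat \<Rightarrow> 'a::field) \<Rightarrow> 'a) set" where
  "split_torus_regular m =
     fun_algebra ({\<lambda>t. t i | i. i < m} \<union> {\<lambda>t. inverse (t i) | i. i < m})"

text \<open>A torus is a closed subgroup isomorphic, as an algebraic group, to some \<open>(F\<^sup>\<times>)\<^sup>m\<close>. The last two
  conditions say that \<open>\<rho>\<close> and its inverse are morphisms of varieties. That \<open>T\<close> is a subgroup follows,
  as \<open>T\<close> is the image of the homomorphism \<open>\<rho>\<close>.\<close>

definition is_torus :: "('a::field kac \<Rightarrow> 'a kac) set \<Rightarrow> bool" where
  "is_torus T \<longleftrightarrow>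
     zariski_closed_in_Aut T \<and>
     (\<exists>m \<rho>. bij_betw \<rho> (split_torus m) T \<and>
        (\<forall>s\<in>split_torus m. \<forall>t\<in>split_torus m. \<rho> (\<lambda>i. s i * t i) = \<rho> s \<circ> \<rho> t) \<and>
        (\<forall>q\<in>GL_regular. \<exists>p\<in>split_torus_regular m. \<forall>t\<in>split_torus m. q (\<rho> t) = p t) \<and>
        (\<forall>p\<in>split_torus_regular m. \<exists>q\<in>GL_regular. \<forall>t\<in>split_torus m. q (\<rho> t) = p t))"

definition toral :: "('g, 'm) monoid_scheme \<Rightarrow> ('g \<Rightarrow> 'a::field kac set) \<Rightarrow> bool" where
  "toral G U \<longleftrightarrow> (\<exists>T S. is_torus T \<and> S \<subseteq> T \<and> produced_by S G U)"


section \<open>The two gradings\<close>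

abbreviation ZZ_group :: "(int \<times> int) monoid" where
  "ZZ_group \<equiv> integer_group \<times>\<times> integer_group"

abbreviation ZZ2_group :: "(int \<times> int) monoid" where
  "ZZ2_group \<equiv> integer_group \<times>\<times> integer_mod_group 2"

definition kac_ZZ_grading :: "int \<times> int \<Rightarrow> 'a::field kac set" where
  "kac_ZZ_grading g =
    (if g = (0, 0) then vec.span {kac_one, kap_e \<^bold>\<otimes> kap_e}
     else if g = (1, 1) then vec.span {kap_x \<^bold>\<otimes> kap_x}
     else if g = (1, -1) then vec.span {kap_x \<^bold>\<otimes> kap_y}
     else if g = (-1, 1) then vec.span {kap_y \<^bold>\<otimes> kap_x}
     else if g = (-1, -1) then vec.span {kap_y \<^bold>\<otimes> kap_y}
     else if g = (0, 1) then vec.span {kap_e \<^bold>\<otimes> kap_x}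
     else if g = (1, 0) then vec.span {kap_x \<^bold>\<otimes> kap_e}
     else if g = (0, -1) then vec.span {kap_e \<^bold>\<otimes> kap_y}
     else if g = (-1, 0) then vec.span {kap_y \<^bold>\<otimes> kap_e}
     else {0})"

definition kac_ZZ2_grading :: "int \<times> int \<Rightarrow> 'a::field kac set" where
  "kac_ZZ2_grading g =
    (if g = (0, 0) then
       vec.span {kac_one, kap_e \<^bold>\<otimes> kap_e, kap_x \<^bold>\<otimes> kap_y - kap_y \<^bold>\<otimes> kap_x}
     else if g = (-1, 1) then vec.span {kap_e \<^bold>\<otimes> kap_y - kap_y \<^bold>\<otimes> kap_e}
     else if g = (2, 1) then vec.span {kap_x \<^bold>\<otimes> kap_x}
     else if g = (-2, 1) then vec.span {kap_y \<^bold>\<otimes> kap_y}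
     else if g = (1, 1) then vec.span {kap_e \<^bold>\<otimes> kap_x - kap_x \<^bold>\<otimes> kap_e}
     else if g = (0, 1) then vec.span {kap_x \<^bold>\<otimes> kap_y + kap_y \<^bold>\<otimes> kap_x}
     else if g = (1, 0) then vec.span {kap_e \<^bold>\<otimes> kap_x + kap_x \<^bold>\<otimes> kap_e}
     else if g = (-1, 0) then vec.span {kap_e \<^bold>\<otimes> kap_y + kap_y \<^bold>\<otimes> kap_e}
     else {0})"

end

theory Submission
  imports Defs
begin

text \<open>Write \<open>E = e \<otimes> e\<close>, \<open>V = \<langle>x, y\<rangle>\<close>, and let \<open>a, b, c, d\<close> range over \<open>V\<close>. The odd part is \<open>V \<otimes> e + e \<otimes> V\<close>.
  In any grading \<open>1\<close> and \<open>E\<close> have neutral degree, so the \<open>V \<otimes> V\<close>-part of the product of two homogeneous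
  odd elements is again homogeneous, and the symplectic form on the odd part pairs only components of inverse
  degrees. If some \<open>a \<otimes> e\<close> or \<open>e \<otimes> b\<close> is homogeneous, multiplying with such products splits every homogeneous
  odd element into its two halves, and there are symplectic bases of both halves consisting of homogeneous
  elements: the grading is a coarsening of a conjugate of the first one. Otherwise, for a homogeneous
  \<open>m = a \<otimes> e + e \<otimes> b\<close> and a dual homogeneous \<open>n = c \<otimes> e + e \<otimes> d\<close>, comparing \<open>m\<close> with \<open>(m n) m\<close> forces
  \<open>(a|c) = (b|d)\<close>, and the eigenvectors of \<open>u \<mapsto> (m u) n\<close> turn out to be homogeneous: the grading is a coarsening
  of a conjugate of the second one. Both gradings are fine because their components other than the neutral
  one are lines, on which the neutral component acts faithfully.\<close>

section \<open>Coordinates\<close>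

text \<open>Two kinds of automorphism stand behind the two gradings. SL_2 x SL_2 acts on the two
  tensor factors (\<open>kac_lin\<close>), and the signed flip
  \<open>a \<otimes> b \<mapsto> (-1)^(|a||b|) b \<otimes> a\<close> exchanges them. The first
  grading records the weights of the torus of pairs of diagonal matrices; the second records the
  weights of the diagonally embedded one-dimensional torus together with the eigenvalues of the
  flip. The element \<open>E\<close> acts by 1/2 on the odd part and by 1/4 on
  \<open>V \<otimes> V\<close>. Once it is known to be neutral, multiplication by \<open>E\<close>
  separates the pieces of an even element without changing degrees. The dichotomy comes from one
  computation. Let \<open>w = a \<otimes> d - c \<otimes> b\<close>, which is four times the
  \<open>V \<otimes> V\<close>-part of \<open>m n\<close>. Then \<open>w m\<close> equals -1/2 times
  \<open>(b|d) a \<otimes> e + (a|c) e \<otimes> b\<close>. If the two scalars differ, a combination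
  of \<open>w m\<close> and \<open>m\<close> is a nonzero homogeneous element of one half; if they
  agree, \<open>m\<close> and \<open>n\<close> can be rescaled so that both pairs are symplectic
  bases.\<close>

abbreviation kac_E :: "'a::field kac" where "kac_E \<equiv> kap_e \<^bold>\<otimes> kap_e"

lemma kap_index_all: "(\<forall>i. P i) \<longleftrightarrow> P Ie \<and> P Ix \<and> P Iy"
  by (metis kap_index.exhaust)

lemma kac_index_all: "(\<forall>k :: (kap_index \<times> kap_index) option. P k) \<longleftrightarrow>
    P None \<and> P (Some (Ie,Ie)) \<and> P (Some (Ie,Ix)) \<and> P (Some (Ie,Iy)) \<and> P (Some (Ix,Ie)) \<and> P (Some (Ix,Ix))
    \<and> P (Some (Ix,Iy)) \<and> P (Some (Iy,Ie)) \<and> P (Some (Iy,Ix)) \<and> P (Some (Iy,Iy))"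
  unfolding split_option_all split_paired_All kap_index_all by blast

lemma kac_eq_iff: "(u :: 'a::field kac) = v \<longleftrightarrow>
    u $ None = v $ None \<and> u $ Some (Ie,Ie) = v $ Some (Ie,Ie) \<and> u $ Some (Ie,Ix) = v $ Some (Ie,Ix)
    \<and> u $ Some (Ie,Iy) = v $ Some (Ie,Iy) \<and> u $ Some (Ix,Ie) = v $ Some (Ix,Ie)
    \<and> u $ Some (Ix,Ix) = v $ Some (Ix,Ix) \<and> u $ Some (Ix,Iy) = v $ Some (Ix,Iy)
    \<and> u $ Some (Iy,Ie) = v $ Some (Iy,Ie) \<and> u $ Some (Iy,Ix) = v $ Some (Iy,Ix)
    \<and> u $ Some (Iy,Iy) = v $ Some (Iy,Iy)"
  unfolding vec_eq_iff by (rule kac_index_all)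

lemma kac_mult_add_left: "kac_mult (u + v) w = kac_mult u w + kac_mult v w"
  by (simp add: kac_mult_def distrib_right vec.scale_left_distrib sum.distrib)

lemma kac_mult_add_right: "kac_mult w (u + v) = kac_mult w u + kac_mult w v"
  by (simp add: kac_mult_def distrib_left vec.scale_left_distrib sum.distrib)

lemma kac_mult_scale_left: "kac_mult (c *s u) w = c *s kac_mult u w"
  by (simp add: kac_mult_def vec.scale_sum_right vector_smult_assoc mult.assoc)

lemma kac_mult_scale_right: "kac_mult w (c *s u) = c *s kac_mult w u"
  by (simp add: kac_mult_def vec.scale_sum_right vector_smult_assoc mult.assoc mult.left_commute)

lemma kac_mult_linear_left: "Vector_Spaces.linear (*s) (*s) (\<lambda>u. kac_mult u w)"
  by unfold_locales (simp_all add: kac_mult_add_left kac_mult_scale_left)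

lemma kac_mult_linear_right: "Vector_Spaces.linear (*s) (*s) (kac_mult w)"
  by unfold_locales (simp_all add: kac_mult_add_right kac_mult_scale_right)

lemma tensor_nth [simp]: "(a \<^bold>\<otimes> b) $ None = 0" "(a \<^bold>\<otimes> b) $ Some (i, j) = a $ i * b $ j"
  by (simp_all add: kac_tensor_def)

lemma kap_basis_nth [simp]:
  "kap_e $ Ie = 1" "kap_e $ Ix = 0" "kap_e $ Iy = 0"
  "kap_x $ Ie = 0" "kap_x $ Ix = 1" "kap_x $ Iy = 0"
  "kap_y $ Ie = 0" "kap_y $ Ix = 0" "kap_y $ Iy = 1"
  by (simp_all add: kap_e_def kap_x_def kap_y_def axis_def)

lemma kac_one_nth [simp]: "kac_one $ None = 1" "kac_one $ Some p = 0"
  by (simp_all add: kac_one_def axis_def)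

lemma kap_mult_axis_nth:
  "kap_mult (axis Ie 1) (axis Ie 1) $ Ie = (1 :: 'a::field_char_0)"
  "kap_mult (axis Ie 1) (axis Ie 1) $ Ix = (0 :: 'a::field_char_0)"
  "kap_mult (axis Ie 1) (axis Ie 1) $ Iy = (0 :: 'a::field_char_0)"
  "kap_mult (axis Ie 1) (axis Ix 1) $ Ie = (0 :: 'a::field_char_0)"
  "kap_mult (axis Ie 1) (axis Ix 1) $ Ix = (1/2 :: 'a::field_char_0)"
  "kap_mult (axis Ie 1) (axis Ix 1) $ Iy = (0 :: 'a::field_char_0)"
  "kap_mult (axis Ie 1) (axis Iy 1) $ Ie = (0 :: 'a::field_char_0)"
  "kap_mult (axis Ie 1) (axis Iy 1) $ Ix = (0 :: 'a::field_char_0)"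
  "kap_mult (axis Ie 1) (axis Iy 1) $ Iy = (1/2 :: 'a::field_char_0)"
  "kap_mult (axis Ix 1) (axis Ie 1) $ Ie = (0 :: 'a::field_char_0)"
  "kap_mult (axis Ix 1) (axis Ie 1) $ Ix = (1/2 :: 'a::field_char_0)"
  "kap_mult (axis Ix 1) (axis Ie 1) $ Iy = (0 :: 'a::field_char_0)"
  "kap_mult (axis Ix 1) (axis Ix 1) $ Ie = (0 :: 'a::field_char_0)"
  "kap_mult (axis Ix 1) (axis Ix 1) $ Ix = (0 :: 'a::field_char_0)"
  "kap_mult (axis Ix 1) (axis Ix 1) $ Iy = (0 :: 'a::field_char_0)"
  "kap_mult (axis Ix 1) (axis Iy 1) $ Ie = (1 :: 'a::field_char_0)"
  "kap_mult (axis Ix 1) (axis Iy 1) $ Ix = (0 :: 'a::field_char_0)"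
  "kap_mult (axis Ix 1) (axis Iy 1) $ Iy = (0 :: 'a::field_char_0)"
  "kap_mult (axis Iy 1) (axis Ie 1) $ Ie = (0 :: 'a::field_char_0)"
  "kap_mult (axis Iy 1) (axis Ie 1) $ Ix = (0 :: 'a::field_char_0)"
  "kap_mult (axis Iy 1) (axis Ie 1) $ Iy = (1/2 :: 'a::field_char_0)"
  "kap_mult (axis Iy 1) (axis Ix 1) $ Ie = (-1 :: 'a::field_char_0)"
  "kap_mult (axis Iy 1) (axis Ix 1) $ Ix = (0 :: 'a::field_char_0)"
  "kap_mult (axis Iy 1) (axis Ix 1) $ Iy = (0 :: 'a::field_char_0)"
  "kap_mult (axis Iy 1) (axis Iy 1) $ Ie = (0 :: 'a::field_char_0)"
  "kap_mult (axis Iy 1) (axis Iy 1) $ Ix = (0 :: 'a::field_char_0)"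
  "kap_mult (axis Iy 1) (axis Iy 1) $ Iy = (0 :: 'a::field_char_0)"
  by (simp_all add: kap_mult_def axis_def)

lemma kap_form_axis:
  "kap_form (axis Ie 1) (axis Ie 1) = (1/2 :: 'a::field_char_0)"
  "kap_form (axis Ie 1) (axis Ix 1) = (0 :: 'a::field_char_0)"
  "kap_form (axis Ie 1) (axis Iy 1) = (0 :: 'a::field_char_0)"
  "kap_form (axis Ix 1) (axis Ie 1) = (0 :: 'a::field_char_0)"
  "kap_form (axis Ix 1) (axis Ix 1) = (0 :: 'a::field_char_0)"
  "kap_form (axis Ix 1) (axis Iy 1) = (1 :: 'a::field_char_0)"
  "kap_form (axis Iy 1) (axis Ie 1) = (0 :: 'a::field_char_0)"
  "kap_form (axis Iy 1) (axis Ix 1) = (-1 :: 'a::field_char_0)"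
  "kap_form (axis Iy 1) (axis Iy 1) = (0 :: 'a::field_char_0)"
  by (simp_all add: kap_form_def axis_def)

lemma axis_nth_if: "axis k c $ t = (if t = k then c else 0)"
  by (simp add: axis_def)

lemma kac_basis_mult_nth:
  "kac_basis_mult (Some (i, j)) (Some (k, l)) $ None =
     - ((-1) ^ (kap_parity j * kap_parity k) * (3/4 * kap_form (axis i 1) (axis k 1) * kap_form (axis j 1) (axis l 1)))"
  "kac_basis_mult (Some (i, j)) (Some (k, l)) $ Some (p, q) =
     (-1) ^ (kap_parity j * kap_parity k) *
     (kap_mult (axis i 1) (axis k 1) $ p * kap_mult (axis j 1) (axis l 1) $ q)"
  "kac_basis_mult None l' $ t = (if t = l' then 1 else 0)"
  "kac_basis_mult k' None $ t = (if t = k' then 1 else 0)"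
  by (simp add: axis_nth_if; fail | cases k'; simp add: axis_nth_if; fail)+

text \<open>The structure constants written out, so that identities between explicit products become
  polynomial identities in the ten coordinates, within reach of \<open>simp\<close>.\<close>

lemma kac_mult_nth:
  fixes u v :: "'a::field_char_0 kac"
  shows
    "kac_mult u v $ None =
      u $ None * v $ None - 3/16 * (u $ Some (Ie,Ie) * v $ Some (Ie,Ie)) - 3/8 * (u $ Some (Ie,Ix) *
      v $ Some (Ie,Iy)) + 3/8 * (u $ Some (Ie,Iy) * v $ Some (Ie,Ix)) - 3/8 * (u $ Some (Ix,Ie) * v $
      Some (Iy,Ie)) + 3/4 * (u $ Some (Ix,Ix) * v $ Some (Iy,Iy)) - 3/4 * (u $ Some (Ix,Iy) * v $
      Some (Iy,Ix)) + 3/8 * (u $ Some (Iy,Ie) * v $ Some (Ix,Ie)) - 3/4 * (u $ Some (Iy,Ix) * v $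
      Some (Ix,Iy)) + 3/4 * (u $ Some (Iy,Iy) * v $ Some (Ix,Ix))"
    "kac_mult u v $ Some (Ie,Ie) =
      u $ None * v $ Some (Ie,Ie) + u $ Some (Ie,Ie) * v $ None + u $ Some (Ie,Ie) * v $ Some (Ie,Ie)
      + u $ Some (Ie,Ix) * v $ Some (Ie,Iy) - u $ Some (Ie,Iy) * v $ Some (Ie,Ix) + u $ Some (Ix,Ie)
      * v $ Some (Iy,Ie) - u $ Some (Ix,Ix) * v $ Some (Iy,Iy) + u $ Some (Ix,Iy) * v $ Some (Iy,Ix)
      - u $ Some (Iy,Ie) * v $ Some (Ix,Ie) + u $ Some (Iy,Ix) * v $ Some (Ix,Iy) - u $ Some (Iy,Iy)
      * v $ Some (Ix,Ix)"
    "kac_mult u v $ Some (Ie,Ix) =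
      u $ None * v $ Some (Ie,Ix) + 1/2 * (u $ Some (Ie,Ie) * v $ Some (Ie,Ix)) + u $ Some (Ie,Ix) *
      v $ None + 1/2 * (u $ Some (Ie,Ix) * v $ Some (Ie,Ie)) + 1/2 * (u $ Some (Ix,Ie) * v $ Some
      (Iy,Ix)) - 1/2 * (u $ Some (Ix,Ix) * v $ Some (Iy,Ie)) - 1/2 * (u $ Some (Iy,Ie) * v $ Some
      (Ix,Ix)) + 1/2 * (u $ Some (Iy,Ix) * v $ Some (Ix,Ie))"
    "kac_mult u v $ Some (Ie,Iy) =
      u $ None * v $ Some (Ie,Iy) + 1/2 * (u $ Some (Ie,Ie) * v $ Some (Ie,Iy)) + u $ Some (Ie,Iy) *
      v $ None + 1/2 * (u $ Some (Ie,Iy) * v $ Some (Ie,Ie)) + 1/2 * (u $ Some (Ix,Ie) * v $ Some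
      (Iy,Iy)) - 1/2 * (u $ Some (Ix,Iy) * v $ Some (Iy,Ie)) - 1/2 * (u $ Some (Iy,Ie) * v $ Some
      (Ix,Iy)) + 1/2 * (u $ Some (Iy,Iy) * v $ Some (Ix,Ie))"
    "kac_mult u v $ Some (Ix,Ie) =
      u $ None * v $ Some (Ix,Ie) + 1/2 * (u $ Some (Ie,Ie) * v $ Some (Ix,Ie)) - 1/2 * (u $ Some
      (Ie,Ix) * v $ Some (Ix,Iy)) + 1/2 * (u $ Some (Ie,Iy) * v $ Some (Ix,Ix)) + u $ Some (Ix,Ie) *
      v $ None + 1/2 * (u $ Some (Ix,Ie) * v $ Some (Ie,Ie)) + 1/2 * (u $ Some (Ix,Ix) * v $ Some
      (Ie,Iy)) - 1/2 * (u $ Some (Ix,Iy) * v $ Some (Ie,Ix))"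
    "kac_mult u v $ Some (Ix,Ix) =
      u $ None * v $ Some (Ix,Ix) + 1/4 * (u $ Some (Ie,Ie) * v $ Some (Ix,Ix)) - 1/4 * (u $ Some
      (Ie,Ix) * v $ Some (Ix,Ie)) + 1/4 * (u $ Some (Ix,Ie) * v $ Some (Ie,Ix)) + u $ Some (Ix,Ix) *
      v $ None + 1/4 * (u $ Some (Ix,Ix) * v $ Some (Ie,Ie))"
    "kac_mult u v $ Some (Ix,Iy) =
      u $ None * v $ Some (Ix,Iy) + 1/4 * (u $ Some (Ie,Ie) * v $ Some (Ix,Iy)) - 1/4 * (u $ Some
      (Ie,Iy) * v $ Some (Ix,Ie)) + 1/4 * (u $ Some (Ix,Ie) * v $ Some (Ie,Iy)) + u $ Some (Ix,Iy) *
      v $ None + 1/4 * (u $ Some (Ix,Iy) * v $ Some (Ie,Ie))"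
    "kac_mult u v $ Some (Iy,Ie) =
      u $ None * v $ Some (Iy,Ie) + 1/2 * (u $ Some (Ie,Ie) * v $ Some (Iy,Ie)) - 1/2 * (u $ Some
      (Ie,Ix) * v $ Some (Iy,Iy)) + 1/2 * (u $ Some (Ie,Iy) * v $ Some (Iy,Ix)) + u $ Some (Iy,Ie) *
      v $ None + 1/2 * (u $ Some (Iy,Ie) * v $ Some (Ie,Ie)) + 1/2 * (u $ Some (Iy,Ix) * v $ Some
      (Ie,Iy)) - 1/2 * (u $ Some (Iy,Iy) * v $ Some (Ie,Ix))"
    "kac_mult u v $ Some (Iy,Ix) =
      u $ None * v $ Some (Iy,Ix) + 1/4 * (u $ Some (Ie,Ie) * v $ Some (Iy,Ix)) - 1/4 * (u $ Some
      (Ie,Ix) * v $ Some (Iy,Ie)) + 1/4 * (u $ Some (Iy,Ie) * v $ Some (Ie,Ix)) + u $ Some (Iy,Ix) *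
      v $ None + 1/4 * (u $ Some (Iy,Ix) * v $ Some (Ie,Ie))"
    "kac_mult u v $ Some (Iy,Iy) =
      u $ None * v $ Some (Iy,Iy) + 1/4 * (u $ Some (Ie,Ie) * v $ Some (Iy,Iy)) - 1/4 * (u $ Some
      (Ie,Iy) * v $ Some (Iy,Ie)) + 1/4 * (u $ Some (Iy,Ie) * v $ Some (Ie,Iy)) + u $ Some (Iy,Iy) *
      v $ None + 1/4 * (u $ Some (Iy,Iy) * v $ Some (Ie,Ie))"
  unfolding kac_mult_def sum_UNIV_kac_index sum_UNIV_kap_index vector_add_component vector_smult_component
  by (simp_all add: kac_basis_mult_nth kap_mult_axis_nth kap_form_axis axis_nth_if mult.commute)

section \<open>Odd elements as pairs of vectors of \<open>V\<close>, and their products\<close>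

definition kac_lift :: "'a::field kap \<Rightarrow> 'a kap \<Rightarrow> 'a kac" where
  "kac_lift a b = a \<^bold>\<otimes> kap_e + kap_e \<^bold>\<otimes> b"

text \<open>On \<open>V\<close> the Kaplansky product is \<open>a c = (a|c) e\<close>, so
  \<open>(a \<otimes> e)(c \<otimes> e)\<close> is \<open>(a|c)\<close> times \<open>kac_K\<close>;
  the constant is 3/8 = 3/4 * \<open>(e|e)\<close>. The same element arises from the other
  half.\<close>

definition kac_K :: "'a::field kac" where
  "kac_K = kac_E - (3/8) *s kac_one"

lemma kac_lift_nth:
  assumes "a $ Ie = 0" "b $ Ie = 0"
  shows "kac_lift a b $ None = 0" "kac_lift a b $ Some (Ie,Ie) = 0"
    "kac_lift a b $ Some (Ie,Ix) = b $ Ix" "kac_lift a b $ Some (Ie,Iy) = b $ Iy"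
    "kac_lift a b $ Some (Ix,Ie) = a $ Ix" "kac_lift a b $ Some (Iy,Ie) = a $ Iy"
    "kac_lift a b $ Some (Ix,Ix) = 0" "kac_lift a b $ Some (Ix,Iy) = 0"
    "kac_lift a b $ Some (Iy,Ix) = 0" "kac_lift a b $ Some (Iy,Iy) = 0"
  using assms by (simp_all add: kac_lift_def)

lemma kac_K_nth:
  "kac_K $ None = -(3/8)" "kac_K $ Some (Ie,Ie) = 1"
  "kac_K $ Some (Ie,Ix) = 0" "kac_K $ Some (Ie,Iy) = 0"
  "kac_K $ Some (Ix,Ie) = 0" "kac_K $ Some (Iy,Ie) = 0"
  "kac_K $ Some (Ix,Ix) = 0" "kac_K $ Some (Ix,Iy) = 0"
  "kac_K $ Some (Iy,Ix) = 0" "kac_K $ Some (Iy,Iy) = 0"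
  by (simp_all add: kac_K_def)

lemma kac_lift_mult:
  fixes a b c d :: "'a::field_char_0 kap"
  assumes "a $ Ie = 0" "b $ Ie = 0" "c $ Ie = 0" "d $ Ie = 0"
  shows "kac_mult (kac_lift a b) (kac_lift c d) =
    (kap_form a c + kap_form b d) *s kac_K + (1/4) *s (a \<^bold>\<otimes> d - c \<^bold>\<otimes> b)"
  using assms by (simp add: kac_eq_iff kac_mult_nth kac_lift_nth kac_K_nth kap_form_def algebra_simps)

text \<open>\<open>V \<otimes> V\<close> exchanges the two halves of the odd part:
  \<open>a \<otimes> b\<close> sends \<open>c \<otimes> e\<close> to a multiple of
  \<open>e \<otimes> b\<close>, and \<open>e \<otimes> d\<close> to a multiple of
  \<open>a \<otimes> e\<close>. This is how single halves of homogeneous elements are extracted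
  later.\<close>

lemma kac_tensor_mult_lift:
  fixes a b c d :: "'a::field_char_0 kap"
  assumes "a $ Ie = 0" "b $ Ie = 0" "c $ Ie = 0" "d $ Ie = 0"
  shows "kac_mult (a \<^bold>\<otimes> b) (kac_lift c d) =
    kac_lift ((kap_form b d / 2) *s a) (- (kap_form a c / 2) *s b)"
  using assms by (simp add: kac_eq_iff kac_mult_nth kac_lift_nth kap_form_def field_simps)

lemma kac_E_mult_lift:
  fixes a b :: "'a::field_char_0 kap"
  assumes "a $ Ie = 0" "b $ Ie = 0"
  shows "kac_mult kac_E (kac_lift a b) = (1/2) *s kac_lift a b"
  using assms by (simp add: kac_eq_iff kac_mult_nth kac_lift_nth)

section \<open>The even and odd parts in coordinates\<close>

lemma kac_even_iff: "v \<in> kac_even \<longleftrightarrow> v $ Some (Ie,Ix) = 0 \<and> v $ Some (Ie,Iy) = 0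
    \<and> v $ Some (Ix,Ie) = 0 \<and> v $ Some (Iy,Ie) = 0" (is "_ \<longleftrightarrow> ?P v")
proof
  assume "v \<in> kac_even"
  then show "?P v" unfolding kac_even_def
    by (induction rule: vec.span_induct_alt) auto
next
  assume "?P v"
  then have "v = v $ None *s kac_one + v $ Some (Ie,Ie) *s kap_e \<^bold>\<otimes> kap_e
      + v $ Some (Ix,Ix) *s kap_x \<^bold>\<otimes> kap_x + v $ Some (Ix,Iy) *s kap_x \<^bold>\<otimes> kap_y
      + v $ Some (Iy,Ix) *s kap_y \<^bold>\<otimes> kap_x + v $ Some (Iy,Iy) *s kap_y \<^bold>\<otimes> kap_y"
    by (simp add: kac_eq_iff)
  also have "\<dots> \<in> kac_even" unfolding kac_even_def
    by (intro vec.span_add vec.span_scale vec.span_base) auto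
  finally show "v \<in> kac_even" .
qed

lemma kac_odd_iff: "v \<in> kac_odd \<longleftrightarrow> v $ None = 0 \<and> v $ Some (Ie,Ie) = 0 \<and> v $ Some (Ix,Ix) = 0
    \<and> v $ Some (Ix,Iy) = 0 \<and> v $ Some (Iy,Ix) = 0 \<and> v $ Some (Iy,Iy) = 0" (is "_ \<longleftrightarrow> ?P v")
proof
  assume "v \<in> kac_odd"
  then show "?P v" unfolding kac_odd_def
    by (induction rule: vec.span_induct_alt) auto
next
  assume "?P v"
  then have "v = v $ Some (Ie,Ix) *s kap_e \<^bold>\<otimes> kap_x + v $ Some (Ix,Ie) *s kap_x \<^bold>\<otimes> kap_e
      + v $ Some (Ie,Iy) *s kap_e \<^bold>\<otimes> kap_y + v $ Some (Iy,Ie) *s kap_y \<^bold>\<otimes> kap_e"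
    by (simp add: kac_eq_iff)
  also have "\<dots> \<in> kac_odd" unfolding kac_odd_def
    by (intro vec.span_add vec.span_scale vec.span_base) auto
  finally show "v \<in> kac_odd" .
qed

lemma subspace_kac_even: "vec.subspace kac_even"
  unfolding kac_even_def by (rule vec.subspace_span)

lemma subspace_kac_odd: "vec.subspace kac_odd"
  unfolding kac_odd_def by (rule vec.subspace_span)

lemma kac_lift_odd: "a $ Ie = 0 \<Longrightarrow> b $ Ie = 0 \<Longrightarrow> kac_lift a b \<in> kac_odd"
  by (simp add: kac_odd_iff kac_lift_nth)

lemma kac_oddE:
  assumes "m \<in> kac_odd"
  obtains a b where "a $ Ie = 0" "b $ Ie = 0" "m = kac_lift a b"
proof
  let ?a = "m $ Some (Ix,Ie) *s kap_x + m $ Some (Iy,Ie) *s kap_y"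
  let ?b = "m $ Some (Ie,Ix) *s kap_x + m $ Some (Ie,Iy) *s kap_y"
  show "?a $ Ie = 0" "?b $ Ie = 0" by simp_all
  then show "m = kac_lift ?a ?b" using assms by (simp add: kac_eq_iff kac_lift_nth kac_odd_iff)
qed

lemma kac_E_even: "kac_E \<in> kac_even"
  by (simp add: kac_even_iff)

lemma kac_even_odd_unique:
  assumes "a \<in> kac_even" "b \<in> kac_odd" "a' \<in> kac_even" "b' \<in> kac_odd" "a + b = a' + b'"
  shows "a = a'" "b = b'"
  using assms by (auto simp: kac_even_iff kac_odd_iff kac_eq_iff)

lemma kac_E_mult_odd: "m \<in> kac_odd \<Longrightarrow> kac_mult kac_E m = (1/2 :: 'a::field_char_0) *s m"
  by (metis kac_oddE kac_E_mult_lift)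

text \<open>On the odd part \<open>1\<close> and \<open>E\<close> act by the scalars 1 and 1/2,
  whereas \<open>V \<otimes> V\<close> exchanges the halves and acts faithfully. Hence the
  \<open>V \<otimes> V\<close>-part vanishes and the two scalars cancel.\<close>

lemma kac_even_annihilates_odd:
  fixes u :: "'a::field_char_0 kac"
  assumes u: "u \<in> kac_even" and ann: "\<And>m. m \<in> kac_odd \<Longrightarrow> kac_mult u m = 0"
  shows "\<exists>c. u = c *s (kac_one - 2 *s kac_E)"
proof -
  have n: "kac_mult u m $ k = 0" if "m \<in> kac_odd" for m k using ann[OF that] by simp
  have m: "kap_e \<^bold>\<otimes> kap_x \<in> kac_odd" "kap_e \<^bold>\<otimes> kap_y \<in> kac_odd"
    by (simp_all add: kac_odd_iff)
  have 1: "u $ Some (Ix,Ix) = 0" "u $ Some (Ix,Iy) = 0" "u $ Some (Iy,Ix) = 0" "u $ Some (Iy,Iy) = 0"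
    using n[OF m(2), of "Some (Ix,Ie)"] n[OF m(1), of "Some (Ix,Ie)"]
      n[OF m(2), of "Some (Iy,Ie)"] n[OF m(1), of "Some (Iy,Ie)"] u
    by (simp_all add: kac_mult_nth kac_even_iff)
  have 2: "2 * u $ None + u $ Some (Ie,Ie) = 0"
    using n[OF m(1), of "Some (Ie,Ix)"] u by (simp add: kac_mult_nth kac_even_iff field_simps)
  have "u = u $ None *s (kac_one - 2 *s kac_E)"
    using u 1 2 by (simp add: kac_eq_iff kac_even_iff eq_neg_iff_add_eq_0 algebra_simps)
  then show ?thesis by blast
qed

text \<open>Multiplication by \<open>4 E\<close> is the identity on \<open>V \<otimes> V\<close>,
  sends \<open>1\<close> to \<open>4 E\<close> and sends \<open>E\<close> to
  \<open>4 E - 3/4\<close>. Subtracting the identity therefore leaves an operator of rank one with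
  image spanned by \<open>4 E - 1\<close>.\<close>

lemma kac_even_E_mult:
  fixes v :: "'a::field_char_0 kac"
  assumes "v \<in> kac_even"
  shows "4 *s kac_mult kac_E v - v = (v $ None + 3/4 * v $ Some (Ie,Ie)) *s (4 *s kac_E - kac_one)"
  using assms by (simp add: kac_eq_iff kac_mult_nth kac_even_iff field_simps)

section \<open>Automorphisms from a pair of symplectic bases\<close>

fun kap_basis_map :: "'a::field kap \<Rightarrow> 'a kap \<Rightarrow> kap_index \<Rightarrow> 'a kap" where
  "kap_basis_map a c Ie = kap_e"
| "kap_basis_map a c Ix = a"
| "kap_basis_map a c Iy = c"

definition kap_lin :: "'a::field kap \<Rightarrow> 'a kap \<Rightarrow> 'a kap \<Rightarrow> 'a kap" where
  "kap_lin a c v = v $ Ie *s kap_e + v $ Ix *s a + v $ Iy *s c"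

text \<open>The action of the pair of matrices with columns \<open>a\<close>, \<open>c\<close> and
  \<open>p\<close>, \<open>q\<close> on the two tensor factors, with \<open>e\<close> and
  \<open>1\<close> fixed. For symplectic bases both matrices lie in SL_2.\<close>

definition kac_lin :: "'a::field kap \<Rightarrow> 'a kap \<Rightarrow> 'a kap \<Rightarrow> 'a kap \<Rightarrow> 'a kac \<Rightarrow> 'a kac" where
  "kac_lin a c p q v = v $ None *s kac_one +
     (\<Sum>i\<in>UNIV. \<Sum>j\<in>UNIV. v $ Some (i, j) *s (kap_basis_map a c i \<^bold>\<otimes> kap_basis_map p q j))"

lemma kap_eq_iff: "(u :: 'a kap) = v \<longleftrightarrow> u $ Ie = v $ Ie \<and> u $ Ix = v $ Ix \<and> u $ Iy = v $ Iy"
  unfolding vec_eq_iff by (rule kap_index_all)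

lemma kap_lin_basis [simp]: "kap_lin a c kap_e = kap_e" "kap_lin a c kap_x = a" "kap_lin a c kap_y = c"
  by (simp_all add: kap_lin_def)

lemma kac_lin_linear: "Vector_Spaces.linear (*s) (*s) (kac_lin a c p q)"
  by unfold_locales (simp_all add: kac_lin_def vec.scale_left_distrib sum.distrib vec.scale_right_distrib
      vec.scale_sum_right vector_smult_assoc)

lemma kac_lin_one [simp]: "kac_lin a c p q kac_one = kac_one"
  by (simp add: kac_lin_def)

lemma kac_lin_tensor: "kac_lin a c p q (u \<^bold>\<otimes> v) = kap_lin a c u \<^bold>\<otimes> kap_lin p q v"
  by (simp add: kac_eq_iff kac_lin_def kap_lin_def sum_UNIV_kap_index algebra_simps)

lemma kac_axis_None: "axis None 1 = kac_one"
  by (simp add: kac_one_def)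

lemma kac_axis_Some: "axis (Some (i, j)) 1 = (axis i 1 \<^bold>\<otimes> axis j 1 :: 'a::field kac)"
  unfolding vec_eq_iff split_option_all by (simp add: axis_nth_if split_paired_All)

lemma kac_linear_eqI:
  fixes f g :: "'a::field kac \<Rightarrow> 'a kac"
  assumes "Vector_Spaces.linear (*s) (*s) f" "Vector_Spaces.linear (*s) (*s) g"
    and "f kac_one = g kac_one" "\<And>i j. f (axis i 1 \<^bold>\<otimes> axis j 1) = g (axis i 1 \<^bold>\<otimes> axis j 1)"
  shows "f v = g v"
proof -
  interpret f: Vector_Spaces.linear "(*s)" "(*s)" f by fact
  interpret g: Vector_Spaces.linear "(*s)" "(*s)" g by fact
  have "f (axis k 1) = g (axis k 1)" for k
    by (cases k) (auto simp: kac_axis_None kac_axis_Some assms)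
  then have "f (\<Sum>k\<in>UNIV. v $ k *s axis k 1) = g (\<Sum>k\<in>UNIV. v $ k *s axis k 1)"
    by (simp add: f.sum g.sum f.scale g.scale)
  then show ?thesis by (simp add: basis_expansion)
qed

lemma linear_compose_kac:
  fixes f g :: "'a::field kac \<Rightarrow> 'a kac"
  assumes "Vector_Spaces.linear (*s) (*s) f" "Vector_Spaces.linear (*s) (*s) g"
  shows "Vector_Spaces.linear (*s) (*s) (\<lambda>v. f (g v))"
proof -
  interpret f: Vector_Spaces.linear "(*s)" "(*s)" f by fact
  interpret g: Vector_Spaces.linear "(*s)" "(*s)" g by fact
  show ?thesis by unfold_locales (simp_all add: f.add f.scale g.add g.scale)
qed

lemma linear_ident_kac: "Vector_Spaces.linear (*s) (*s) (\<lambda>v :: 'a::field kac. v)"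
  by unfold_locales simp_all

lemma kac_hom_basis:
  fixes f :: "'a::field kac \<Rightarrow> 'a kac"
  assumes "Vector_Spaces.linear (*s) (*s) f" "f kac_one = kac_one"
    and "\<And>i j k l. f (kac_mult (axis i 1 \<^bold>\<otimes> axis j 1) (axis k 1 \<^bold>\<otimes> axis l 1)) =
           kac_mult (f (axis i 1 \<^bold>\<otimes> axis j 1)) (f (axis k 1 \<^bold>\<otimes> axis l 1))"
  shows "f (kac_mult u v) = kac_mult (f u) (f v)"
proof (rule kac_linear_eqI[where v = u])
  note lin = linear_compose_kac[OF assms(1) kac_mult_linear_left] linear_compose_kac[OF kac_mult_linear_left assms(1)]
    linear_compose_kac[OF assms(1) kac_mult_linear_right] linear_compose_kac[OF kac_mult_linear_right assms(1)]
  show "Vector_Spaces.linear (*s) (*s) (\<lambda>u. f (kac_mult u v))"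
    "Vector_Spaces.linear (*s) (*s) (\<lambda>u. kac_mult (f u) (f v))"
    by (rule lin)+
  show "f (kac_mult kac_one v) = kac_mult (f kac_one) (f v)"
    by (simp add: assms kac_mult_one)
  show "f (kac_mult (axis i 1 \<^bold>\<otimes> axis j 1) v) = kac_mult (f (axis i 1 \<^bold>\<otimes> axis j 1)) (f v)" for i j
    by (rule kac_linear_eqI[where v = v]) (simp_all add: lin assms kac_mult_one)
qed

text \<open>The product of two vectors of \<open>V\<close> is their form times \<open>e\<close>, and
  \<open>e\<close> acts on \<open>V\<close> by 1/2. So a linear map fixing \<open>e\<close> and
  preserving the form on \<open>V\<close> preserves the product.\<close>

lemma kap_lin_hom:
  assumes "a $ Ie = 0" "c $ Ie = 0" "kap_form a c = (1 :: 'a::field_char_0)"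
  shows "kap_lin a c (kap_mult u v) = kap_mult (kap_lin a c u) (kap_lin a c v)"
    "kap_form (kap_lin a c u) (kap_lin a c v) = kap_form u v"
proof -
  from assms have d: "a $ Ix * c $ Iy = 1 + a $ Iy * c $ Ix" by (simp add: kap_form_def diff_eq_eq)
  \<comment> \<open>The determinant relation as a rewrite rule; the extra factor \<open>t\<close>
    lets it fire inside longer products.\<close>
  have *: "a $ Ix * (c $ Iy * t) = t + a $ Iy * (c $ Ix * t)" for t
    using arg_cong[OF d, of "\<lambda>r. r * t"] by (simp add: algebra_simps)
  show "kap_form (kap_lin a c u) (kap_lin a c v) = kap_form u v"
    using assms(1,2) by (simp add: kap_form_def kap_lin_def algebra_simps *)
  show "kap_lin a c (kap_mult u v) = kap_mult (kap_lin a c u) (kap_lin a c v)"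
    using assms(1,2) by (simp add: kap_eq_iff kap_mult_def kap_lin_def field_simps *)
qed

lemma kap_part_1_iff: "v \<in> kap_part (Suc 0) \<longleftrightarrow> v $ Ie = 0"
proof
  assume "v $ Ie = 0"
  then have "v = v $ Ix *s kap_x + v $ Iy *s kap_y" by (simp add: kap_eq_iff)
  also have "\<dots> \<in> kap_part (Suc 0)" unfolding kap_part_def
    by (simp, intro vec.span_add vec.span_scale vec.span_base) auto
  finally show "v \<in> kap_part (Suc 0)" .
qed (use kap_part_components(3) in auto)

lemma kap_axis: "axis Ie 1 = kap_e" "axis Ix 1 = kap_x" "axis Iy 1 = kap_y"
  by (simp_all add: kap_e_def kap_x_def kap_y_def)

lemma kap_lin_part:
  assumes "a $ Ie = 0" "c $ Ie = 0"
  shows "kap_lin a c (axis i 1) \<in> kap_part (kap_parity i)"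
proof (cases i)
  case Ie
  then show ?thesis by (auto simp: kap_axis kap_part_def intro: vec.span_base)
qed (simp_all add: kap_axis kap_part_1_iff assms)

lemma kap_parity_le: "kap_parity i \<le> 1"
  by (cases i) simp_all

lemma kap_axis_part: "axis i 1 \<in> kap_part (kap_parity i)"
  using kap_lin_part[of kap_x kap_y i] by (cases i) (simp_all add: kap_axis)

lemma kac_lin_parity:
  assumes "a $ Ie = 0" "c $ Ie = 0" "p $ Ie = 0" "q $ Ie = 0"
  shows "v \<in> kac_even \<Longrightarrow> kac_lin a c p q v \<in> kac_even" "v \<in> kac_odd \<Longrightarrow> kac_lin a c p q v \<in> kac_odd"
  using assms by (simp_all add: kac_lin_def sum_UNIV_kap_index kac_even_iff kac_odd_iff)

lemma kac_lin_inverse: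
  assumes "a $ Ie = 0" "c $ Ie = 0" "p $ Ie = 0" "q $ Ie = 0" "kap_form a c = 1" "kap_form p q = 1"
  obtains a' c' p' q' where "a' $ Ie = 0" "c' $ Ie = 0" "p' $ Ie = 0" "q' $ Ie = 0"
    "\<And>v. kac_lin a' c' p' q' (kac_lin a c p q v) = v" "\<And>v. kac_lin a c p q (kac_lin a' c' p' q' v) = v"
proof -
  \<comment> \<open>\<open>?f\<close> and \<open>?g\<close> are the columns of the adjugate, which
    is the inverse because the determinant is 1.\<close>
  let ?f = "\<lambda>a c. c $ Iy *s kap_x - a $ Iy *s kap_y"
  let ?g = "\<lambda>a c. a $ Ix *s kap_y - c $ Ix *s kap_x"
  have inv: "kap_lin (?f a c) (?g a c) (kap_lin a c v) = v" "kap_lin a c (kap_lin (?f a c) (?g a c) v) = v"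
    if "a $ Ie = 0" "c $ Ie = 0" "kap_form a c = 1" for a c v :: "'a kap"
  proof -
    from that have d: "a $ Ix * c $ Iy = 1 + a $ Iy * c $ Ix" by (simp add: kap_form_def diff_eq_eq)
    have *: "a $ Ix * (c $ Iy * t) = t + a $ Iy * (c $ Ix * t)" for t
      using arg_cong[OF d, of "\<lambda>r. r * t"] by (simp add: algebra_simps)
    show "kap_lin (?f a c) (?g a c) (kap_lin a c v) = v" "kap_lin a c (kap_lin (?f a c) (?g a c) v) = v"
      using that by (simp_all add: kap_eq_iff kap_lin_def algebra_simps *)
  qed
  show ?thesis
  proof (rule that[of "?f a c" "?g a c" "?f p q" "?g p q"])
    show "kac_lin (?f a c) (?g a c) (?f p q) (?g p q) (kac_lin a c p q v) = v" for v
      by (rule kac_linear_eqI[where g = "\<lambda>v. v"])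
        (simp_all add: linear_compose_kac kac_lin_linear kac_lin_tensor inv assms linear_ident_kac)
    show "kac_lin a c p q (kac_lin (?f a c) (?g a c) (?f p q) (?g p q) v) = v" for v
      by (rule kac_linear_eqI[where g = "\<lambda>v. v"])
        (simp_all add: linear_compose_kac kac_lin_linear kac_lin_tensor inv assms linear_ident_kac)
  qed simp_all
qed

lemma kac_lin_Aut:
  fixes a c p q :: "'a::field_char_0 kap"
  assumes "a $ Ie = 0" "c $ Ie = 0" "p $ Ie = 0" "q $ Ie = 0" "kap_form a c = 1" "kap_form p q = 1"
  shows "kac_lin a c p q \<in> kac_Aut"
proof -
  let ?f = "kac_lin a c p q"
  interpret f: Vector_Spaces.linear "(*s)" "(*s)" ?f by (rule kac_lin_linear)
  obtain a' c' p' q' where inv: "a' $ Ie = 0" "c' $ Ie = 0" "p' $ Ie = 0" "q' $ Ie = 0"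
    "\<And>v. kac_lin a' c' p' q' (?f v) = v" "\<And>v. ?f (kac_lin a' c' p' q' v) = v"
    by (rule kac_lin_inverse[OF assms]) blast
  have "?f (kac_mult u v) = kac_mult (?f u) (?f v)" for u v
  proof (rule kac_hom_basis[OF kac_lin_linear])
    show "?f (kac_mult (axis i 1 \<^bold>\<otimes> axis j 1) (axis k 1 \<^bold>\<otimes> axis l 1)) =
        kac_mult (?f (axis i 1 \<^bold>\<otimes> axis j 1)) (?f (axis k 1 \<^bold>\<otimes> axis l 1))" for i j k l
      using assms
      by (simp add: kac_mult_tensor[OF kap_axis_part kap_axis_part kap_parity_le kap_parity_le]
          kac_lin_tensor kac_mult_tensor[OF kap_lin_part kap_lin_part kap_parity_le kap_parity_le]
          f.scale f.diff kap_lin_hom)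
  qed simp
  moreover have "bij ?f"
    by (rule o_bij[where g = "kac_lin a' c' p' q'"]) (auto simp: inv)
  moreover have "?f ` kac_even = kac_even" "?f ` kac_odd = kac_odd"
    using kac_lin_parity[OF assms(1-4)] kac_lin_parity[OF inv(1-4)] inv(6)
    by (auto intro!: subset_antisym) (metis image_eqI)+
  ultimately show ?thesis by (simp add: kac_Aut_def kac_lin_linear)
qed

section \<open>Homogeneous components\<close>

definition kac_even_part :: "'a::field kac \<Rightarrow> 'a kac" where
  "kac_even_part v = (\<chi> k. if k \<in> {Some (Ie,Ix), Some (Ie,Iy), Some (Ix,Ie), Some (Iy,Ie)} then 0 else v $ k)"

lemma kac_even_part:
  "kac_even_part v \<in> kac_even" "v - kac_even_part v \<in> kac_odd"
  "v \<in> kac_even \<Longrightarrow> kac_even_part v = v" "v \<in> kac_odd \<Longrightarrow> kac_even_part v = 0"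
  by (simp_all add: kac_even_part_def kac_even_iff kac_odd_iff kac_eq_iff)

lemma kac_even_part_linear: "Vector_Spaces.linear (*s) (*s) kac_even_part"
  by unfold_locales (auto simp: kac_even_part_def vec_eq_iff)

lemma linear_zero_kac: "Vector_Spaces.linear (*s) (*s) (\<lambda>v :: 'a::field kac. 0 :: 'a kac)"
  by unfold_locales simp_all

locale kac_graded = comm_group G for G :: "('g, 'm) monoid_scheme" (structure) +
  fixes U :: "'g \<Rightarrow> 'a::field_char_0 kac set"
  assumes grading: "kac_grading G U"
begin

lemma subspace_U: "g \<in> carrier G \<Longrightarrow> vec.subspace (U g)"
  using grading by (auto simp: kac_grading_def direct_decomposition_def)

lemma mult_U: "g \<in> carrier G \<Longrightarrow> h \<in> carrier G \<Longrightarrow> u \<in> U g \<Longrightarrow> v \<in> U h \<Longrightarrow> kac_mult u v \<in> U (g \<otimes> h)"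
  using grading by (auto simp: kac_grading_def)

lemma zero_U: "g \<in> carrier G \<Longrightarrow> 0 \<in> U g"
  and add_U: "g \<in> carrier G \<Longrightarrow> u \<in> U g \<Longrightarrow> v \<in> U g \<Longrightarrow> u + v \<in> U g"
  and diff_U: "g \<in> carrier G \<Longrightarrow> u \<in> U g \<Longrightarrow> v \<in> U g \<Longrightarrow> u - v \<in> U g"
  and scale_U: "g \<in> carrier G \<Longrightarrow> u \<in> U g \<Longrightarrow> c *s u \<in> U g"
  by (simp_all add: subspace_U vec.subspace_0 vec.subspace_add vec.subspace_diff vec.subspace_scale)

lemma scale_U_cancel: "g \<in> carrier G \<Longrightarrow> c *s u \<in> U g \<Longrightarrow> c \<noteq> 0 \<Longrightarrow> u \<in> U g"
  using scale_U[of g "c *s u" "inverse c"] by (simp add: vector_smult_assoc)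

text \<open>Projection to a homogeneous component. It is 0 outside the carrier, because the families
  in \<open>direct_decomposition\<close> are padded with 0 there.\<close>

definition hcomp :: "'g \<Rightarrow> 'a kac \<Rightarrow> 'a kac" where
  "hcomp g v = (THE w. (\<forall>g\<in>carrier G. w g \<in> U g) \<and> (\<forall>g. g \<notin> carrier G \<longrightarrow> w g = 0) \<and>
              finite {g. w g \<noteq> 0} \<and> v = (\<Sum>g | w g \<noteq> 0. w g)) g"

lemma ex1_implies_uniq: "\<exists>!x. P x \<Longrightarrow> P a \<Longrightarrow> P b \<Longrightarrow> a = b"
  by blast

lemma hcomp_ex1: "\<exists>!w. (\<forall>g\<in>carrier G. w g \<in> U g) \<and> (\<forall>g. g \<notin> carrier G \<longrightarrow> w g = 0) \<and>
              finite {g. w g \<noteq> 0} \<and> v = (\<Sum>g | w g \<noteq> 0. w g)"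
  using grading by (simp add: kac_grading_def direct_decomposition_def)

lemma hcomp_props: "(\<forall>g\<in>carrier G. hcomp g v \<in> U g) \<and> (\<forall>g. g \<notin> carrier G \<longrightarrow> hcomp g v = 0) \<and>
              finite {g. hcomp g v \<noteq> 0} \<and> v = (\<Sum>g | hcomp g v \<noteq> 0. hcomp g v)"
  using theI'[OF hcomp_ex1[of v]] by (simp add: hcomp_def)

lemma hcomp_in: "g \<in> carrier G \<Longrightarrow> hcomp g v \<in> U g"
  and hcomp_out: "g \<notin> carrier G \<Longrightarrow> hcomp g v = 0"
  and hcomp_finite: "finite {g. hcomp g v \<noteq> 0}"
  using hcomp_props[of v] by blast+

lemma hcomp_sum: "(\<Sum>g | hcomp g v \<noteq> 0. hcomp g v) = v"
  using hcomp_props[of v, THEN conjunct2, THEN conjunct2, THEN conjunct2] by (rule sym)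

lemma hcomp_unique:
  assumes "\<And>g. g \<in> carrier G \<Longrightarrow> w g \<in> U g" "\<And>g. g \<notin> carrier G \<Longrightarrow> w g = 0"
    and "finite S" "{g. w g \<noteq> 0} \<subseteq> S" "v = sum w S"
  shows "hcomp g v = w g"
proof -
  have "finite {g. w g \<noteq> 0}" using assms(3,4) by (rule rev_finite_subset)
  moreover have "v = (\<Sum>g | w g \<noteq> 0. w g)"
    unfolding assms(5) by (rule sum.mono_neutral_right) (use assms in auto)
  ultimately have "(\<forall>g\<in>carrier G. w g \<in> U g) \<and> (\<forall>g. g \<notin> carrier G \<longrightarrow> w g = 0) \<and>
      finite {g. w g \<noteq> 0} \<and> v = (\<Sum>g | w g \<noteq> 0. w g)"
    using assms(1,2) by blast
  then have "w = (\<lambda>g. hcomp g v)"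
    by (rule ex1_implies_uniq[OF hcomp_ex1[of v]]) (rule hcomp_props)
  then show ?thesis by simp
qed

lemma hcomp_homogeneous:
  assumes "g \<in> carrier G" "u \<in> U g"
  shows "hcomp h u = (if h = g then u else 0)"
  by (rule hcomp_unique[where S = "{g}"]) (use assms zero_U in auto)

lemma hcomp_sum_superset:
  assumes "finite S" "{g. hcomp g v \<noteq> 0} \<subseteq> S"
  shows "(\<Sum>g\<in>S. hcomp g v) = v"
proof -
  have "(\<Sum>g\<in>S. hcomp g v) = (\<Sum>g | hcomp g v \<noteq> 0. hcomp g v)"
    by (rule sum.mono_neutral_right) (use assms in auto)
  then show ?thesis by (simp only: hcomp_sum)
qed

lemma hcomp_linear: "Vector_Spaces.linear (*s) (*s) (hcomp g)"
proof unfold_locales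
  fix u v :: "'a kac" and c :: 'a
  show "hcomp g (u + v) = hcomp g u + hcomp g v"
  proof (rule hcomp_unique[where S = "{g. hcomp g u \<noteq> 0} \<union> {g. hcomp g v \<noteq> 0}"])
    show "u + v = (\<Sum>g\<in>{g. hcomp g u \<noteq> 0} \<union> {g. hcomp g v \<noteq> 0}. hcomp g u + hcomp g v)"
      by (simp add: sum.distrib hcomp_sum_superset hcomp_finite)
  qed (auto simp: hcomp_in hcomp_out hcomp_finite add_U)
  show "hcomp g (c *s u) = c *s hcomp g u"
  proof (rule hcomp_unique[where S = "{g. hcomp g u \<noteq> 0}"])
    show "c *s u = (\<Sum>g | hcomp g u \<noteq> 0. c *s hcomp g u)"
      by (simp add: hcomp_sum flip: vec.scale_sum_right)
  qed (auto simp: hcomp_in hcomp_out hcomp_finite scale_U)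
qed

lemma homogeneous_linear_eqI:
  assumes "Vector_Spaces.linear (*s) (*s) f" "Vector_Spaces.linear (*s) (*s) f'"
    and "\<And>g u. g \<in> carrier G \<Longrightarrow> u \<in> U g \<Longrightarrow> f u = (f' u :: 'a kac)"
  shows "f v = f' v"
proof -
  interpret f: Vector_Spaces.linear "(*s)" "(*s)" f by fact
  interpret f': Vector_Spaces.linear "(*s)" "(*s)" f' by fact
  have "f (hcomp g v) = f' (hcomp g v)" for g
    by (cases "g \<in> carrier G") (auto simp: assms hcomp_in hcomp_out f.zero f'.zero)
  then have "f (\<Sum>g | hcomp g v \<noteq> 0. hcomp g v) = f' (\<Sum>g | hcomp g v \<noteq> 0. hcomp g v)"
    by (simp add: f.sum f'.sum)
  then show ?thesis by (simp add: hcomp_sum)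
qed

text \<open>Multiplication by an element of degree \<open>h\<close> shifts every degree by
  \<open>h\<close>, and this shift is injective by cancellation; it suffices to check homogeneous
  \<open>u\<close>.\<close>

lemma hcomp_mult:
  assumes "g \<in> carrier G" "h \<in> carrier G" "w \<in> U h"
  shows "hcomp (g \<otimes> h) (kac_mult u w) = kac_mult (hcomp g u) w"
proof (rule homogeneous_linear_eqI[where v = u])
  fix k u assume k: "k \<in> carrier G" "u \<in> U k"
  then show "hcomp (g \<otimes> h) (kac_mult u w) = kac_mult (hcomp g u) w"
    using assms hcomp_homogeneous[OF _ mult_U[OF k(1) assms(2) k(2) assms(3)], of "g \<otimes> h"]
    by (auto simp: hcomp_homogeneous[OF k] kac_mult_def)
qed (rule linear_compose_kac[OF hcomp_linear kac_mult_linear_left],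
    rule linear_compose_kac[OF kac_mult_linear_left hcomp_linear])

text \<open>This is where the compatibility of the grading with parity is used: the even part of a
  homogeneous element is homogeneous of the same degree.\<close>

lemma hcomp_even_part: "hcomp g (kac_even_part v) = kac_even_part (hcomp g v)"
proof (rule homogeneous_linear_eqI[where v = v])
  fix k u assume k: "k \<in> carrier G" "u \<in> U k"
  then obtain a b where ab: "u = a + b" "a \<in> U k" "a \<in> kac_even" "b \<in> kac_odd"
    using grading unfolding kac_grading_def by blast
  then have "kac_even_part u = a"
    using kac_even_odd_unique(1)[OF kac_even_part(1) kac_even_part(2) ab(3,4), of u u] by simp
  then show "hcomp g (kac_even_part u) = kac_even_part (hcomp g u)"
    using k ab by (simp add: hcomp_homogeneous kac_even_part(3) kac_even_iff)
qed (rule linear_compose_kac[OF hcomp_linear kac_even_part_linear],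
    rule linear_compose_kac[OF kac_even_part_linear hcomp_linear])

lemma hcomp_even: "v \<in> kac_even \<Longrightarrow> hcomp g v \<in> kac_even"
  using hcomp_even_part[of g v] kac_even_part by metis

lemma hcomp_odd:
  assumes "v \<in> kac_odd"
  shows "hcomp g v \<in> kac_odd"
proof -
  interpret c: Vector_Spaces.linear "(*s)" "(*s)" "hcomp g" by (rule hcomp_linear)
  show ?thesis
    using hcomp_even_part[of g v] kac_even_part(2)[of "hcomp g v"] kac_even_part(4)[OF assms]
    by (simp add: c.zero)
qed

lemma U_intro:
  assumes "g \<in> carrier G" "\<And>h. h \<in> carrier G \<Longrightarrow> h \<noteq> g \<Longrightarrow> hcomp h v = 0"
  shows "v \<in> U g"
proof -
  have "(\<Sum>h | hcomp h v \<noteq> 0. hcomp h v) = (\<Sum>h\<in>{g}. hcomp h v)"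
    using assms hcomp_out by (intro sum.mono_neutral_left) (auto simp: hcomp_finite)
  then show ?thesis using hcomp_in[OF assms(1), of v] by (simp add: hcomp_sum)
qed

lemma homogeneous_disjoint:
  assumes "g \<in> carrier G" "h \<in> carrier G" "u \<in> U g" "u \<in> U h" "u \<noteq> 0"
  shows "g = h"
  using hcomp_homogeneous[OF assms(1,3), of h] hcomp_homogeneous[OF assms(2,4), of h] assms(5)
  by (auto split: if_splits)

text \<open>The source of homogeneous witnesses for a linear condition of the form "nonzero". Scalar
  functionals are fed into it after multiplication by \<open>kac_one\<close>, as \<open>f\<close>
  takes values in the algebra.\<close>

lemma nonzero_hcomp_ex:
  assumes "Vector_Spaces.linear (*s) (*s) f" "f v \<noteq> (0 :: 'a kac)"
  shows "\<exists>g\<in>carrier G. f (hcomp g v) \<noteq> 0"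
proof (rule ccontr)
  interpret f: Vector_Spaces.linear "(*s)" "(*s)" f by fact
  assume a: "\<not> (\<exists>g\<in>carrier G. f (hcomp g v) \<noteq> 0)"
  have "f (hcomp g v) = 0" for g
    using a by (cases "g \<in> carrier G") (auto simp: hcomp_out f.zero)
  then have "f (\<Sum>g | hcomp g v \<noteq> 0. hcomp g v) = 0" by (simp add: f.sum)
  then show False using assms(2) by (simp add: hcomp_sum)
qed

text \<open>For \<open>g\<close> different from the neutral element, the \<open>g\<close>-component
  of \<open>1\<close> times a homogeneous \<open>w\<close> of degree \<open>h\<close> is the
  component of \<open>w\<close> in degree \<open>g \<otimes> h\<close>, hence 0. So this component
  annihilates everything, in particular \<open>1\<close>, and vanishes.\<close>

lemma one_U: "kac_one \<in> U \<one>"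
proof (rule U_intro)
  fix g assume g: "g \<in> carrier G" "g \<noteq> \<one>"
  have "kac_mult (hcomp g kac_one) v = 0" for v
  proof (rule homogeneous_linear_eqI[where f = "kac_mult (hcomp g kac_one)" and f' = "\<lambda>_. 0"])
    fix h w assume w: "h \<in> carrier G" "w \<in> U h"
    then show "kac_mult (hcomp g kac_one) w = 0"
      using hcomp_mult[OF g(1) w, of kac_one] hcomp_homogeneous[OF w, of "g \<otimes> h"] g
      by (simp add: kac_mult_one)
  qed (rule kac_mult_linear_right linear_zero_kac)+
  from this[of kac_one] show "hcomp g kac_one = 0" by (simp add: kac_mult_one)
qed simp

text \<open>The argument for the unit, restricted to the odd part, where \<open>E\<close> acts as
  the scalar 1/2: a non-neutral component of \<open>E\<close> annihilates all odd elements.\<close>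

lemma hcomp_E:
  assumes g: "g \<in> carrier G" "g \<noteq> \<one>"
  shows "\<exists>c. hcomp g kac_E = c *s (kac_one - 2 *s kac_E)"
proof (rule kac_even_annihilates_odd)
  show "hcomp g kac_E \<in> kac_even" by (simp add: hcomp_even kac_E_even)
  fix m :: "'a kac" assume m: "m \<in> kac_odd"
  have "kac_mult (hcomp g kac_E) (v - kac_even_part v) = 0" for v
  proof (rule homogeneous_linear_eqI[where v = v and f' = "\<lambda>_. 0"])
    fix h u assume h: "h \<in> carrier G" "u \<in> U h"
    let ?w = "u - kac_even_part u"
    have "hcomp h (kac_even_part u) = kac_even_part u" by (simp add: hcomp_even_part hcomp_homogeneous[OF h])
    then have "kac_even_part u \<in> U h" using hcomp_in[OF h(1), of "kac_even_part u"] by simp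
    then have w: "?w \<in> U h" using h by (simp add: diff_U)
    then show "kac_mult (hcomp g kac_E) ?w = 0"
      using hcomp_mult[OF g(1) h(1) w, of kac_E] hcomp_homogeneous[OF h(1) w, of "g \<otimes> h"] g h
      by (simp add: kac_E_mult_odd kac_even_part scale_U hcomp_homogeneous[OF h(1) scale_U[OF h(1) w]])
  next
    interpret e: Vector_Spaces.linear "(*s)" "(*s)" kac_even_part by (rule kac_even_part_linear)
    show "Vector_Spaces.linear (*s) (*s) (\<lambda>v. kac_mult (hcomp g kac_E) (v - kac_even_part v))"
      by unfold_locales (simp_all add: kac_mult_add_right[symmetric] kac_mult_scale_right[symmetric]
          e.add e.scale algebra_simps vec.scale_right_diff_distrib)
  qed (rule linear_zero_kac)
  from this[of m] show "kac_mult (hcomp g kac_E) m = 0" using m by (simp add: kac_even_part)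
qed

text \<open>Otherwise the element \<open>1 - 2E\<close>, which kills the odd part, would be homogeneous of a degree other
  than the neutral one, and comparing components in \<open>kac_even_E_mult\<close> every homogeneous even element would lie
  in \<open>\<langle>1, E\<rangle>\<close>.\<close>
lemma E_U: "kac_E \<in> U \<one>"
proof (rule U_intro[OF one_closed])
  fix g assume g: "g \<in> carrier G" "g \<noteq> \<one>"
  let ?Z = "kac_one - 2 *s kac_E :: 'a kac"
  show "hcomp g kac_E = 0"
  proof (rule ccontr)
    assume nz: "hcomp g kac_E \<noteq> 0"
    obtain c where c: "hcomp g kac_E = c *s ?Z" using hcomp_E[OF g] by blast
    have "c \<noteq> 0"
    proof
      assume "c = 0"
      then show False using nz unfolding c by simp
    qed
    then have Z: "?Z \<in> U g"
      by (rule scale_U_cancel[OF g(1), rotated]) (use hcomp_in[OF g(1), of kac_E] in \<open>unfold c\<close>)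
    have flat: "v $ Some (Ix,Ix) = 0" if h: "h \<in> carrier G" and v: "v \<in> U h" "v \<in> kac_even" for h v
    proof -
      define \<mu> where "\<mu> = v $ None + 3/4 * v $ Some (Ie,Ie)"
      \<comment> \<open>With \<open>Z = 1 - 2 E\<close> one has \<open>1 - 2 Z = 4 E - 1\<close>. As
        \<open>Z v\<close> has degree \<open>g \<otimes> h\<close>, the \<open>h\<close>-component
        of the left side is \<open>v\<close>, while that of the right side lies in the span of
        \<open>1\<close> and \<open>Z\<close>.\<close>
      have "v - 2 *s kac_mult ?Z v = 4 *s kac_mult kac_E v - v"
        by (simp add: kac_eq_iff kac_mult_nth)
      also have "\<dots> = \<mu> *s kac_one - (2 * \<mu>) *s ?Z"
        unfolding kac_even_E_mult[OF v(2)] \<mu>_def by (simp add: kac_eq_iff algebra_simps)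
      finally have eq: "v - 2 *s kac_mult ?Z v = \<mu> *s kac_one - (2 * \<mu>) *s ?Z" .
      interpret C: Vector_Spaces.linear "(*s)" "(*s)" "hcomp h" by (rule hcomp_linear)
      have "g \<otimes> h \<noteq> h" using g h by simp
      then have "hcomp h (v - 2 *s kac_mult ?Z v) = v"
        using hcomp_homogeneous[OF h v(1), of h] hcomp_homogeneous[OF _ mult_U[OF g(1) h Z v(1)], of h] g h
        by (simp add: C.diff C.scale)
      then have "v = \<mu> *s hcomp h kac_one - (2 * \<mu>) *s hcomp h ?Z"
        unfolding eq by (simp only: C.diff C.scale)
      also have "hcomp h kac_one = (if h = \<one> then kac_one else 0)"
        by (rule hcomp_homogeneous) (simp_all add: one_U)
      also have "hcomp h ?Z = (if h = g then ?Z else 0)"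
        by (rule hcomp_homogeneous[OF g(1) Z])
      finally have "v = \<mu> *s (if h = \<one> then kac_one else 0) - (2 * \<mu>) *s (if h = g then ?Z else 0)" .
      then have "v $ Some (Ix,Ix) = (\<mu> *s (if h = \<one> then kac_one else 0) - (2 * \<mu>) *s (if h = g then ?Z else 0)) $ Some (Ix,Ix)"
        by simp
      also have "\<dots> = 0" by simp
      finally show ?thesis .
    qed
    let ?w = "kap_x \<^bold>\<otimes> kap_x :: 'a kac"
    have ev: "?w \<in> kac_even" by (simp add: kac_even_iff)
    have "hcomp h ?w $ Some (Ix,Ix) = 0" for h
      using flat[OF _ hcomp_in hcomp_even[OF ev]] by (cases "h \<in> carrier G") (auto simp: hcomp_out)
    then have "(\<Sum>h | hcomp h ?w \<noteq> 0. hcomp h ?w) $ Some (Ix,Ix) = 0"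
      by simp
    then show False by (simp add: hcomp_sum)
  qed
qed

lemma K_U: "kac_K \<in> U \<one>"
  unfolding kac_K_def by (intro diff_U scale_U) (simp_all add: one_U E_U)

end

section \<open>Homogeneous generators of the odd part\<close>

lemma kap_form_linear:
  "kap_form (u + v) w = kap_form u w + kap_form v w" "kap_form w (u + v) = kap_form w u + kap_form w v"
  "kap_form (u - v) w = kap_form u w - kap_form v w" "kap_form w (u - v) = kap_form w u - kap_form w v"
  "kap_form (c *s u) w = c * kap_form u w" "kap_form w (c *s u) = c * kap_form w u"
  "kap_form (- u) w = - kap_form u w" "kap_form w (- u) = - kap_form w u"
  "kap_form 0 w = 0" "kap_form w 0 = 0"
  by (simp_all add: kap_form_def algebra_simps add_divide_distrib diff_divide_distrib)

lemma kap_form_self: "a $ Ie = 0 \<Longrightarrow> kap_form a a = 0"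
  and kap_form_skew: "a $ Ie = 0 \<Longrightarrow> kap_form b a = - kap_form a b"
  by (simp_all add: kap_form_def)

lemma kac_lift_linear:
  "kac_lift a b + kac_lift c d = kac_lift (a + c) (b + d)"
  "kac_lift a b - kac_lift c d = kac_lift (a - c) (b - d)"
  "t *s kac_lift a b = kac_lift (t *s a) (t *s b)"
  by (simp_all add: kac_eq_iff kac_lift_def algebra_simps)

lemma kac_lift_inject:
  assumes "a $ Ie = 0" "b $ Ie = 0" "c $ Ie = 0" "d $ Ie = 0"
  shows "kac_lift a b = kac_lift c d \<longleftrightarrow> a = c \<and> b = d"
  using assms by (auto simp: kac_eq_iff kap_eq_iff kac_lift_nth)

lemma kac_tensor_linear:
  "(t *s a) \<^bold>\<otimes> b = t *s (a \<^bold>\<otimes> b)" "a \<^bold>\<otimes> (t *s b) = t *s (a \<^bold>\<otimes> b)"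
  "(- a) \<^bold>\<otimes> b = - (a \<^bold>\<otimes> b)" "a \<^bold>\<otimes> (- b) = - (a \<^bold>\<otimes> b)"
  "0 \<^bold>\<otimes> b = 0" "a \<^bold>\<otimes> 0 = 0"
  by (simp_all add: kac_eq_iff)

context kac_graded begin

lemma cancel_conj: "g \<in> carrier G \<Longrightarrow> h \<in> carrier G \<Longrightarrow> g \<otimes> h \<otimes> inv g = h"
  by (simp add: m_comm[of g h] m_assoc)

text \<open>The product has a part in the line of \<open>kac_K\<close> and a part in
  \<open>V \<otimes> V\<close>. Multiplication by the neutral element \<open>E\<close> acts by 1/4
  on the latter but not on the former, so it separates them within the degree of the product. A
  nonzero form value puts a nonzero neutral element into that degree.\<close>

lemma lift_mult_U:
  assumes V: "a $ Ie = 0" "b $ Ie = 0" "c $ Ie = 0" "d $ Ie = 0"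
    and U: "g \<in> carrier G" "h \<in> carrier G" "kac_lift a b \<in> U g" "kac_lift c d \<in> U h"
  shows "a \<^bold>\<otimes> d - c \<^bold>\<otimes> b \<in> U (g \<otimes> h)" (is ?A)
    and "kap_form a c + kap_form b d \<noteq> 0 \<Longrightarrow> g \<otimes> h = \<one>" (is "?l \<noteq> 0 \<Longrightarrow> ?B")
proof -
  define z where "z = kac_mult (kac_lift a b) (kac_lift c d)"
  have z: "z = ?l *s kac_K + (1/4) *s (a \<^bold>\<otimes> d - c \<^bold>\<otimes> b)"
    unfolding z_def by (rule kac_lift_mult[OF V])
  have zU: "z \<in> U (g \<otimes> h)" unfolding z_def by (rule mult_U[OF U])
  have "kac_mult kac_E z \<in> U (\<one> \<otimes> (g \<otimes> h))"
    by (rule mult_U) (simp_all add: U E_U zU)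
  then have Ez: "kac_mult kac_E z \<in> U (g \<otimes> h)" using U by simp
  \<comment> \<open>This is \<open>E K - K/4\<close> for \<open>K = E - 3/8\<close>, computed from
    \<open>E E = E - 3/16\<close>.\<close>
  let ?E = "(3/8) *s kac_E - (3/32) *s kac_one :: 'a kac"
  have "kac_mult kac_E z - (1/4) *s z = ?l *s ?E"
    unfolding z by (simp add: kac_mult_add_right kac_mult_scale_right kac_eq_iff kac_mult_nth kac_K_nth V field_simps)
  moreover have "kac_mult kac_E z - (1/4) *s z \<in> U (g \<otimes> h)"
    using Ez zU U by (intro diff_U scale_U) simp_all
  ultimately have E: "?l *s ?E \<in> U (g \<otimes> h)" by simp
  have E1: "?E \<in> U \<one>" by (intro diff_U scale_U) (simp_all add: E_U one_U)
  show B: ?B if "?l \<noteq> 0"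
  proof (rule homogeneous_disjoint)
    show "?E \<in> U (g \<otimes> h)" using E that U by (metis scale_U_cancel m_closed)
    show "?E \<noteq> 0" by (simp add: kac_eq_iff)
  qed (simp_all add: U E1)
  have "?l *s kac_K \<in> U (g \<otimes> h)"
  proof (cases "?l = 0")
    case False
    then show ?thesis using B K_U by (simp add: scale_U)
  qed (use U in \<open>simp add: zero_U\<close>)
  then have "z - ?l *s kac_K \<in> U (g \<otimes> h)" using zU U by (simp add: diff_U)
  then have "(1/4) *s (a \<^bold>\<otimes> d - c \<^bold>\<otimes> b) \<in> U (g \<otimes> h)" by (simp add: z)
  then show ?A by (rule scale_U_cancel[rotated]) (simp_all add: U)
qed

lemma lift_homogeneous_ex:
  assumes f: "Vector_Spaces.linear (*s) (*s) f" and "f m \<noteq> (0 :: 'a kac)" "m \<in> kac_odd"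
  obtains g a b where "g \<in> carrier G" "a $ Ie = 0" "b $ Ie = 0" "kac_lift a b \<in> U g" "f (kac_lift a b) \<noteq> 0"
proof -
  obtain g where g: "g \<in> carrier G" "f (hcomp g m) \<noteq> 0"
    using nonzero_hcomp_ex[OF assms(1,2)] by blast
  obtain a b where "a $ Ie = 0" "b $ Ie = 0" "hcomp g m = kac_lift a b"
    by (rule kac_oddE[OF hcomp_odd[OF assms(3)]])
  then show ?thesis using that g hcomp_in[OF g(1), of m] by metis
qed

text \<open>By nondegeneracy some odd element pairs nontrivially with the given one, hence so does
  one of its homogeneous components. \<open>lift_mult_U\<close> then forces the inverse degree, and
  rescaling makes the pairing 1.\<close>

lemma dual_homogeneous_ex:
  assumes V: "a $ Ie = 0" "b $ Ie = 0" and "kac_lift a b \<noteq> 0"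
    and U: "g \<in> carrier G" "kac_lift a b \<in> U g"
  obtains c d where "c $ Ie = 0" "d $ Ie = 0" "kac_lift c d \<in> U (inv g)" "kap_form a c + kap_form b d = 1"
proof -
  \<comment> \<open>The pairing with \<open>kac_lift a b\<close>, extended linearly to the whole
    algebra by reading only the odd coordinates.\<close>
  define f where "f v = (a $ Ix * v $ Some (Iy,Ie) - a $ Iy * v $ Some (Ix,Ie)
    + b $ Ix * v $ Some (Ie,Iy) - b $ Iy * v $ Some (Ie,Ix)) *s (kac_one :: 'a kac)" for v :: "'a kac"
  have lin: "Vector_Spaces.linear (*s) (*s) f"
    by unfold_locales (simp_all add: f_def kac_eq_iff algebra_simps)
  have f: "f (kac_lift c d) = (kap_form a c + kap_form b d) *s kac_one" if "c $ Ie = 0" "d $ Ie = 0" for c d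
    using that V by (simp add: f_def kac_lift_nth kap_form_def)
  have "a $ Ix \<noteq> 0 \<or> a $ Iy \<noteq> 0 \<or> b $ Ix \<noteq> 0 \<or> b $ Iy \<noteq> 0"
    using assms(3) V by (auto simp: kac_eq_iff kac_lift_nth)
  then have "f (kap_y \<^bold>\<otimes> kap_e) \<noteq> 0 \<or> f (kap_x \<^bold>\<otimes> kap_e) \<noteq> 0 \<or> f (kap_e \<^bold>\<otimes> kap_y) \<noteq> 0 \<or> f (kap_e \<^bold>\<otimes> kap_x) \<noteq> 0"
    by (simp add: f_def kac_eq_iff)
  moreover have "kap_y \<^bold>\<otimes> kap_e \<in> kac_odd" "kap_x \<^bold>\<otimes> kap_e \<in> kac_odd" "kap_e \<^bold>\<otimes> kap_y \<in> kac_odd" "kap_e \<^bold>\<otimes> kap_x \<in> kac_odd"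
    by (simp_all add: kac_odd_iff)
  ultimately obtain m where m: "m \<in> kac_odd" "f m \<noteq> 0" by blast
  obtain h c d where h: "h \<in> carrier G" "c $ Ie = 0" "d $ Ie = 0" "kac_lift c d \<in> U h" "f (kac_lift c d) \<noteq> 0"
    by (rule lift_homogeneous_ex[OF lin m(2,1)])
  define l where "l = kap_form a c + kap_form b d"
  have l: "l \<noteq> 0" using h(5) f[OF h(2,3)] by (auto simp: l_def)
  then have "g \<otimes> h = \<one>" using lift_mult_U(2)[OF V h(2,3) U(1) h(1) U(2) h(4)] by (simp add: l_def)
  then have "h = inv g" using U h by (metis inv_equality m_comm)
  show thesis
  proof (rule that[of "inverse l *s c" "inverse l *s d"])
    show "kac_lift (inverse l *s c) (inverse l *s d) \<in> U (inv g)"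
      using h \<open>h = inv g\<close> by (simp add: scale_U flip: kac_lift_linear(3))
    show "kap_form a (inverse l *s c) + kap_form b (inverse l *s d) = 1"
      using l by (simp add: kap_form_linear l_def flip: distrib_left)
  qed (use h in simp_all)
qed

text \<open>Let \<open>c \<otimes> e + e \<otimes> b\<close> be dual to
  \<open>a \<otimes> e\<close>. Then \<open>a \<otimes> b\<close> is neutral, and it sends this dual
  element to -1/2 times its right half \<open>e \<otimes> b\<close>. So the left half
  \<open>c \<otimes> e\<close> is homogeneous too, and the pair \<open>a\<close>, \<open>c\<close>
  cuts out the right half of every other homogeneous odd element.\<close>

lemma ZZ_generators_if_pure_left:
  assumes a: "a $ Ie = 0" "a \<noteq> 0" and g: "g \<in> carrier G" "kac_lift a 0 \<in> U g"
  obtains c p q h where "c $ Ie = 0" "p $ Ie = 0" "q $ Ie = 0" "kap_form a c = 1" "kap_form p q = 1"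
    "h \<in> carrier G" "kac_lift c 0 \<in> U (inv g)" "kac_lift 0 p \<in> U h" "kac_lift 0 q \<in> U (inv h)"
proof -
  have z: "(0 :: 'a kap) $ Ie = 0" by simp
  have "kac_lift a 0 \<noteq> 0" using a by (auto simp: kac_eq_iff kap_eq_iff kac_lift_nth)
  then obtain c b where cb: "c $ Ie = 0" "b $ Ie = 0" "kac_lift c b \<in> U (inv g)" "kap_form a c + kap_form 0 b = 1"
    by (rule dual_homogeneous_ex[OF a(1) z _ g])
  then have ac: "kap_form a c = 1" by (simp add: kap_form_linear)
  have "a \<^bold>\<otimes> b - c \<^bold>\<otimes> 0 \<in> U (g \<otimes> inv g)"
    by (rule lift_mult_U(1)) (use a cb g in simp_all)
  then have "a \<^bold>\<otimes> b \<in> U \<one>" using g by (simp add: kac_tensor_linear)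
  then have "kac_mult (a \<^bold>\<otimes> b) (kac_lift c b) \<in> U (\<one> \<otimes> inv g)"
    by (intro mult_U) (use g cb in simp_all)
  then have "(-(1/2)) *s kac_lift 0 b \<in> U (inv g)"
    using g by (simp add: kac_tensor_mult_lift a cb kap_form_self ac kac_lift_linear)
  then have "kac_lift 0 b \<in> U (inv g)"
    by (rule scale_U_cancel[rotated]) (use g in simp_all)
  then have "kac_lift c b - kac_lift 0 b \<in> U (inv g)" using g cb by (intro diff_U) simp_all
  then have c: "kac_lift c 0 \<in> U (inv g)" by (simp add: kac_lift_linear)
  \<comment> \<open>Multiply by \<open>a \<otimes> e\<close>, keep the
    \<open>V \<otimes> V\<close>-part, and multiply by \<open>c \<otimes> e\<close>: degrees
    \<open>g\<close> and \<open>inv g\<close> cancel, and only -1/2 times the right half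
    survives.\<close>
  have project: "kac_lift 0 q \<in> U h"
    if "h \<in> carrier G" "p $ Ie = 0" "q $ Ie = 0" "kac_lift p q \<in> U h" for h p q
  proof -
    have "a \<^bold>\<otimes> q - p \<^bold>\<otimes> 0 \<in> U (g \<otimes> h)"
      by (rule lift_mult_U(1)) (use a that g in simp_all)
    then have "kac_mult (a \<^bold>\<otimes> q) (kac_lift c 0) \<in> U (g \<otimes> h \<otimes> inv g)"
      by (intro mult_U) (use g c that in \<open>simp_all add: kac_tensor_linear\<close>)
    then have "(-(1/2)) *s kac_lift 0 q \<in> U h"
      using g that by (simp add: cancel_conj kac_tensor_mult_lift a cb kap_form_linear ac kac_lift_linear)
    then show ?thesis by (rule scale_U_cancel[rotated]) (use that in simp_all)
  qed
  define f where "f v = v $ Some (Ie,Ix) *s (kac_one :: 'a kac)" for v :: "'a kac"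
  have "Vector_Spaces.linear (*s) (*s) f" by unfold_locales (simp_all add: f_def kac_eq_iff)
  then obtain h p q where h: "h \<in> carrier G" "p $ Ie = 0" "q $ Ie = 0" "kac_lift p q \<in> U h" "f (kac_lift p q) \<noteq> 0"
    by (rule lift_homogeneous_ex[of f "kap_e \<^bold>\<otimes> kap_x"]) (simp_all add: f_def kac_odd_iff kac_eq_iff)
  have q: "kac_lift 0 q \<in> U h" by (rule project[OF h(1-4)])
  have "kac_lift 0 q \<noteq> 0" using h by (auto simp: f_def kac_eq_iff kac_lift_nth)
  then obtain p' r where r: "p' $ Ie = 0" "r $ Ie = 0" "kac_lift p' r \<in> U (inv h)" "kap_form 0 p' + kap_form q r = 1"
    by (rule dual_homogeneous_ex[OF z h(3) _ h(1) q])
  have "kac_lift 0 r \<in> U (inv h)" by (rule project[OF _ r(1-3)]) (use h in simp)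
  then show thesis using that[of c q r h] cb ac h q r c by (simp add: kap_form_linear)
qed

text \<open>The mirror image of the preceding extraction. If
  \<open>p \<otimes> e + e \<otimes> r\<close> is dual to \<open>e \<otimes> q\<close>, the neutral
  element \<open>p \<otimes> q\<close> isolates its left half, so \<open>e \<otimes> r\<close> is
  homogeneous. Multiplying by \<open>e \<otimes> q\<close>, keeping the
  \<open>V \<otimes> V\<close>-part, and multiplying by \<open>e \<otimes> r\<close> projects any
  homogeneous odd element to its left half.\<close>

lemma pure_left_if_pure_right:
  assumes q: "q $ Ie = 0" "q \<noteq> 0" and h: "h \<in> carrier G" "kac_lift 0 q \<in> U h"
  obtains a g where "a $ Ie = 0" "a \<noteq> 0" "g \<in> carrier G" "kac_lift a 0 \<in> U g"
proof -
  have z: "(0 :: 'a kap) $ Ie = 0" by simp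
  have "kac_lift 0 q \<noteq> 0" using q by (auto simp: kac_eq_iff kap_eq_iff kac_lift_nth)
  then obtain p r where pr: "p $ Ie = 0" "r $ Ie = 0" "kac_lift p r \<in> U (inv h)" "kap_form 0 p + kap_form q r = 1"
    by (rule dual_homogeneous_ex[OF z q(1) _ h])
  then have qr: "kap_form q r = 1" by (simp add: kap_form_linear)
  have "0 \<^bold>\<otimes> r - p \<^bold>\<otimes> q \<in> U (h \<otimes> inv h)"
    by (rule lift_mult_U(1)) (use q pr h in simp_all)
  then have "(-1) *s (0 \<^bold>\<otimes> r - p \<^bold>\<otimes> q) \<in> U \<one>" using h by (intro scale_U) simp_all
  then have "p \<^bold>\<otimes> q \<in> U \<one>" by (simp add: kac_tensor_linear)
  then have "kac_mult (p \<^bold>\<otimes> q) (kac_lift p r) \<in> U (\<one> \<otimes> inv h)"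
    by (intro mult_U) (use h pr in simp_all)
  then have "(1/2) *s kac_lift p 0 \<in> U (inv h)"
    using h by (simp add: kac_tensor_mult_lift q pr kap_form_self qr kac_lift_linear)
  then have "kac_lift p 0 \<in> U (inv h)"
    by (rule scale_U_cancel[rotated]) (use h in simp_all)
  then have "kac_lift p r - kac_lift p 0 \<in> U (inv h)" using h pr by (intro diff_U) simp_all
  then have r: "kac_lift 0 r \<in> U (inv h)" by (simp add: kac_lift_linear)
  define f where "f v = v $ Some (Ix,Ie) *s (kac_one :: 'a kac)" for v :: "'a kac"
  have "Vector_Spaces.linear (*s) (*s) f" by unfold_locales (simp_all add: f_def kac_eq_iff)
  then obtain g a b where g: "g \<in> carrier G" "a $ Ie = 0" "b $ Ie = 0" "kac_lift a b \<in> U g" "f (kac_lift a b) \<noteq> 0"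
    by (rule lift_homogeneous_ex[of f "kap_x \<^bold>\<otimes> kap_e"]) (simp_all add: f_def kac_odd_iff kac_eq_iff)
  have "0 \<^bold>\<otimes> b - a \<^bold>\<otimes> q \<in> U (h \<otimes> g)"
    by (rule lift_mult_U(1)) (use q g h in simp_all)
  then have "kac_mult (0 \<^bold>\<otimes> b - a \<^bold>\<otimes> q) (kac_lift 0 r) \<in> U (h \<otimes> g \<otimes> inv h)"
    by (intro mult_U) (use h r g in simp_all)
  also have "kac_mult (0 \<^bold>\<otimes> b - a \<^bold>\<otimes> q) (kac_lift 0 r) = (- 1) *s kac_mult (a \<^bold>\<otimes> q) (kac_lift 0 r)"
    by (simp add: kac_tensor_linear flip: kac_mult_scale_left)
  finally have "(-(1/2)) *s kac_lift a 0 \<in> U g"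
    using h g by (simp add: cancel_conj kac_tensor_mult_lift q pr kap_form_linear qr kac_lift_linear)
  then have "kac_lift a 0 \<in> U g" by (rule scale_U_cancel[rotated]) (use g in simp_all)
  moreover have "a \<noteq> 0" using g by (auto simp: f_def kac_lift_nth)
  ultimately show thesis using that g by blast
qed

text \<open>Let \<open>T\<close> send an odd \<open>u\<close> to \<open>w n\<close>, where
  \<open>w\<close> is four times the \<open>V \<otimes> V\<close>-part of \<open>m u\<close>, for
  \<open>m = kac_lift x x'\<close> and \<open>n = kac_lift y y'\<close>. It preserves degrees. Its
  eigenvalues are 0 on \<open>m\<close>, -1 on \<open>kac_lift x (- x')\<close>, and -1/2 on
  \<open>y \<otimes> e\<close> and \<open>e \<otimes> y'\<close>. Hence \<open>T (T + 1/2)\<close>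
  is half the projection to the line of \<open>kac_lift x (- x')\<close>.\<close>

lemma antidiagonal_homogeneous:
  assumes V: "x $ Ie = 0" "y $ Ie = 0" "x' $ Ie = 0" "y' $ Ie = 0" "kap_form x y = 1" "kap_form x' y' = 1"
    and g: "g \<in> carrier G" "kac_lift x x' \<in> U g" "kac_lift y y' \<in> U (inv g)"
  shows "\<exists>h\<in>carrier G. kac_lift x (- x') \<in> U h"
proof -
  \<comment> \<open>One application of \<open>T\<close>; the degree of the result is
    \<open>g \<otimes> h \<otimes> inv g = h\<close>.\<close>
  have step: "kac_lift ((1/2) *s (kap_form d y' *s x - c)) ((1/2) *s (kap_form c y *s x' - d)) \<in> U h"
    if "h \<in> carrier G" "c $ Ie = 0" "d $ Ie = 0" "kac_lift c d \<in> U h" for h c d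
  proof -
    have "x \<^bold>\<otimes> d - c \<^bold>\<otimes> x' \<in> U (g \<otimes> h)"
      by (rule lift_mult_U(1)) (use V g that in simp_all)
    then have "kac_mult (x \<^bold>\<otimes> d - c \<^bold>\<otimes> x') (kac_lift y y') \<in> U (g \<otimes> h \<otimes> inv g)"
      by (intro mult_U) (use g that in simp_all)
    also have "g \<otimes> h \<otimes> inv g = h" using that g by (simp add: cancel_conj)
    also have "kac_mult (x \<^bold>\<otimes> d - c \<^bold>\<otimes> x') (kac_lift y y') =
        kac_mult (x \<^bold>\<otimes> d) (kac_lift y y') + (-1) *s kac_mult (c \<^bold>\<otimes> x') (kac_lift y y')"
      by (simp flip: kac_mult_scale_left kac_mult_add_left)
    also have "\<dots> = kac_lift ((1/2) *s (kap_form d y' *s x - c)) ((1/2) *s (kap_form c y *s x' - d))"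
      using V that by (simp add: kac_tensor_mult_lift kac_lift_linear vec.scale_right_diff_distrib vector_smult_assoc)
    finally show ?thesis .
  qed
  \<comment> \<open>On the odd part this functional has the same kernel as
    \<open>T (T + 1/2)\<close>.\<close>
  define f where "f v = ((v $ Some (Ix,Ie) * y $ Iy - v $ Some (Iy,Ie) * y $ Ix)
      - (v $ Some (Ie,Ix) * y' $ Iy - v $ Some (Ie,Iy) * y' $ Ix)) *s (kac_one :: 'a kac)" for v :: "'a kac"
  have f: "f (kac_lift c d) = (kap_form c y - kap_form d y') *s kac_one" if "c $ Ie = 0" "d $ Ie = 0" for c d
    using that V by (simp add: f_def kac_lift_nth kap_form_def)
  have "Vector_Spaces.linear (*s) (*s) f"
    by unfold_locales (simp_all add: f_def kac_eq_iff algebra_simps)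
  moreover have "f (kac_lift x (- x')) \<noteq> 0"
    using V by (simp add: f kap_form_linear kac_eq_iff)
  moreover have "kac_lift x (- x') \<in> kac_odd" using V by (simp add: kac_lift_odd)
  ultimately obtain h c d where h: "h \<in> carrier G" "c $ Ie = 0" "d $ Ie = 0" "kac_lift c d \<in> U h" "f (kac_lift c d) \<noteq> 0"
    by (rule lift_homogeneous_ex)
  define C where "C = kap_form c y"
  define D where "D = kap_form d y'"
  have CD: "C - D \<noteq> 0" using h(5) f[OF h(2,3)] by (auto simp: C_def D_def)
  define c' where "c' = (1/2) *s (D *s x - c)"
  define d' where "d' = (1/2) *s (C *s x' - d)"
  have 1: "kac_lift c' d' \<in> U h" unfolding c'_def d'_def C_def D_def by (rule step[OF h(1-4)])
  have forms: "kap_form c' y = (D - C) / 2" "kap_form d' y' = (C - D) / 2"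
    using V by (simp_all add: c'_def d'_def kap_form_linear C_def D_def)
  have "c' $ Ie = 0" "d' $ Ie = 0" using V h by (simp_all add: c'_def d'_def)
  from step[OF h(1) this 1] have 2: "kac_lift ((1/2) *s (((C - D) / 2) *s x - c')) ((1/2) *s (((D - C) / 2) *s x' - d')) \<in> U h"
    unfolding forms .
  \<comment> \<open>The right side is \<open>T (T u) + (1/2) T u\<close> for
    \<open>u = kac_lift c d\<close>.\<close>
  have "((C - D) / 4) *s kac_lift x (- x') =
      kac_lift ((1/2) *s (((C - D) / 2) *s x - c')) ((1/2) *s (((D - C) / 2) *s x' - d')) + (1/2) *s kac_lift c' d'"
    unfolding kac_lift_linear c'_def d'_def
    by (intro arg_cong2[where f = kac_lift]) (simp_all add: kap_eq_iff field_simps)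
  also have "\<dots> \<in> U h" by (intro add_U scale_U h 1 2)
  finally have "kac_lift x (- x') \<in> U h" by (rule scale_U_cancel[rotated]) (use h CD in simp_all)
  then show ?thesis using h by blast
qed

text \<open>Each case lists homogeneous odd vectors in the shape of the odd basis of one of the two
  gradings, transported by a pair of symplectic bases. The even components are reached from these by
  products. In the second case \<open>h\<close> and \<open>k\<close> may be any degrees, since a
  coarsening only asks that each line lie in some component.\<close>

theorem generators:
  obtains (ZZ) a c p q g h where "a $ Ie = 0" "c $ Ie = 0" "p $ Ie = 0" "q $ Ie = 0" "kap_form a c = 1" "kap_form p q = 1"
      "g \<in> carrier G" "h \<in> carrier G"
      "kac_lift a 0 \<in> U g" "kac_lift c 0 \<in> U (inv g)" "kac_lift 0 p \<in> U h" "kac_lift 0 q \<in> U (inv h)"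
  | (ZZ2) a c p q g h k where "a $ Ie = 0" "c $ Ie = 0" "p $ Ie = 0" "q $ Ie = 0" "kap_form a c = 1" "kap_form p q = 1"
      "g \<in> carrier G" "h \<in> carrier G" "k \<in> carrier G"
      "kac_lift a p \<in> U g" "kac_lift c q \<in> U (inv g)" "kac_lift a (- p) \<in> U h" "kac_lift c (- q) \<in> U k"
proof -
  have pure: thesis if a: "a $ Ie = 0" "a \<noteq> 0" "g \<in> carrier G" "kac_lift a 0 \<in> U g" for a g
    by (rule ZZ_generators_if_pure_left[OF a]) (rule ZZ[OF a(1) _ _ _ _ _ a(3) _ a(4)]; assumption)
  have pure': thesis if q: "q $ Ie = 0" "q \<noteq> 0" "h \<in> carrier G" "kac_lift 0 q \<in> U h" for q h
    by (rule pure_left_if_pure_right[OF q]) (rule pure)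
  define f where "f v = v $ Some (Ix,Ie) *s (kac_one :: 'a kac)" for v :: "'a kac"
  have "Vector_Spaces.linear (*s) (*s) f" by unfold_locales (simp_all add: f_def kac_eq_iff)
  then obtain g x x' where g: "g \<in> carrier G" "x $ Ie = 0" "x' $ Ie = 0" "kac_lift x x' \<in> U g" "f (kac_lift x x') \<noteq> 0"
    by (rule lift_homogeneous_ex[of f "kap_x \<^bold>\<otimes> kap_e"]) (simp_all add: f_def kac_odd_iff kac_eq_iff)
  have x: "x \<noteq> 0" using g by (auto simp: f_def kac_lift_nth)
  show thesis
  proof (cases "x' = 0")
    case True
    then show thesis using pure[of x g] g x by simp
  next
    case False
    have "kac_lift x x' \<noteq> 0" using x g by (auto simp: kac_eq_iff kap_eq_iff kac_lift_nth)
    then obtain a b where ab: "a $ Ie = 0" "b $ Ie = 0" "kac_lift a b \<in> U (inv g)" "kap_form x a + kap_form x' b = 1"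
      by (rule dual_homogeneous_ex[OF g(2,3) _ g(1,4)])
    define \<alpha> where "\<alpha> = kap_form x a"
    define \<beta> where "\<beta> = kap_form x' b"
    have "x \<^bold>\<otimes> b - a \<^bold>\<otimes> x' \<in> U (g \<otimes> inv g)"
      by (rule lift_mult_U(1)) (use g ab in simp_all)
    then have "x \<^bold>\<otimes> b - a \<^bold>\<otimes> x' \<in> U \<one>" using g by simp
    then have "kac_mult (x \<^bold>\<otimes> b - a \<^bold>\<otimes> x') (kac_lift x x') \<in> U (\<one> \<otimes> g)"
      by (intro mult_U) (use g in simp_all)
    \<comment> \<open>Multiplication by \<open>x \<otimes> b - a \<otimes> x'\<close> scales the
      left half of \<open>kac_lift x x'\<close> by \<open>- \<beta> / 2\<close> and the right half
      by \<open>- \<alpha> / 2\<close>. Doubling and adding \<open>\<beta>\<close> times the element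
      cancels the left half.\<close>
    then have "2 *s kac_mult (x \<^bold>\<otimes> b - a \<^bold>\<otimes> x') (kac_lift x x') + \<beta> *s kac_lift x x' \<in> U g"
      using g by (intro add_U scale_U) simp_all
    also have "kac_mult (x \<^bold>\<otimes> b - a \<^bold>\<otimes> x') (kac_lift x x') =
        kac_mult (x \<^bold>\<otimes> b) (kac_lift x x') + (-1) *s kac_mult (a \<^bold>\<otimes> x') (kac_lift x x')"
      by (simp flip: kac_mult_scale_left kac_mult_add_left)
    also have "\<dots> = kac_lift ((- \<beta> / 2) *s x) ((- \<alpha> / 2) *s x')"
      using g ab by (simp add: kac_tensor_mult_lift kac_lift_linear kap_form_self
          kap_form_skew[of x a] kap_form_skew[of x' b] \<alpha>_def \<beta>_def vector_smult_assoc)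
    also have "2 *s kac_lift ((- \<beta> / 2) *s x) ((- \<alpha> / 2) *s x') + \<beta> *s kac_lift x x' = kac_lift 0 ((\<beta> - \<alpha>) *s x')"
      unfolding kac_lift_linear by (intro arg_cong2[where f = kac_lift]) (simp_all add: kap_eq_iff field_simps)
    finally have U: "kac_lift 0 ((\<beta> - \<alpha>) *s x') \<in> U g" .
    show thesis
    proof (cases "\<alpha> = \<beta>")
      case False
      then show thesis using pure'[OF _ _ g(1) U] g \<open>x' \<noteq> 0\<close> by simp
    next
      case True
      then have half: "2 * \<alpha> = 1" "2 * \<beta> = 1" using ab(4) by (simp_all add: \<alpha>_def \<beta>_def)
      \<comment> \<open>Both forms equal 1/2, so doubling the dual element yields symplectic bases
        on both sides at once.\<close>
      let ?y = "2 *s a" and ?y' = "2 *s b"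
      have V: "?y $ Ie = 0" "?y' $ Ie = 0" "kap_form x ?y = 1" "kap_form x' ?y' = 1"
        using half ab by (simp_all add: kap_form_linear \<alpha>_def \<beta>_def)
      have y: "kac_lift ?y ?y' \<in> U (inv g)"
        using scale_U[OF _ ab(3), of 2] g by (simp add: kac_lift_linear)
      obtain h where h: "h \<in> carrier G" "kac_lift x (- x') \<in> U h"
        using antidiagonal_homogeneous[OF g(2) V(1) g(3) V(2-4) g(1,4) y] by blast
      \<comment> \<open>For the second antidiagonal element the two vectors change roles; the sign
        keeps both forms equal to 1.\<close>
      have W: "(- x) $ Ie = 0" "(- x') $ Ie = 0" "kap_form ?y (- x) = 1" "kap_form ?y' (- x') = 1"
        "kac_lift (- x) (- x') \<in> U (inv (inv g))"
      proof -
        show "kap_form ?y (- x) = 1" "kap_form ?y' (- x') = 1"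
          using V g by (simp_all add: kap_form_linear kap_form_skew[of x] kap_form_skew[of x'])
        have "(-1) *s kac_lift x x' \<in> U g" by (rule scale_U) (use g in simp_all)
        then show "kac_lift (- x) (- x') \<in> U (inv (inv g))" using g by (simp add: kac_lift_linear)
      qed (use g in simp_all)
      obtain k where k: "k \<in> carrier G" "kac_lift ?y (- ?y') \<in> U k"
        using antidiagonal_homogeneous[OF V(1) W(1) V(2) W(2-4) _ y W(5)] g by blast
      show thesis by (rule ZZ2[OF g(2) V(1) g(3) V(2-4) g(1) h(1) k(1) g(4) y h(2) k(2)])
    qed
  qed
qed

end

section \<open>Gradings given by a homogeneous basis\<close>

text \<open>Finite data certifying a grading: a basis \<open>B\<close>, its dual functionals
  \<open>C\<close> and a degree for each basis vector. Multiplicativity is required only of nonzero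
  structure constants, so for a concrete grading it is settled by running through the ten
  indices.\<close>

locale graded_basis = comm_group G for G :: "('g, 'm) monoid_scheme" (structure) +
  fixes B :: "(kap_index \<times> kap_index) option \<Rightarrow> 'a::field_char_0 kac"
    and C :: "(kap_index \<times> kap_index) option \<Rightarrow> 'a kac \<Rightarrow> 'a"
    and deg :: "(kap_index \<times> kap_index) option \<Rightarrow> 'g"
  assumes C_add: "C k (u + v) = C k u + C k v"
    and C_scale: "C k (c *s u) = c * C k u"
    and expand: "(\<Sum>k\<in>UNIV. C k v *s B k) = v"
    and dual: "C k (B l) = (if k = l then 1 else 0)"
    and deg_closed: "deg k \<in> carrier G"
    and deg_mult: "C m (kac_mult (B k) (B l)) \<noteq> 0 \<Longrightarrow> deg m = deg k \<otimes> deg l"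
    and parity: "B k \<in> kac_even \<or> B k \<in> kac_odd"
    and deg_generate: "generate G (range deg) = carrier G"
begin

definition U :: "'g \<Rightarrow> 'a kac set" where
  "U g = {v. \<forall>k. C k v \<noteq> 0 \<longrightarrow> deg k = g}"

lemma C_zero: "C k 0 = 0"
  using C_scale[of k 0 0] by simp

lemma C_sum: "C k (sum f S) = (\<Sum>i\<in>S. C k (f i))"
  by (induction S rule: infinite_finite_induct) (simp_all add: C_zero C_add)

lemma C_eqI:
  assumes "\<And>k. C k u = C k v"
  shows "u = v"
proof -
  have "(\<Sum>k\<in>UNIV. C k u *s B k) = (\<Sum>k\<in>UNIV. C k v *s B k)" by (simp only: assms)
  then show ?thesis by (simp only: expand)
qed

lemma C_linear: "Vector_Spaces.linear (*s) (*s) (\<lambda>v. C k v *s w)"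
  by unfold_locales (simp_all add: C_add C_scale vec.scale_left_distrib)

lemma subspace_U: "vec.subspace (U g)"
proof (rule vec.subspaceI)
  show "x + y \<in> U g" if "x \<in> U g" "y \<in> U g" for x y
    using that unfolding U_def by (auto simp: C_add) (metis add_0)
qed (auto simp: U_def C_zero C_scale)

lemma B_in: "B k \<in> U (deg k)"
  by (simp add: U_def dual)

lemma U_span: "U g = vec.span (B ` {k. deg k = g})"
proof
  show "vec.span (B ` {k. deg k = g}) \<subseteq> U g"
    by (rule vec.span_minimal) (auto simp: B_in subspace_U)
  show "U g \<subseteq> vec.span (B ` {k. deg k = g})"
  proof
    fix v assume v: "v \<in> U g"
    have "C k v *s B k \<in> vec.span (B ` {k. deg k = g})" for k
    proof (cases "C k v = 0")
      case True
      then show ?thesis by (simp add: vec.span_zero)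
    next
      case False
      then have "deg k = g" using v by (simp add: U_def)
      then show ?thesis by (intro vec.span_scale vec.span_base) simp
    qed
    then have "(\<Sum>k\<in>UNIV. C k v *s B k) \<in> vec.span (B ` {k. deg k = g})"
      by (intro vec.span_sum) simp
    then show "v \<in> vec.span (B ` {k. deg k = g})" by (simp add: expand)
  qed
qed

lemma B_nonzero: "B k \<noteq> 0"
  using dual[of k k] by (auto simp: C_zero)

lemma inj_B: "inj B"
  by (rule injI) (metis dual zero_neq_one)

lemma independent_B: "vec.independent (B ` S)"
proof -
  have "vec.independent (range B)"
  proof (rule vec.independent_if_scalars_zero)
    fix f b assume s: "(\<Sum>x\<in>range B. f x *s x) = 0" and "b \<in> range B"
    then obtain k where k: "b = B k" by blast
    have "C k (\<Sum>x\<in>range B. f x *s x) = (\<Sum>l\<in>UNIV. f (B l) * (if k = l then 1 else 0))"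
      by (simp add: C_sum C_scale dual sum.reindex inj_B)
    also have "\<dots> = f (B k)"
      by (simp add: if_distrib[of "(*) _"] cong: if_cong)
    finally show "f b = 0" using s by (simp add: C_zero k)
  qed simp
  then show ?thesis by (rule vec.independent_mono) auto
qed

lemma dim_U: "vec.dim (U g) = card {k. deg k = g}"
  unfolding U_span vec.dim_span
  by (subst vec.dim_eq_card_independent[OF independent_B])
    (simp add: card_image inj_on_subset[OF inj_B])

lemma U_nonzero: "U g \<noteq> {0} \<longleftrightarrow> g \<in> range deg"
proof
  assume "U g \<noteq> {0}"
  then obtain v where v: "v \<in> U g" "v \<noteq> 0" using vec.subspace_0[OF subspace_U] by blast
  then obtain k where "C k v \<noteq> 0" using C_eqI[of v 0] by (auto simp: C_zero)
  then show "g \<in> range deg" using v by (auto simp: U_def)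
next
  assume "g \<in> range deg"
  then show "U g \<noteq> {0}" using B_in B_nonzero by force
qed

lemma support_U: "support G U = range deg"
  using deg_closed by (auto simp: support_def U_nonzero)

lemma decomposition: "direct_decomposition (carrier G) U"
  unfolding direct_decomposition_def
proof (intro conjI ballI allI subspace_U)
  fix v :: "'a kac"
  define w where "w g = (\<Sum>k | deg k = g. C k v *s B k)" for g
  have Cw: "C k (w g) = (if deg k = g then C k v else 0)" for k g
    by (simp add: w_def C_sum C_scale dual if_distrib[of "(*) _"] cong: if_cong)
  have fin: "finite {g. w g \<noteq> 0}"
  proof (rule finite_subset)
    show "{g. w g \<noteq> 0} \<subseteq> range deg"
    proof
      fix g assume "g \<in> {g. w g \<noteq> 0}"
      then have "{k. deg k = g} \<noteq> {}" unfolding w_def by force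
      then show "g \<in> range deg" by blast
    qed
  qed simp
  show "\<exists>!w. (\<forall>g\<in>carrier G. w g \<in> U g) \<and> (\<forall>g. g \<notin> carrier G \<longrightarrow> w g = 0) \<and>
    finite {g. w g \<noteq> 0} \<and> v = (\<Sum>g | w g \<noteq> 0. w g)"
  proof (rule ex1I)
    have "v = (\<Sum>g | w g \<noteq> 0. w g)"
    proof (rule C_eqI)
      fix k
      have "(\<Sum>g | w g \<noteq> 0. C k (w g)) = (\<Sum>g\<in>insert (deg k) {g. w g \<noteq> 0}. C k (w g))"
        by (rule sum.mono_neutral_left) (auto simp: fin C_zero)
      also have "\<dots> = (\<Sum>g\<in>{deg k}. C k (w g))"
        by (rule sum.mono_neutral_right) (auto simp: fin Cw)
      finally show "C k v = C k (\<Sum>g | w g \<noteq> 0. w g)" by (simp add: C_sum Cw)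
    qed
    moreover have "w g = 0" if "g \<notin> carrier G" for g
      by (rule C_eqI) (use that deg_closed in \<open>auto simp: Cw C_zero\<close>)
    ultimately show "(\<forall>g\<in>carrier G. w g \<in> U g) \<and> (\<forall>g. g \<notin> carrier G \<longrightarrow> w g = 0) \<and>
        finite {g. w g \<noteq> 0} \<and> v = (\<Sum>g | w g \<noteq> 0. w g)"
      using fin by (auto simp: U_def Cw)
    fix w' assume w': "(\<forall>g\<in>carrier G. w' g \<in> U g) \<and> (\<forall>g. g \<notin> carrier G \<longrightarrow> w' g = 0) \<and>
        finite {g. w' g \<noteq> 0} \<and> v = (\<Sum>g | w' g \<noteq> 0. w' g)"
    have Cw': "C k (w' g) = 0" if "deg k \<noteq> g" for k g
      using w' that by (cases "g \<in> carrier G") (auto simp: U_def C_zero)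
    show "w' = w"
    proof
      fix g
      show "w' g = w g"
      proof (rule C_eqI)
        fix k
        have fin': "finite {g. w' g \<noteq> 0}" and v: "v = (\<Sum>g | w' g \<noteq> 0. w' g)" using w' by blast+
        have "C k v = (\<Sum>g | w' g \<noteq> 0. C k (w' g))" by (subst v) (rule C_sum)
        also have "\<dots> = (\<Sum>g\<in>insert (deg k) {g. w' g \<noteq> 0}. C k (w' g))"
          by (rule sum.mono_neutral_left) (auto simp: fin' C_zero)
        also have "\<dots> = (\<Sum>g\<in>{deg k}. C k (w' g))"
          by (rule sum.mono_neutral_right) (auto simp: fin' intro!: Cw')
        finally show "C k (w' g) = C k (w g)" using Cw' by (auto simp: Cw)
      qed
    qed
  qed
qed

lemma C_mult: "C m (kac_mult u v) = (\<Sum>k\<in>UNIV. \<Sum>l\<in>UNIV. C k u * C l v * C m (kac_mult (B k) (B l)))"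
proof -
  interpret R: Vector_Spaces.linear "(*s)" "(*s)" "kac_mult w" for w :: "'a kac" by (rule kac_mult_linear_right)
  interpret L: Vector_Spaces.linear "(*s)" "(*s)" "\<lambda>u. kac_mult u w" for w :: "'a kac" by (rule kac_mult_linear_left)
  have "kac_mult u v = kac_mult (\<Sum>k\<in>UNIV. C k u *s B k) (\<Sum>l\<in>UNIV. C l v *s B l)"
    by (simp only: expand)
  also have "\<dots> = (\<Sum>k\<in>UNIV. \<Sum>l\<in>UNIV. (C k u * C l v) *s kac_mult (B k) (B l))"
    unfolding L.sum R.sum L.scale R.scale vector_smult_assoc vec.scale_sum_right
    by (subst sum.swap) (simp add: mult.commute)
  finally show ?thesis by (simp add: C_sum C_scale)
qed

lemma mult_U:
  assumes "u \<in> U g" "v \<in> U h"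
  shows "kac_mult u v \<in> U (g \<otimes> h)"
  unfolding U_def
proof safe
  fix m assume m: "C m (kac_mult u v) \<noteq> 0"
  have "\<exists>k l. C k u * C l v * C m (kac_mult (B k) (B l)) \<noteq> 0"
  proof (rule ccontr)
    assume "\<not> ?thesis"
    then have "C m (kac_mult u v) = 0" by (subst C_mult, intro sum.neutral ballI) blast
    then show False using m by simp
  qed
  then obtain k l where kl: "C k u \<noteq> 0" "C l v \<noteq> 0" "C m (kac_mult (B k) (B l)) \<noteq> 0" by auto
  then have "deg k = g" "deg l = h" using assms by (auto simp: U_def)
  then show "deg m = g \<otimes> h" using deg_mult[OF kl(3)] by simp
qed

lemma kac_grading_U: "kac_grading G U"
  unfolding kac_grading_def support_U
proof (intro conjI ballI deg_generate decomposition mult_U)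
  show "comm_group G" by (rule comm_group_axioms)
  show "\<exists>S. finite S \<and> S \<subseteq> carrier G \<and> generate G S = carrier G"
    using deg_generate deg_closed by (intro exI[of _ "range deg"]) auto
  fix g
  let ?P = "{k. deg k = g \<and> B k \<in> kac_even}" and ?Q = "{k. deg k = g \<and> B k \<notin> kac_even}"
  show "U g = {a + b |a b. a \<in> U g \<inter> kac_even \<and> b \<in> U g \<inter> kac_odd}"
  proof safe
    fix v assume v: "v \<in> U g"
    have t: "C k v *s B k \<in> U g" for k
      using v by (auto simp: U_def C_scale dual)
    let ?a = "\<Sum>k\<in>{k. B k \<in> kac_even}. C k v *s B k" and ?b = "\<Sum>k\<in>{k. B k \<notin> kac_even}. C k v *s B k"
    have "v = (\<Sum>k\<in>{k. B k \<in> kac_even} \<union> {k. B k \<notin> kac_even}. C k v *s B k)"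
      by (simp add: expand Collect_disj_eq[symmetric])
    also have "\<dots> = ?a + ?b" by (rule sum.union_disjoint) auto
    finally have "v = ?a + ?b" .
    moreover have "?a \<in> U g" "?b \<in> U g"
      by (intro vec.subspace_sum subspace_U t)+
    moreover have "?a \<in> kac_even"
      by (intro vec.subspace_sum subspace_kac_even vec.subspace_scale) simp
    moreover have "?b \<in> kac_odd"
      using parity by (intro vec.subspace_sum subspace_kac_odd vec.subspace_scale) auto
    ultimately show "\<exists>a b. v = a + b \<and> a \<in> U g \<inter> kac_even \<and> b \<in> U g \<inter> kac_odd" by blast
  qed (rule vec.subspace_add[OF subspace_U])
qed

end

section \<open>Fineness from one-dimensional components and a faithful neutral component\<close>

locale faithful_graded_basis = graded_basis +
  assumes one_dim: "deg k = deg l \<Longrightarrow> deg k \<noteq> \<one> \<Longrightarrow> k = l"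
    and faithful: "v \<in> U \<one> \<Longrightarrow> (\<And>k. deg k \<noteq> \<one> \<Longrightarrow> kac_mult v (B k) = 0) \<Longrightarrow> v = 0"
begin

lemma U_one_dim:
  assumes "deg k \<noteq> \<one>" "v \<in> U (deg k)"
  shows "v = C k v *s B k"
proof (rule C_eqI)
  fix l
  show "C l v = C l (C k v *s B k)"
    using assms one_dim[of k l] by (cases "l = k") (auto simp: U_def C_scale dual)
qed

text \<open>In a refinement the lines cannot be split, so every \<open>B k\<close> of non-neutral
  degree stays homogeneous. A nonzero \<open>v\<close> of the refinement inside
  \<open>U \<one>\<close> has some nonzero \<open>kac_mult v (B k)\<close>, which is again a
  multiple of \<open>B k\<close>; comparing degrees, \<open>v\<close> is neutral. So the neutral
  component is not split either.\<close>

lemma no_proper_refinement: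
  fixes H :: "('h, 'n) monoid_scheme"
  assumes "kac_grading H V"
  shows "\<not> proper_refinement H V G U"
proof
  assume ref: "proper_refinement H V G U"
  interpret H: comm_group H using assms by (simp add: kac_grading_def)
  interpret V: kac_graded H V by unfold_locales (rule assms)
  have coarse: "\<exists>g\<in>range deg. V h \<subseteq> U g" if "h \<in> carrier H" "v \<in> V h" "v \<noteq> 0" for h v
    using ref that unfolding proper_refinement_def support_U by (auto simp: support_def)
  have V_eq: "V h = U g"
    if h: "h \<in> carrier H" "v \<in> V h" "v \<noteq> 0" and g: "V h \<subseteq> U g" "g \<noteq> \<one>" "g \<in> range deg" for h v g
  proof -
    obtain k where k: "g = deg k" using g by blast
    have v: "v = C k v *s B k" by (intro U_one_dim) (use g h k in auto)
    then have "C k v \<noteq> 0" using h(3) by (metis vec.scale_zero_left)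
    then have Bk: "B k \<in> V h" using h(1,2) v V.scale_U_cancel by metis
    have "U g \<subseteq> V h"
    proof
      fix u assume "u \<in> U g"
      then have "u = C k u *s B k" by (intro U_one_dim) (use g k in simp_all)
      then show "u \<in> V h" using V.scale_U[OF h(1) Bk] by metis
    qed
    then show ?thesis using g by blast
  qed
  have B_hom: "\<exists>h\<in>carrier H. B k \<in> V h" if k: "deg k \<noteq> \<one>" for k
  proof -
    let ?f = "\<lambda>v. C k v *s kac_one"
    have "?f (B k) \<noteq> 0" by (simp add: dual kac_eq_iff)
    then obtain h where h: "h \<in> carrier H" "?f (V.hcomp h (B k)) \<noteq> 0"
      using V.nonzero_hcomp_ex[OF C_linear] by blast
    let ?v = "V.hcomp h (B k)"
    have v: "?v \<in> V h" "?v \<noteq> 0" using h V.hcomp_in by (auto simp: C_zero)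
    obtain g where g: "g \<in> range deg" "V h \<subseteq> U g" using coarse[OF h(1) v] by blast
    have "deg k = g" using v(1) g h(2) by (auto simp: U_def)
    then have "V h = U (deg k)" using V_eq[OF h(1) v g(2) _ g(1)] k by simp
    then show ?thesis using B_in[of k] h(1) by blast
  qed
  have neutral: "h = \<one>\<^bsub>H\<^esub>" if h: "h \<in> carrier H" "v \<in> V h" "v \<noteq> 0" and sub: "V h \<subseteq> U \<one>" for h v
  proof -
    have "v \<in> U \<one>" using h sub by blast
    then obtain k where k: "deg k \<noteq> \<one>" "kac_mult v (B k) \<noteq> 0" using faithful h(3) by blast
    have "kac_mult v (B k) \<in> U (\<one> \<otimes> deg k)" by (intro mult_U \<open>v \<in> U \<one>\<close> B_in)
    then have "kac_mult v (B k) = C k (kac_mult v (B k)) *s B k"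
      by (intro U_one_dim k(1)) (simp add: deg_closed)
    moreover obtain h' where h': "h' \<in> carrier H" "B k \<in> V h'" using B_hom[OF k(1)] by blast
    ultimately have "kac_mult v (B k) \<in> V h'" using V.scale_U by metis
    moreover have "kac_mult v (B k) \<in> V (h \<otimes>\<^bsub>H\<^esub> h')" by (intro V.mult_U h h')
    ultimately have "h \<otimes>\<^bsub>H\<^esub> h' = h'" using V.homogeneous_disjoint k(2) h h' by (metis H.m_closed)
    then show ?thesis using h h' by simp
  qed
  obtain h g where hg: "h \<in> support H V" "g \<in> range deg" "V h \<subset> U g"
    using ref unfolding proper_refinement_def support_U by blast
  then have h: "h \<in> carrier H" by (simp add: support_def)
  obtain v where v: "v \<in> V h" "v \<noteq> 0" using hg V.zero_U[OF h] by (auto simp: support_def)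
  show False
  proof (cases "g = \<one>")
    case False
    then show False using V_eq[OF h v] hg by blast
  next
    case True
    then have h1: "h = \<one>\<^bsub>H\<^esub>" using neutral[OF h v] hg by blast
    have "V h \<subset> U \<one>" using hg True by simp
    then obtain u where u: "u \<in> U \<one>" "u \<notin> V h" by (auto simp: psubset_eq)
    \<comment> \<open>Components of \<open>u\<close> in other degrees of the refinement lie in
      non-neutral lines and have no coordinate of neutral degree. So \<open>u\<close> and its
      \<open>h\<close>-component agree in the neutral coordinates and vanish in the others.\<close>
    have other: "C k (V.hcomp h' u) = 0" if h': "h' \<noteq> h" and k: "deg k = \<one>" for h' k
    proof (cases "V.hcomp h' u = 0")
      case nz: False
      have c: "h' \<in> carrier H" using nz V.hcomp_out by blast
      have "V.hcomp h' u \<in> V h'" by (rule V.hcomp_in[OF c])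
      moreover obtain g' where g': "V h' \<subseteq> U g'" using coarse[OF c \<open>V.hcomp h' u \<in> V h'\<close> nz] by blast
      moreover have "g' \<noteq> \<one>" using neutral[OF c \<open>V.hcomp h' u \<in> V h'\<close> nz] g' h' h1 by blast
      ultimately show ?thesis using k by (auto simp: U_def)
    qed (simp add: C_zero)
    have "V.hcomp h u = u"
    proof (rule C_eqI)
      fix k
      show "C k (V.hcomp h u) = C k u"
      proof (cases "deg k = \<one>")
        case k: True
        have "C k u = (\<Sum>g | V.hcomp g u \<noteq> 0. C k (V.hcomp g u))"
          by (subst V.hcomp_sum[of u, symmetric]) (rule C_sum)
        also have "\<dots> = (\<Sum>g\<in>insert h {g. V.hcomp g u \<noteq> 0}. C k (V.hcomp g u))"
          by (rule sum.mono_neutral_left) (auto simp: V.hcomp_finite C_zero)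
        also have "\<dots> = (\<Sum>g\<in>{h}. C k (V.hcomp g u))"
          by (rule sum.mono_neutral_right) (auto simp: V.hcomp_finite other k)
        finally show ?thesis by simp
      next
        case False
        have "V.hcomp h u \<in> U \<one>" using V.hcomp_in[OF h, of u] \<open>V h \<subset> U \<one>\<close> by (auto simp: psubset_eq)
        then have "C k (V.hcomp h u) = 0" "C k u = 0" using u(1) False by (auto simp: U_def)
        then show ?thesis by simp
      qed
    qed
    then show False using V.hcomp_in[OF h, of u] u(2) by simp
  qed
qed

lemma fine: "fine_grading G U"
  unfolding fine_grading_def using kac_grading_U no_proper_refinement by blast

end

section \<open>The two gradings\<close>

lemma group_ZZ: "comm_group ZZ_group" and group_ZZ2: "comm_group ZZ2_group"
  by (rule group.group_comm_groupI[OF DirProd_group]; simp add: DirProd_def add.commute split: prod.splits)+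

lemma ZZ_simps: "carrier ZZ_group = UNIV" "g \<otimes>\<^bsub>ZZ_group\<^esub> h = g + h" "\<one>\<^bsub>ZZ_group\<^esub> = (0, 0)"
  by (simp_all add: DirProd_def split: prod.splits)

lemma ZZ2_simps: "carrier ZZ2_group = UNIV \<times> {0, 1}"
  "g \<otimes>\<^bsub>ZZ2_group\<^esub> h = (fst g + fst h, (snd g + snd h) mod 2)" "\<one>\<^bsub>ZZ2_group\<^esub> = (0, 0)"
  by (auto simp add: DirProd_def carrier_integer_mod_group split: prod.splits)

lemma generate_ZZ:
  assumes "{(1, 0), (-1, 0), (0, 1), (0, -1)} \<subseteq> S"
  shows "generate ZZ_group S = carrier ZZ_group"
proof -
  note eng = generate.eng[where G = ZZ_group, unfolded ZZ_simps]
  have 1: "(m, 0) \<in> generate ZZ_group S" for m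
  proof (induction m rule: int_induct[where k = 0])
    case base
    then show ?case using generate.one[of ZZ_group S] by (simp add: ZZ_simps)
  next
    case (step1 i)
    then show ?case using eng[OF step1(2) generate.incl[of "(1, 0)"]] assms by simp
  next
    case (step2 i)
    then show ?case using eng[OF step2(2) generate.incl[of "(-1, 0)"]] assms by simp
  qed
  have 2: "(0, m) \<in> generate ZZ_group S" for m
  proof (induction m rule: int_induct[where k = 0])
    case base
    then show ?case using generate.one[of ZZ_group S] by (simp add: ZZ_simps)
  next
    case (step1 i)
    then show ?case using eng[OF step1(2) generate.incl[of "(0, 1)"]] assms by simp
  next
    case (step2 i)
    then show ?case using eng[OF step2(2) generate.incl[of "(0, -1)"]] assms by simp
  qed
  have "(m, n) \<in> generate ZZ_group S" for m n
    using eng[OF 1[of m] 2[of n]] by simp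
  then show ?thesis by (auto simp: ZZ_simps)
qed

lemma generate_ZZ2:
  assumes "{(1, 0), (-1, 0), (0, 1)} \<subseteq> S" "S \<subseteq> carrier ZZ2_group"
  shows "generate ZZ2_group S = carrier ZZ2_group"
proof -
  interpret comm_group ZZ2_group by (rule group_ZZ2)
  note eng = generate.eng[where G = ZZ2_group, unfolded ZZ2_simps]
  have 1: "(m, 0) \<in> generate ZZ2_group S" for m
  proof (induction m rule: int_induct[where k = 0])
    case base
    then show ?case using generate.one[of ZZ2_group S] by (simp add: ZZ2_simps)
  next
    case (step1 i)
    then show ?case using eng[OF step1(2) generate.incl[of "(1, 0)"]] assms by simp
  next
    case (step2 i)
    then show ?case using eng[OF step2(2) generate.incl[of "(-1, 0)"]] assms by simp
  qed
  have 2: "(0, 1) \<in> generate ZZ2_group S" using assms by (intro generate.incl) simp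
  have "(m, 1) \<in> generate ZZ2_group S" for m
    using eng[OF 1[of m] 2] by simp
  then have "carrier ZZ2_group \<subseteq> generate ZZ2_group S" unfolding ZZ2_simps(1) using 1 by auto
  then show ?thesis using generate_incl[OF assms(2)] by blast
qed

fun kap_weight :: "kap_index \<Rightarrow> int" where
  "kap_weight Ie = 0"
| "kap_weight Ix = 1"
| "kap_weight Iy = -1"

fun ZZ_deg :: "(kap_index \<times> kap_index) option \<Rightarrow> int \<times> int" where
  "ZZ_deg None = (0, 0)"
| "ZZ_deg (Some (i, j)) = (kap_weight i, kap_weight j)"

text \<open>Eigenvectors of the signed flip
  \<open>a \<otimes> b \<mapsto> (-1)^(|a||b|) b \<otimes> a\<close>; the second entry of
  \<open>ZZ2_deg\<close> is 0 for eigenvalue 1 and 1 for eigenvalue -1, and the first is the total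
  weight. Because of the sign, \<open>x \<otimes> y - y \<otimes> x\<close> is fixed while
  \<open>x \<otimes> x\<close> is negated. The indices of the tensor basis are reused as mere
  labels.\<close>

fun ZZ2_basis :: "(kap_index \<times> kap_index) option \<Rightarrow> 'a::field kac" where
  "ZZ2_basis None = kac_one"
| "ZZ2_basis (Some (Ie, Ie)) = kap_e \<^bold>\<otimes> kap_e"
| "ZZ2_basis (Some (Ix, Ix)) = kap_x \<^bold>\<otimes> kap_x"
| "ZZ2_basis (Some (Iy, Iy)) = kap_y \<^bold>\<otimes> kap_y"
| "ZZ2_basis (Some (Ix, Iy)) = kap_x \<^bold>\<otimes> kap_y - kap_y \<^bold>\<otimes> kap_x"
| "ZZ2_basis (Some (Iy, Ix)) = kap_x \<^bold>\<otimes> kap_y + kap_y \<^bold>\<otimes> kap_x"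
| "ZZ2_basis (Some (Ie, Ix)) = kap_e \<^bold>\<otimes> kap_x + kap_x \<^bold>\<otimes> kap_e"
| "ZZ2_basis (Some (Ix, Ie)) = kap_e \<^bold>\<otimes> kap_x - kap_x \<^bold>\<otimes> kap_e"
| "ZZ2_basis (Some (Ie, Iy)) = kap_e \<^bold>\<otimes> kap_y + kap_y \<^bold>\<otimes> kap_e"
| "ZZ2_basis (Some (Iy, Ie)) = kap_e \<^bold>\<otimes> kap_y - kap_y \<^bold>\<otimes> kap_e"

fun ZZ2_coord :: "(kap_index \<times> kap_index) option \<Rightarrow> 'a::field kac \<Rightarrow> 'a" where
  "ZZ2_coord None v = v $ None"
| "ZZ2_coord (Some (Ie, Ie)) v = v $ Some (Ie, Ie)"
| "ZZ2_coord (Some (Ix, Ix)) v = v $ Some (Ix, Ix)"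
| "ZZ2_coord (Some (Iy, Iy)) v = v $ Some (Iy, Iy)"
| "ZZ2_coord (Some (Ix, Iy)) v = (v $ Some (Ix, Iy) - v $ Some (Iy, Ix)) / 2"
| "ZZ2_coord (Some (Iy, Ix)) v = (v $ Some (Ix, Iy) + v $ Some (Iy, Ix)) / 2"
| "ZZ2_coord (Some (Ie, Ix)) v = (v $ Some (Ie, Ix) + v $ Some (Ix, Ie)) / 2"
| "ZZ2_coord (Some (Ix, Ie)) v = (v $ Some (Ie, Ix) - v $ Some (Ix, Ie)) / 2"
| "ZZ2_coord (Some (Ie, Iy)) v = (v $ Some (Ie, Iy) + v $ Some (Iy, Ie)) / 2"
| "ZZ2_coord (Some (Iy, Ie)) v = (v $ Some (Ie, Iy) - v $ Some (Iy, Ie)) / 2"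

fun ZZ2_deg :: "(kap_index \<times> kap_index) option \<Rightarrow> int \<times> int" where
  "ZZ2_deg None = (0, 0)"
| "ZZ2_deg (Some (Ie, Ie)) = (0, 0)"
| "ZZ2_deg (Some (Ix, Ix)) = (2, 1)"
| "ZZ2_deg (Some (Iy, Iy)) = (-2, 1)"
| "ZZ2_deg (Some (Ix, Iy)) = (0, 0)"
| "ZZ2_deg (Some (Iy, Ix)) = (0, 1)"
| "ZZ2_deg (Some (Ie, Ix)) = (1, 0)"
| "ZZ2_deg (Some (Ix, Ie)) = (1, 1)"
| "ZZ2_deg (Some (Ie, Iy)) = (-1, 0)"
| "ZZ2_deg (Some (Iy, Ie)) = (-1, 1)"

abbreviation ZZ_basis :: "(kap_index \<times> kap_index) option \<Rightarrow> 'a::field kac" where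
  "ZZ_basis k \<equiv> axis k 1"

lemma ZZ_deg_mult:
  "\<forall>k l m. kac_mult (ZZ_basis k) (ZZ_basis l :: 'a::field_char_0 kac) $ m \<noteq> 0 \<longrightarrow> ZZ_deg m = ZZ_deg k + ZZ_deg l"
  unfolding kac_index_all by (simp add: kac_mult_nth axis_nth_if)

lemma ZZ2_deg_mult:
  "\<forall>k l m. ZZ2_coord m (kac_mult (ZZ2_basis k) (ZZ2_basis l :: 'a::field_char_0 kac)) \<noteq> 0 \<longrightarrow>
     ZZ2_deg m = (fst (ZZ2_deg k) + fst (ZZ2_deg l), (snd (ZZ2_deg k) + snd (ZZ2_deg l)) mod 2)"
  unfolding kac_index_all by (simp add: kac_mult_nth)

text \<open>Turns an image over the ten indices into an explicit union, so that \<open>simp\<close>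
  can evaluate supports and spanning sets.\<close>

lemma kac_index_image: "f ` {k. P k} =
    (if P None then {f None} else {}) \<union> (if P (Some (Ie,Ie)) then {f (Some (Ie,Ie))} else {})
    \<union> (if P (Some (Ie,Ix)) then {f (Some (Ie,Ix))} else {}) \<union> (if P (Some (Ie,Iy)) then {f (Some (Ie,Iy))} else {})
    \<union> (if P (Some (Ix,Ie)) then {f (Some (Ix,Ie))} else {}) \<union> (if P (Some (Ix,Ix)) then {f (Some (Ix,Ix))} else {})
    \<union> (if P (Some (Ix,Iy)) then {f (Some (Ix,Iy))} else {}) \<union> (if P (Some (Iy,Ie)) then {f (Some (Iy,Ie))} else {})
    \<union> (if P (Some (Iy,Ix)) then {f (Some (Iy,Ix))} else {}) \<union> (if P (Some (Iy,Iy)) then {f (Some (Iy,Iy))} else {})"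
    (is "_ = ?R")
proof
  have "\<forall>k. P k \<longrightarrow> f k \<in> ?R" unfolding kac_index_all by simp
  then show "f ` {k. P k} \<subseteq> ?R" by blast
  show "?R \<subseteq> f ` {k. P k}" by (simp split: if_splits)
qed

lemmas kac_index_Collect = kac_index_image[where f = "\<lambda>k. k", unfolded image_ident]
lemmas kac_index_range = kac_index_image[where P = "\<lambda>_. True", unfolded if_True Collect_const]

text \<open>The left sides are the scalars by which \<open>a 1 + b E\<close> acts on the odd part
  and on \<open>V \<otimes> V\<close>.\<close>

lemma two_equations:
  fixes a b :: "'a::field_char_0"
  assumes "a + b / 2 = 0" "a + b / 4 = 0"
  shows "a = 0" "b = 0"
proof -
  have "b = 4 * ((a + b / 2) - (a + b / 4))" by (simp add: field_simps)
  then show "b = 0" using assms by simp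
  then show "a = 0" using assms by simp
qed

interpretation ZZ: faithful_graded_basis ZZ_group ZZ_basis "\<lambda>k v. v $ k" ZZ_deg
proof -
  interpret comm_group ZZ_group by (rule group_ZZ)
  interpret ZZ: graded_basis ZZ_group "ZZ_basis :: _ \<Rightarrow> 'a::field_char_0 kac" "\<lambda>k v. v $ k" ZZ_deg
  proof unfold_locales
    show "ZZ_deg m = ZZ_deg k \<otimes>\<^bsub>ZZ_group\<^esub> ZZ_deg l" if "kac_mult (ZZ_basis k) (ZZ_basis l :: 'a kac) $ m \<noteq> 0" for k l m
      unfolding ZZ_simps using ZZ_deg_mult that by blast
    have "\<forall>k. (ZZ_basis k :: 'a kac) \<in> kac_even \<or> (ZZ_basis k :: 'a kac) \<in> kac_odd"
      unfolding kac_index_all by (simp add: kac_even_iff kac_odd_iff axis_nth_if)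
    then show "(ZZ_basis k :: 'a kac) \<in> kac_even \<or> (ZZ_basis k :: 'a kac) \<in> kac_odd" for k by blast
    show "generate ZZ_group (range ZZ_deg) = carrier ZZ_group"
      by (rule generate_ZZ) (simp add: kac_index_range)
    show "(\<Sum>k\<in>UNIV. v $ k *s axis k 1) = v" for v :: "'a kac" by (rule basis_expansion)
  qed (simp_all add: axis_nth_if ZZ_simps(1))
  show "faithful_graded_basis ZZ_group (ZZ_basis :: _ \<Rightarrow> 'a kac) (\<lambda>k v. v $ k) ZZ_deg"
  proof unfold_locales
    have "\<forall>k l. ZZ_deg k = ZZ_deg l \<longrightarrow> ZZ_deg k \<noteq> (0, 0) \<longrightarrow> k = l"
      unfolding kac_index_all by simp
    then show "k = l" if "ZZ_deg k = ZZ_deg l" "ZZ_deg k \<noteq> \<one>\<^bsub>ZZ_group\<^esub>" for k l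
      using that unfolding ZZ_simps by blast
    fix v :: "'a kac"
    assume v: "v \<in> ZZ.U \<one>\<^bsub>ZZ_group\<^esub>" and ann: "\<And>k. ZZ_deg k \<noteq> \<one>\<^bsub>ZZ_group\<^esub> \<Longrightarrow> kac_mult v (axis k 1) = 0"
    from v have "\<forall>k. v $ k \<noteq> 0 \<longrightarrow> ZZ_deg k = (0, 0)" unfolding ZZ.U_def ZZ_simps by blast
    then have z: "v $ Some (Ie,Ix) = 0" "v $ Some (Ie,Iy) = 0" "v $ Some (Ix,Ie) = 0" "v $ Some (Ix,Ix) = 0"
        "v $ Some (Ix,Iy) = 0" "v $ Some (Iy,Ie) = 0" "v $ Some (Iy,Ix) = 0" "v $ Some (Iy,Iy) = 0"
      unfolding kac_index_all by simp_all
    have "kac_mult v (axis (Some (Ix,Ie)) 1) $ Some (Ix,Ie) = 0" "kac_mult v (axis (Some (Ix,Ix)) 1) $ Some (Ix,Ix) = 0"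
      using ann[of "Some (Ix,Ie)"] ann[of "Some (Ix,Ix)"] by (simp_all add: ZZ_simps(3))
    then have "v $ None + v $ Some (Ie,Ie) / 2 = 0" "v $ None + v $ Some (Ie,Ie) / 4 = 0"
      by (simp_all add: kac_mult_nth axis_nth_if)
    note two_equations[OF this]
    with z show "v = 0" by (simp add: kac_eq_iff)
  qed
qed

interpretation ZZ2: faithful_graded_basis ZZ2_group ZZ2_basis ZZ2_coord ZZ2_deg
proof -
  interpret comm_group ZZ2_group by (rule group_ZZ2)
  interpret ZZ2: graded_basis ZZ2_group "ZZ2_basis :: _ \<Rightarrow> 'a::field_char_0 kac" ZZ2_coord ZZ2_deg
  proof unfold_locales
    show "ZZ2_deg m = ZZ2_deg k \<otimes>\<^bsub>ZZ2_group\<^esub> ZZ2_deg l"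
      if "ZZ2_coord m (kac_mult (ZZ2_basis k) (ZZ2_basis l :: 'a kac)) \<noteq> 0" for k l m
      unfolding ZZ2_simps using ZZ2_deg_mult that by blast
    have "\<forall>k. (ZZ2_basis k :: 'a kac) \<in> kac_even \<or> (ZZ2_basis k :: 'a kac) \<in> kac_odd"
      unfolding kac_index_all by (simp add: kac_even_iff kac_odd_iff)
    then show "(ZZ2_basis k :: 'a kac) \<in> kac_even \<or> (ZZ2_basis k :: 'a kac) \<in> kac_odd" for k by blast
    have "\<forall>k. ZZ2_deg k \<in> carrier ZZ2_group"
      unfolding kac_index_all ZZ2_simps(1) by simp
    then show c: "ZZ2_deg k \<in> carrier ZZ2_group" for k by blast
    show "generate ZZ2_group (range ZZ2_deg) = carrier ZZ2_group"
      by (rule generate_ZZ2) (use c in \<open>auto simp add: kac_index_range\<close>)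
    show "(\<Sum>k\<in>UNIV. ZZ2_coord k v *s ZZ2_basis k) = v" for v :: "'a kac"
      by (simp add: sum_UNIV_kac_index sum_UNIV_kap_index kac_eq_iff field_simps)
    have "\<forall>k u v. ZZ2_coord k (u + v :: 'a kac) = ZZ2_coord k u + ZZ2_coord k v"
      unfolding kac_index_all by (simp add: add_divide_distrib diff_divide_distrib)
    then show "ZZ2_coord k (u + v) = ZZ2_coord k u + ZZ2_coord k v" for k and u v :: "'a kac" by blast
    have "\<forall>k c u. ZZ2_coord k (c *s u :: 'a kac) = c * ZZ2_coord k u"
      unfolding kac_index_all by (simp add: algebra_simps)
    then show "ZZ2_coord k (c *s u) = c * ZZ2_coord k u" for k c and u :: "'a kac" by blast
    have "\<forall>k l. ZZ2_coord k (ZZ2_basis l :: 'a kac) = (if k = l then 1 else 0)"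
      unfolding kac_index_all by simp
    then show "ZZ2_coord k (ZZ2_basis l :: 'a kac) = (if k = l then 1 else 0)" for k l by blast
  qed
  show "faithful_graded_basis ZZ2_group (ZZ2_basis :: _ \<Rightarrow> 'a kac) ZZ2_coord ZZ2_deg"
  proof unfold_locales
    have "\<forall>k l. ZZ2_deg k = ZZ2_deg l \<longrightarrow> ZZ2_deg k \<noteq> (0, 0) \<longrightarrow> k = l"
      unfolding kac_index_all by simp
    then show "k = l" if "ZZ2_deg k = ZZ2_deg l" "ZZ2_deg k \<noteq> \<one>\<^bsub>ZZ2_group\<^esub>" for k l
      using that unfolding ZZ2_simps by blast
    fix v :: "'a kac"
    assume v: "v \<in> ZZ2.U \<one>\<^bsub>ZZ2_group\<^esub>" and ann: "\<And>k. ZZ2_deg k \<noteq> \<one>\<^bsub>ZZ2_group\<^esub> \<Longrightarrow> kac_mult v (ZZ2_basis k) = 0"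
    from v have "\<forall>k. ZZ2_coord k v \<noteq> 0 \<longrightarrow> ZZ2_deg k = (0, 0)" unfolding ZZ2.U_def ZZ2_simps by blast
    then have z: "v $ Some (Ie,Ix) = 0" "v $ Some (Ie,Iy) = 0" "v $ Some (Ix,Ie) = 0" "v $ Some (Ix,Ix) = 0"
        "v $ Some (Iy,Ie) = 0" "v $ Some (Iy,Iy) = 0" "v $ Some (Iy,Ix) = - v $ Some (Ix,Iy)"
      unfolding kac_index_all by (auto simp: eq_neg_iff_add_eq_0 add.commute)
    have "kac_mult v (ZZ2_basis k) $ l = 0" if "ZZ2_deg k \<noteq> (0, 0)" for k l
      using ann[of k] that by (simp add: ZZ2_simps(3))
    \<comment> \<open>The neutral element \<open>\<alpha> 1 + \<beta> E + \<gamma> (x \<otimes> y -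
      y \<otimes> x)\<close> has eigenvectors \<open>e \<otimes> x - x \<otimes> e\<close>,
      \<open>x \<otimes> x\<close> and \<open>e \<otimes> x + x \<otimes> e\<close>, with
      eigenvalues \<open>\<alpha> + \<beta>/2 + \<gamma>/2\<close>,
      \<open>\<alpha> + \<beta>/4\<close> and \<open>\<alpha> + \<beta>/2 - \<gamma>/2\<close>. If
      all three vanish, so do the coefficients.\<close>
    from this[of "Some (Ix,Ie)" "Some (Ie,Ix)"] this[of "Some (Ix,Ix)" "Some (Ix,Ix)"] this[of "Some (Ie,Ix)" "Some (Ie,Ix)"]
    have e: "v $ None + v $ Some (Ie,Ie) / 2 + v $ Some (Ix,Iy) / 2 = 0" "v $ None + v $ Some (Ie,Ie) / 4 = 0"
        "v $ None + v $ Some (Ie,Ie) / 2 - v $ Some (Ix,Iy) / 2 = 0"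
      by (simp_all add: kac_mult_nth z algebra_simps)
    have "v $ Some (Ix,Iy) = (v $ None + v $ Some (Ie,Ie) / 2 + v $ Some (Ix,Iy) / 2)
        - (v $ None + v $ Some (Ie,Ie) / 2 - v $ Some (Ix,Iy) / 2)" by (simp add: field_simps)
    then have "v $ Some (Ix,Iy) = 0" unfolding e by simp
    moreover from this have "v $ None = 0" "v $ Some (Ie,Ie) = 0" using two_equations e by auto
    ultimately show "v = 0" using z by (simp add: kac_eq_iff)
  qed
qed

section \<open>Components, supports and types of the two gradings\<close>

lemma ZZ_U: "ZZ.U = kac_ZZ_grading"
proof
  fix g :: "int \<times> int"
  show "ZZ.U g = (kac_ZZ_grading g :: 'a::field_char_0 kac set)"
  proof (cases "g \<in> {(0,0), (0,1), (0,-1), (1,0), (1,1), (1,-1), (-1,0), (-1,1), (-1,-1)}")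
    case True
    then show ?thesis
      unfolding ZZ.U_span kac_index_image insert_iff empty_iff
      by (elim disjE; simp add: kac_ZZ_grading_def kac_axis_None kac_axis_Some kap_axis insert_commute)
  next
    case False
    then have "{k. ZZ_deg k = g} = {}" unfolding kac_index_Collect by auto
    then have "ZZ.U g = ({0} :: 'a kac set)" unfolding ZZ.U_span by simp
    then show ?thesis using False by (simp add: kac_ZZ_grading_def)
  qed
qed

lemma ZZ2_U: "ZZ2.U = kac_ZZ2_grading"
proof
  fix g :: "int \<times> int"
  show "ZZ2.U g = (kac_ZZ2_grading g :: 'a::field_char_0 kac set)"
  proof (cases "g \<in> {(0,0), (2,1), (-2,1), (0,1), (1,0), (1,1), (-1,0), (-1,1)}")
    case True
    then show ?thesis
      unfolding ZZ2.U_span kac_index_image insert_iff empty_iff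
      by (elim disjE; simp add: kac_ZZ2_grading_def insert_commute)
  next
    case False
    then have "{k. ZZ2_deg k = g} = {}" unfolding kac_index_Collect by auto
    then have "ZZ2.U g = ({0} :: 'a kac set)" unfolding ZZ2.U_span by simp
    then show ?thesis using False by (simp add: kac_ZZ2_grading_def)
  qed
qed

lemma ZZ_support: "support ZZ_group (kac_ZZ_grading :: _ \<Rightarrow> 'a::field_char_0 kac set) =
    {(0,0), (0,1), (0,-1), (1,0), (1,1), (1,-1), (-1,0), (-1,1), (-1,-1)}"
  unfolding ZZ_U[symmetric] ZZ.support_U kac_index_range by auto

lemma ZZ2_support: "support ZZ2_group (kac_ZZ2_grading :: _ \<Rightarrow> 'a::field_char_0 kac set) =
    {(0,0), (2,1), (-2,1), (0,1), (1,0), (1,1), (-1,0), (-1,1)}"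
  unfolding ZZ2_U[symmetric] ZZ2.support_U kac_index_range by auto

lemma ZZ_dim:
  assumes "g \<in> support ZZ_group (kac_ZZ_grading :: _ \<Rightarrow> 'a::field_char_0 kac set)"
  shows "vec.dim (kac_ZZ_grading g :: 'a kac set) = (if g = (0, 0) then 2 else 1)"
proof -
  from assms obtain k where k: "g = ZZ_deg k" unfolding ZZ_U[symmetric] ZZ.support_U by blast
  have "{k. ZZ_deg k = g} = {k}" if "g \<noteq> (0, 0)"
  proof -
    have "l = k" if "ZZ_deg l = g" for l
      by (rule ZZ.one_dim) (use that \<open>g \<noteq> (0, 0)\<close> k in \<open>simp_all add: ZZ_simps(3)\<close>)
    then show ?thesis using k by blast
  qed
  moreover have "\<forall>k. ZZ_deg k = (0, 0) \<longleftrightarrow> k \<in> {None, Some (Ie,Ie)}"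
    unfolding kac_index_all by simp
  then have "{k. ZZ_deg k = (0, 0)} = {None, Some (Ie,Ie)}" by blast
  ultimately show ?thesis unfolding ZZ_U[symmetric] ZZ.dim_U by simp
qed

lemma ZZ2_dim:
  assumes "g \<in> support ZZ2_group (kac_ZZ2_grading :: _ \<Rightarrow> 'a::field_char_0 kac set)"
  shows "vec.dim (kac_ZZ2_grading g :: 'a kac set) = (if g = (0, 0) then 3 else 1)"
proof -
  from assms obtain k where k: "g = ZZ2_deg k" unfolding ZZ2_U[symmetric] ZZ2.support_U by blast
  have "{k. ZZ2_deg k = g} = {k}" if "g \<noteq> (0, 0)"
  proof -
    have "l = k" if "ZZ2_deg l = g" for l
      by (rule ZZ2.one_dim) (use that \<open>g \<noteq> (0, 0)\<close> k in \<open>simp_all add: ZZ2_simps(3)\<close>)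
    then show ?thesis using k by blast
  qed
  moreover have "\<forall>k. ZZ2_deg k = (0, 0) \<longleftrightarrow> k \<in> {None, Some (Ie,Ie), Some (Ix,Iy)}"
    unfolding kac_index_all by simp
  then have "{k. ZZ2_deg k = (0, 0)} = {None, Some (Ie,Ie), Some (Ix,Iy)}" by blast
  ultimately show ?thesis unfolding ZZ2_U[symmetric] ZZ2.dim_U by simp
qed

lemma ZZ_type: "grading_type ZZ_group (kac_ZZ_grading :: _ \<Rightarrow> 'a::field_char_0 kac set) [8, 1]"
proof -
  let ?J = "kac_ZZ_grading :: _ \<Rightarrow> 'a kac set"
  let ?S = "support ZZ_group ?J"
  have fin: "finite ?S" by (simp add: ZZ_support)
  have "{g \<in> ?S. vec.dim (?J g) = 1} = ?S - {(0, 0)}"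
    using ZZ_dim[where 'a = 'a] by (auto split: if_splits)
  then have c1: "card {g \<in> ?S. vec.dim (?J g) = 1} = 8"
    by (simp only:) (simp add: ZZ_support)
  have "{g \<in> ?S. vec.dim (?J g) = 2} = ?S \<inter> {(0, 0)}"
    using ZZ_dim[where 'a = 'a] by (auto split: if_splits)
  then have c2: "card {g \<in> ?S. vec.dim (?J g) = 2} = 1"
    by (simp only:) (simp add: ZZ_support)
  have r: "{1..length [8::nat, 1]} = {1, 2}" by auto
  have "vec.dim (?J g) \<le> length [8::nat, 1]" if "g \<in> ?S" for g
    using ZZ_dim[OF that] by simp
  moreover have "card {g \<in> ?S. vec.dim (?J g) = i} = [8, 1] ! (i - 1)" if "i \<in> {1..length [8::nat, 1]}" for i
  proof -
    from that have "i = 1 \<or> i = 2" unfolding r by simp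
    then show ?thesis by (elim disjE) (simp_all only: c1 c2, simp_all)
  qed
  ultimately show ?thesis
    unfolding grading_type_def using fin by blast
qed

lemma ZZ2_type: "grading_type ZZ2_group (kac_ZZ2_grading :: _ \<Rightarrow> 'a::field_char_0 kac set) [7, 0, 1]"
proof -
  let ?J = "kac_ZZ2_grading :: _ \<Rightarrow> 'a kac set"
  let ?S = "support ZZ2_group ?J"
  have fin: "finite ?S" by (simp add: ZZ2_support)
  have "{g \<in> ?S. vec.dim (?J g) = 1} = ?S - {(0, 0)}"
    using ZZ2_dim[where 'a = 'a] by (auto split: if_splits)
  then have c1: "card {g \<in> ?S. vec.dim (?J g) = 1} = 7"
    by (simp only:) (simp add: ZZ2_support)
  have "{g \<in> ?S. vec.dim (?J g) = 2} = {}"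
    using ZZ2_dim[where 'a = 'a] by (auto split: if_splits)
  then have c2: "card {g \<in> ?S. vec.dim (?J g) = 2} = 0"
    by (simp only:) (simp add: ZZ2_support)
  have "{g \<in> ?S. vec.dim (?J g) = 3} = ?S \<inter> {(0, 0)}"
    using ZZ2_dim[where 'a = 'a] by (auto split: if_splits)
  then have c3: "card {g \<in> ?S. vec.dim (?J g) = 3} = 1"
    by (simp only:) (simp add: ZZ2_support)
  have r: "{1..length [7::nat, 0, 1]} = {1, 2, 3}" by auto
  have "vec.dim (?J g) \<le> length [7::nat, 0, 1]" if "g \<in> ?S" for g
    using ZZ2_dim[OF that] by simp
  moreover have "card {g \<in> ?S. vec.dim (?J g) = i} = [7, 0, 1] ! (i - 1)" if "i \<in> {1..length [7::nat, 0, 1]}" for i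
  proof -
    from that have "i = 1 \<or> i = 2 \<or> i = 3" unfolding r by simp
    then show ?thesis by (elim disjE) (simp_all only: c1 c2 c3, simp_all)
  qed
  ultimately show ?thesis
    unfolding grading_type_def using fin by blast
qed

section \<open>Classification\<close>

lemma kac_Aut_inv:
  assumes "\<phi> \<in> kac_Aut"
  shows "inv_into UNIV \<phi> \<in> kac_Aut" "inv_into UNIV \<phi> (\<phi> v) = v" "\<phi> (inv_into UNIV \<phi> v) = v"
proof -
  have lin: "Vector_Spaces.linear (*s) (*s) \<phi>" and bij: "bij \<phi>"
    and hom: "\<phi> (kac_mult u v) = kac_mult (\<phi> u) (\<phi> v)"
    and par: "\<phi> ` kac_even = kac_even" "\<phi> ` kac_odd = kac_odd" for u v
    using assms by (auto simp: kac_Aut_def)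
  interpret \<phi>: Vector_Spaces.linear "(*s)" "(*s)" \<phi> by (rule lin)
  show l: "inv_into UNIV \<phi> (\<phi> v) = v" and r: "\<phi> (inv_into UNIV \<phi> v) = v" for v
    using bij by (simp_all add: bij_def surj_f_inv_f)
  have "inv_into UNIV \<phi> (u + v) = inv_into UNIV \<phi> u + inv_into UNIV \<phi> v" for u v
    using l[of "inv_into UNIV \<phi> u + inv_into UNIV \<phi> v"] by (simp add: \<phi>.add r)
  moreover have "inv_into UNIV \<phi> (c *s u) = c *s inv_into UNIV \<phi> u" for c u
    using l[of "c *s inv_into UNIV \<phi> u"] by (simp add: \<phi>.scale r)
  ultimately have "Vector_Spaces.linear (*s) (*s) (inv_into UNIV \<phi>)" by unfold_locales
  moreover have "inv_into UNIV \<phi> (kac_mult u v) = kac_mult (inv_into UNIV \<phi> u) (inv_into UNIV \<phi> v)" for u v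
    using l[of "kac_mult (inv_into UNIV \<phi> u) (inv_into UNIV \<phi> v)"] by (simp add: hom r)
  moreover have "inv_into UNIV \<phi> ` kac_even = kac_even" "inv_into UNIV \<phi> ` kac_odd = kac_odd"
    using par image_inv_f_f[OF bij_is_inj[OF bij]] by metis+
  ultimately show "inv_into UNIV \<phi> \<in> kac_Aut" using bij_imp_bij_inv[OF bij] by (simp add: kac_Aut_def)
qed

lemma image_zero_iff:
  assumes "\<phi> \<in> kac_Aut"
  shows "\<phi> ` A = {0} \<longleftrightarrow> A = {0}"
proof -
  interpret \<phi>: Vector_Spaces.linear "(*s)" "(*s)" \<phi> using assms by (simp add: kac_Aut_def)
  have "inj \<phi>" using assms by (simp add: kac_Aut_def bij_def)
  then have "\<phi> ` A = \<phi> ` {0} \<longleftrightarrow> A = {0}" by (rule inj_image_eq_iff)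
  then show ?thesis by (simp add: \<phi>.zero)
qed

lemma support_image:
  assumes "\<phi> \<in> kac_Aut"
  shows "support H (\<lambda>h. \<phi> ` V h) = support H V"
  by (simp add: support_def image_zero_iff[OF assms])

lemma direct_decomposition_image:
  assumes \<phi>: "\<phi> \<in> kac_Aut" and V: "direct_decomposition I V"
  shows "direct_decomposition I (\<lambda>h. \<phi> ` V h)"
  unfolding direct_decomposition_def
proof (intro conjI ballI allI)
  interpret \<phi>: Vector_Spaces.linear "(*s)" "(*s)" \<phi> using \<phi> by (simp add: kac_Aut_def)
  interpret \<psi>: Vector_Spaces.linear "(*s)" "(*s)" "inv_into UNIV \<phi>"
    using kac_Aut_inv(1)[OF \<phi>] by (simp add: kac_Aut_def)
  note cancel = kac_Aut_inv(2,3)[OF \<phi>]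
  have z: "\<phi> u = 0 \<longleftrightarrow> u = 0" "inv_into UNIV \<phi> u = 0 \<longleftrightarrow> u = 0" for u
    using cancel \<phi>.zero \<psi>.zero by metis+
  show "vec.subspace (\<phi> ` V h)" if "h \<in> I" for h
    using V that by (intro \<phi>.subspace_image) (simp add: direct_decomposition_def)
  fix v
  let ?P = "\<lambda>V v w. (\<forall>g\<in>I. w g \<in> V g) \<and> (\<forall>g. g \<notin> I \<longrightarrow> w g = 0) \<and> finite {g. w g \<noteq> 0} \<and> v = (\<Sum>g | w g \<noteq> 0. w g)"
  from V have "\<exists>!w. ?P V (inv_into UNIV \<phi> v) w" by (simp add: direct_decomposition_def)
  then obtain w where w: "?P V (inv_into UNIV \<phi> v) w" and uniq: "\<And>w'. ?P V (inv_into UNIV \<phi> v) w' \<Longrightarrow> w' = w" by (elim ex1E) blast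
  show "\<exists>!w. ?P (\<lambda>h. \<phi> ` V h) v w"
  proof (rule ex1I)
    have "v = \<phi> (\<Sum>g | w g \<noteq> 0. w g)" using w cancel by metis
    then have "v = (\<Sum>g | w g \<noteq> 0. \<phi> (w g))" by (simp only: \<phi>.sum)
    then show "?P (\<lambda>h. \<phi> ` V h) v (\<lambda>g. \<phi> (w g))" using w by (simp add: z \<phi>.zero)
    fix w' assume w': "?P (\<lambda>h. \<phi> ` V h) v w'"
    then have "inv_into UNIV \<phi> v = inv_into UNIV \<phi> (\<Sum>g | w' g \<noteq> 0. w' g)" by simp
    also have "\<dots> = (\<Sum>g | w' g \<noteq> 0. inv_into UNIV \<phi> (w' g))" by (rule \<psi>.sum)
    finally have "inv_into UNIV \<phi> v = (\<Sum>g | w' g \<noteq> 0. inv_into UNIV \<phi> (w' g))" .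
    moreover have "inv_into UNIV \<phi> (w' g) \<in> V g" if "g \<in> I" for g
    proof -
      have "w' g \<in> \<phi> ` V g" using w' that by blast
      then show ?thesis by (auto simp: cancel)
    qed
    ultimately have "?P V (inv_into UNIV \<phi> v) (\<lambda>g. inv_into UNIV \<phi> (w' g))" using w' by (simp add: z)
    then have "(\<lambda>g. inv_into UNIV \<phi> (w' g)) = w" by (rule uniq)
    then show "w' = (\<lambda>g. \<phi> (w g))" using cancel by auto
  qed
qed

lemma kac_grading_image:
  assumes \<phi>: "\<phi> \<in> kac_Aut" and V: "kac_grading H V"
  shows "kac_grading H (\<lambda>h. \<phi> ` V h)"
  unfolding kac_grading_def support_image[OF \<phi>]
proof (intro conjI ballI)
  interpret \<phi>: Vector_Spaces.linear "(*s)" "(*s)" \<phi> using \<phi> by (simp add: kac_Aut_def)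
  have hom: "\<phi> (kac_mult u v) = kac_mult (\<phi> u) (\<phi> v)"
    and par: "\<phi> ` kac_even = kac_even" "\<phi> ` kac_odd = kac_odd" for u v
    using \<phi> by (auto simp: kac_Aut_def)
  show "direct_decomposition (carrier H) (\<lambda>h. \<phi> ` V h)"
    using V by (intro direct_decomposition_image[OF \<phi>]) (simp add: kac_grading_def)
  show "kac_mult u v \<in> \<phi> ` V (g \<otimes>\<^bsub>H\<^esub> h)"
    if "g \<in> carrier H" "h \<in> carrier H" "u \<in> \<phi> ` V g" "v \<in> \<phi> ` V h" for g h u v
  proof -
    from that(3,4) obtain u' v' where "u = \<phi> u'" "u' \<in> V g" "v = \<phi> v'" "v' \<in> V h" by blast
    moreover from this have "kac_mult u' v' \<in> V (g \<otimes>\<^bsub>H\<^esub> h)" using V that by (simp add: kac_grading_def)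
    ultimately show ?thesis by (metis hom imageI)
  qed
  show "\<phi> ` V h = {a + b |a b. a \<in> \<phi> ` V h \<inter> kac_even \<and> b \<in> \<phi> ` V h \<inter> kac_odd}" if h: "h \<in> carrier H" for h
  proof safe
    fix v assume "v \<in> V h"
    then obtain a b where "v = a + b" "a \<in> V h" "a \<in> kac_even" "b \<in> V h" "b \<in> kac_odd"
      using V h unfolding kac_grading_def by blast
    then have "\<phi> v = \<phi> a + \<phi> b" "\<phi> a \<in> \<phi> ` V h \<inter> kac_even" "\<phi> b \<in> \<phi> ` V h \<inter> kac_odd"
      using par by (auto simp: \<phi>.add)
    then show "\<exists>a b. \<phi> v = a + b \<and> a \<in> \<phi> ` V h \<inter> kac_even \<and> b \<in> \<phi> ` V h \<inter> kac_odd" by blast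
  next
    fix a b assume "a \<in> V h" "b \<in> V h"
    moreover have "vec.subspace (V h)" using V h by (simp add: kac_grading_def direct_decomposition_def)
    ultimately have "a + b \<in> V h" by (simp add: vec.subspace_add)
    then show "\<phi> a + \<phi> b \<in> \<phi> ` V h" by (metis \<phi>.add imageI)
  qed
qed (use V in \<open>auto simp: kac_grading_def\<close>)

text \<open>Containment suffices: the image of \<open>V\<close> under the automorphism refines
  \<open>U\<close>, and as \<open>U\<close> is fine no inclusion can be strict. Equality of
  components then gives the bijection of supports.\<close>

lemma equivalent_if_coarsening:
  fixes U :: "'g \<Rightarrow> 'a::field_char_0 kac set"
  assumes fine: "fine_grading G U" and V: "kac_grading H V" and \<phi>: "\<phi> \<in> kac_Aut"
    and coarse: "\<And>h. h \<in> support H V \<Longrightarrow> \<exists>g\<in>carrier G. \<phi> ` V h \<subseteq> U g"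
  shows "equivalent_gradings G U H V"
proof -
  define W where "W h = \<phi> ` V h" for h
  have W: "kac_grading H W" unfolding W_def by (rule kac_grading_image[OF \<phi> V])
  have supp: "support H W = support H V" unfolding W_def by (rule support_image[OF \<phi>])
  have U: "kac_grading G U" using fine by (simp add: fine_grading_def)
  interpret CG: comm_group G using U by (simp add: kac_grading_def)
  interpret CH: comm_group H using W by (simp add: kac_grading_def)
  interpret U: kac_graded G U by unfold_locales (rule U)
  interpret W: kac_graded H W by unfold_locales (rule W)
  have nz: "\<exists>u\<in>W h. u \<noteq> 0" if "h \<in> support H V" for h
  proof -
    have h: "h \<in> carrier H" "W h \<noteq> {0}"
      using that unfolding supp[symmetric] by (simp_all add: support_def)
    then show ?thesis using W.zero_U[OF h(1)] by blast
  qed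
  have nzU: "\<exists>u\<in>U g. u \<noteq> 0" if "g \<in> support G U" for g
  proof -
    have g: "g \<in> carrier G" "U g \<noteq> {0}" using that by (simp_all add: support_def)
    then show ?thesis using U.zero_U[OF g(1)] by blast
  qed
  have sub: "\<exists>g\<in>support G U. W h \<subseteq> U g" if h: "h \<in> support H V" for h
  proof -
    obtain g where "g \<in> carrier G" "W h \<subseteq> U g" using coarse[OF h] by (auto simp: W_def)
    moreover from this nz[OF h] have "U g \<noteq> {0}" by blast
    ultimately show ?thesis by (auto simp: support_def)
  qed
  have eq: "\<exists>g\<in>support G U. W h = U g" if h: "h \<in> support H V" for h
  proof -
    obtain g where g: "g \<in> support G U" "W h \<subseteq> U g" using sub[OF h] by blast
    have "W h = U g"
    proof (rule ccontr)
      assume "W h \<noteq> U g"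
      then have "W h \<subset> U g" using g by blast
      then have "proper_refinement H W G U"
        unfolding proper_refinement_def supp using sub by (intro conjI ballI bexI[OF bexI[OF _ g(1)] h])
      then show False using fine_grading_no_refinement[OF fine W] by simp
    qed
    then show ?thesis using g by blast
  qed
  \<comment> \<open>Some \<open>W\<close>-component of a nonzero \<open>u\<close> in
    \<open>U g\<close> has a nonzero \<open>g\<close>-component. Being equal to a single
    \<open>U g'\<close>, the space containing it must be \<open>U g\<close>.\<close>
  have onto: "\<exists>h\<in>support H V. W h = U g" if g: "g \<in> support G U" for g
  proof -
    obtain u where u: "u \<in> U g" "u \<noteq> 0" using nzU[OF g] by blast
    have gc: "g \<in> carrier G" using g by (simp add: support_def)
    have "U.hcomp g u \<noteq> 0" using U.hcomp_homogeneous[OF gc u(1), of g] u(2) by simp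
    then obtain h where h: "h \<in> carrier H" "U.hcomp g (W.hcomp h u) \<noteq> 0"
      using W.nonzero_hcomp_ex[OF U.hcomp_linear] by blast
    have "W.hcomp h u \<noteq> 0"
    proof
      assume "W.hcomp h u = 0"
      then show False using h(2) U.hcomp_homogeneous[OF gc U.zero_U[OF gc], of g] by simp
    qed
    then have "W h \<noteq> {0}" using W.hcomp_in[OF h(1), of u] by blast
    then have hs: "h \<in> support H V" using h(1) unfolding supp[symmetric] by (simp add: support_def)
    then obtain g' where g': "g' \<in> support G U" "W h = U g'" using eq by blast
    then have "W.hcomp h u \<in> U g'" "g' \<in> carrier G" using W.hcomp_in[OF h(1), of u] by (auto simp: support_def)
    then have "g' = g" using U.hcomp_homogeneous[of g' "W.hcomp h u" g] h(2) by (auto split: if_splits)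
    then show ?thesis using hs g' by blast
  qed
  define \<sigma> where "\<sigma> g = (SOME h. h \<in> support H V \<and> W h = U g)" for g
  have \<sigma>: "\<sigma> g \<in> support H V" "W (\<sigma> g) = U g" if "g \<in> support G U" for g
  proof -
    have "\<exists>h. h \<in> support H V \<and> W h = U g" using onto[OF that] by blast
    from someI_ex[OF this] show "\<sigma> g \<in> support H V" "W (\<sigma> g) = U g" unfolding \<sigma>_def by blast+
  qed
  have injW: "h = h'" if "h \<in> support H V" "h' \<in> support H V" "W h = W h'" for h h'
    using nz[OF that(1)] that W.homogeneous_disjoint[of h h'] by (auto simp: support_def)
  have injU: "g = g'" if "g \<in> support G U" "g' \<in> support G U" "U g = U g'" for g g'
    using nzU[OF that(1)] that U.homogeneous_disjoint[of g g'] by (auto simp: support_def)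
  have "bij_betw \<sigma> (support G U) (support H V)"
  proof (rule bij_betw_imageI)
    show "inj_on \<sigma> (support G U)" by (rule inj_onI) (metis \<sigma>(2) injU)
    show "\<sigma> ` support G U = support H V"
    proof
      show "support H V \<subseteq> \<sigma> ` support G U"
      proof
        fix h assume h: "h \<in> support H V"
        then obtain g where "g \<in> support G U" "W h = U g" using eq by blast
        then show "h \<in> \<sigma> ` support G U" using injW[OF h] \<sigma> by (metis imageI)
      qed
    qed (use \<sigma> in blast)
  qed
  \<comment> \<open>The equivalence goes from \<open>U\<close> to \<open>V\<close>, so its
    automorphism is the inverse of \<open>\<phi>\<close>.\<close>
  moreover have "inv_into UNIV \<phi> ` U g = V (\<sigma> g)" if "g \<in> support G U" for g
    unfolding \<sigma>(2)[OF that, symmetric] W_def by (simp add: image_image kac_Aut_inv[OF \<phi>])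
  ultimately show ?thesis
    unfolding equivalent_gradings_def using kac_Aut_inv(1)[OF \<phi>] by blast
qed

lemma image_span_subset:
  assumes "Vector_Spaces.linear (*s) (*s) \<phi>" "vec.subspace T" "\<phi> ` S \<subseteq> T"
  shows "\<phi> ` vec.span S \<subseteq> T"
proof -
  interpret \<phi>: Vector_Spaces.linear "(*s)" "(*s)" \<phi> by fact
  show ?thesis using vec.span_minimal[OF assms(3,2)] by (simp add: \<phi>.span_image)
qed

lemma ZZ_fine: "fine_grading ZZ_group (kac_ZZ_grading :: _ \<Rightarrow> 'a::field_char_0 kac set)"
  unfolding ZZ_U[symmetric] by (rule ZZ.fine)

lemma ZZ2_fine: "fine_grading ZZ2_group (kac_ZZ2_grading :: _ \<Rightarrow> 'a::field_char_0 kac set)"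
  unfolding ZZ2_U[symmetric] by (rule ZZ2.fine)

text \<open>The automorphism sends \<open>x\<close>, \<open>y\<close> to \<open>a\<close>,
  \<open>c\<close> in the left factor and to \<open>p\<close>, \<open>q\<close> in the right one.
  The generators then place the image of each component of the model inside a component of
  \<open>U\<close>.\<close>

theorem fine_grading_equivalent:
  fixes U :: "'g \<Rightarrow> 'a::field_char_0 kac set"
  assumes fine: "fine_grading G U"
  shows "equivalent_gradings G U ZZ_group kac_ZZ_grading \<or> equivalent_gradings G U ZZ2_group kac_ZZ2_grading"
proof -
  have U: "kac_grading G U" using fine by (simp add: fine_grading_def)
  interpret comm_group G using U by (simp add: kac_grading_def)
  interpret U: kac_graded G U by unfold_locales (rule U)
  have neg: "v \<in> U g \<Longrightarrow> - v \<in> U g" if "g \<in> carrier G" for v g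
    using U.scale_U[OF that, of v "-1"] by simp
  show ?thesis
  proof (rule U.generators)
    fix a c p q g h
    assume V: "a $ Ie = 0" "c $ Ie = 0" "p $ Ie = 0" "q $ Ie = 0" "kap_form a c = 1" "kap_form p q = 1"
      and c: "g \<in> carrier G" "h \<in> carrier G"
      and m: "kac_lift a 0 \<in> U g" "kac_lift c 0 \<in> U (inv\<^bsub>G\<^esub> g)" "kac_lift 0 p \<in> U h" "kac_lift 0 q \<in> U (inv\<^bsub>G\<^esub> h)"
    let ?\<phi> = "kac_lin a c p q"
    have z: "(0 :: 'a kap) $ Ie = 0" by simp
    have prod: "u \<^bold>\<otimes> v \<in> U (k \<otimes>\<^bsub>G\<^esub> l)"
      if "u $ Ie = 0" "v $ Ie = 0" "k \<in> carrier G" "l \<in> carrier G" "kac_lift u 0 \<in> U k" "kac_lift 0 v \<in> U l" for u v k l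
      using U.lift_mult_U(1)[OF that(1) z z that(2-6)] by (simp add: kac_tensor_linear)
    have img: "\<exists>k\<in>carrier G. ?\<phi> ` vec.span {b} \<subseteq> U k" if "k \<in> carrier G" "?\<phi> b \<in> U k" for b k
      using that by (intro bexI[of _ k] image_span_subset kac_lin_linear U.subspace_U) auto
    have "equivalent_gradings G U ZZ_group kac_ZZ_grading"
    proof (rule equivalent_if_coarsening[OF fine _ kac_lin_Aut[OF V]])
      show "kac_grading ZZ_group (kac_ZZ_grading :: _ \<Rightarrow> 'a kac set)" unfolding ZZ_U[symmetric] by (rule ZZ.kac_grading_U)
      fix d assume "d \<in> support ZZ_group (kac_ZZ_grading :: _ \<Rightarrow> 'a kac set)"
      then show "\<exists>k\<in>carrier G. ?\<phi> ` kac_ZZ_grading d \<subseteq> U k"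
        unfolding ZZ_support insert_iff empty_iff
      proof (elim disjE FalseE)
        assume "d = (0,0)"
        moreover have "?\<phi> ` vec.span {kac_one, kac_E} \<subseteq> U \<one>\<^bsub>G\<^esub>"
          by (intro image_span_subset kac_lin_linear U.subspace_U) (auto simp: kac_lin_tensor U.one_U U.E_U)
        ultimately show ?thesis by (auto simp: kac_ZZ_grading_def intro: bexI[of _ "\<one>\<^bsub>G\<^esub>"])
      next
        assume "d = (0,1)" then show ?thesis
          using img[of h "kap_e \<^bold>\<otimes> kap_x"] m c by (simp add: kac_ZZ_grading_def kac_lin_tensor kac_lift_def kac_tensor_linear)
      next
        assume "d = (0,-1)" then show ?thesis
          using img[of "inv\<^bsub>G\<^esub> h" "kap_e \<^bold>\<otimes> kap_y"] m c by (simp add: kac_ZZ_grading_def kac_lin_tensor kac_lift_def kac_tensor_linear)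
      next
        assume "d = (1,0)" then show ?thesis
          using img[of g "kap_x \<^bold>\<otimes> kap_e"] m c by (simp add: kac_ZZ_grading_def kac_lin_tensor kac_lift_def kac_tensor_linear)
      next
        assume "d = (-1,0)" then show ?thesis
          using img[of "inv\<^bsub>G\<^esub> g" "kap_y \<^bold>\<otimes> kap_e"] m c by (simp add: kac_ZZ_grading_def kac_lin_tensor kac_lift_def kac_tensor_linear)
      next
        assume "d = (1,1)" then show ?thesis
          using img[of "g \<otimes>\<^bsub>G\<^esub> h" "kap_x \<^bold>\<otimes> kap_x"] prod[of a p g h] V m c
          by (simp add: kac_ZZ_grading_def kac_lin_tensor)
      next
        assume "d = (1,-1)" then show ?thesis
          using img[of "g \<otimes>\<^bsub>G\<^esub> inv\<^bsub>G\<^esub> h" "kap_x \<^bold>\<otimes> kap_y"] prod[of a q g "inv\<^bsub>G\<^esub> h"] V m c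
          by (simp add: kac_ZZ_grading_def kac_lin_tensor)
      next
        assume "d = (-1,1)" then show ?thesis
          using img[of "inv\<^bsub>G\<^esub> g \<otimes>\<^bsub>G\<^esub> h" "kap_y \<^bold>\<otimes> kap_x"] prod[of c p "inv\<^bsub>G\<^esub> g" h] V m c
          by (simp add: kac_ZZ_grading_def kac_lin_tensor)
      next
        assume "d = (-1,-1)" then show ?thesis
          using img[of "inv\<^bsub>G\<^esub> g \<otimes>\<^bsub>G\<^esub> inv\<^bsub>G\<^esub> h" "kap_y \<^bold>\<otimes> kap_y"] prod[of c q "inv\<^bsub>G\<^esub> g" "inv\<^bsub>G\<^esub> h"] V m c
          by (simp add: kac_ZZ_grading_def kac_lin_tensor)
      qed
    qed
    then show ?thesis ..
  next
    fix a c p q g h k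
    assume V: "a $ Ie = 0" "c $ Ie = 0" "p $ Ie = 0" "q $ Ie = 0" "kap_form a c = 1" "kap_form p q = 1"
      and c: "g \<in> carrier G" "h \<in> carrier G" "k \<in> carrier G"
      and m: "kac_lift a p \<in> U g" "kac_lift c q \<in> U (inv\<^bsub>G\<^esub> g)" "kac_lift a (- p) \<in> U h" "kac_lift c (- q) \<in> U k"
    let ?\<phi> = "kac_lin a c p q"
    interpret \<phi>: Vector_Spaces.linear "(*s)" "(*s)" ?\<phi> by (rule kac_lin_linear)
    have V': "(- p) $ Ie = 0" "(- q) $ Ie = 0" using V by simp_all
    have ci: "inv\<^bsub>G\<^esub> g \<in> carrier G" using c by simp
    have img: "\<exists>k\<in>carrier G. ?\<phi> ` vec.span {b} \<subseteq> U k" if "k \<in> carrier G" "?\<phi> b \<in> U k" for b k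
      using that by (intro bexI[of _ k] image_span_subset kac_lin_linear U.subspace_U) auto
    have w0: "a \<^bold>\<otimes> q - c \<^bold>\<otimes> p \<in> U \<one>\<^bsub>G\<^esub>"
      using U.lift_mult_U(1)[OF V(1,3,2,4) c(1) ci m(1,2)] c by simp
    \<comment> \<open>The product of a diagonal and an antidiagonal generator: with equal left
      entries, the two mixed terms add up instead of cancelling.\<close>
    have "a \<^bold>\<otimes> (- p) - a \<^bold>\<otimes> p \<in> U (g \<otimes>\<^bsub>G\<^esub> h)"
      by (rule U.lift_mult_U(1)[OF V(1,3,1) V'(1) c(1,2) m(1,3)])
    moreover have "a \<^bold>\<otimes> (- p) - a \<^bold>\<otimes> p = (-2) *s (a \<^bold>\<otimes> p)" by (simp add: kac_eq_iff)
    ultimately have xx: "a \<^bold>\<otimes> p \<in> U (g \<otimes>\<^bsub>G\<^esub> h)" using U.scale_U_cancel[of "g \<otimes>\<^bsub>G\<^esub> h" "-2"] c by simp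
    have "c \<^bold>\<otimes> (- q) - c \<^bold>\<otimes> q \<in> U (inv\<^bsub>G\<^esub> g \<otimes>\<^bsub>G\<^esub> k)"
      by (rule U.lift_mult_U(1)[OF V(2,4,2) V'(2) ci c(3) m(2,4)])
    moreover have "c \<^bold>\<otimes> (- q) - c \<^bold>\<otimes> q = (-2) *s (c \<^bold>\<otimes> q)" by (simp add: kac_eq_iff)
    ultimately have yy: "c \<^bold>\<otimes> q \<in> U (inv\<^bsub>G\<^esub> g \<otimes>\<^bsub>G\<^esub> k)" using U.scale_U_cancel[of "inv\<^bsub>G\<^esub> g \<otimes>\<^bsub>G\<^esub> k" "-2"] c by simp
    have "a \<^bold>\<otimes> (- q) - c \<^bold>\<otimes> p \<in> U (g \<otimes>\<^bsub>G\<^esub> k)"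
      by (rule U.lift_mult_U(1)[OF V(1,3,2) V'(2) c(1,3) m(1,4)])
    moreover have "a \<^bold>\<otimes> (- q) - c \<^bold>\<otimes> p = (-1) *s (a \<^bold>\<otimes> q + c \<^bold>\<otimes> p)" by (simp add: kac_eq_iff)
    ultimately have xy: "a \<^bold>\<otimes> q + c \<^bold>\<otimes> p \<in> U (g \<otimes>\<^bsub>G\<^esub> k)"
      using U.scale_U_cancel[of "g \<otimes>\<^bsub>G\<^esub> k" "-1"] c by (simp del: vector_sneg_minus1)
    \<comment> \<open>The antidiagonal generators carry the minus sign on the other half than the
      basis of the second grading does.\<close>
    have "kap_e \<^bold>\<otimes> p - a \<^bold>\<otimes> kap_e = - kac_lift a (- p)" "kap_e \<^bold>\<otimes> q - c \<^bold>\<otimes> kap_e = - kac_lift c (- q)"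
      by (simp_all add: kac_eq_iff kac_lift_def)
    then have m': "kap_e \<^bold>\<otimes> p - a \<^bold>\<otimes> kap_e \<in> U h" "kap_e \<^bold>\<otimes> q - c \<^bold>\<otimes> kap_e \<in> U k"
      using neg m c by simp_all
    have "equivalent_gradings G U ZZ2_group kac_ZZ2_grading"
    proof (rule equivalent_if_coarsening[OF fine _ kac_lin_Aut[OF V]])
      show "kac_grading ZZ2_group (kac_ZZ2_grading :: _ \<Rightarrow> 'a kac set)" unfolding ZZ2_U[symmetric] by (rule ZZ2.kac_grading_U)
      fix d assume "d \<in> support ZZ2_group (kac_ZZ2_grading :: _ \<Rightarrow> 'a kac set)"
      then show "\<exists>k\<in>carrier G. ?\<phi> ` kac_ZZ2_grading d \<subseteq> U k"
        unfolding ZZ2_support insert_iff empty_iff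
      proof (elim disjE FalseE)
        assume "d = (0,0)"
        moreover have "?\<phi> ` vec.span {kac_one, kac_E, kap_x \<^bold>\<otimes> kap_y - kap_y \<^bold>\<otimes> kap_x} \<subseteq> U \<one>\<^bsub>G\<^esub>"
          by (intro image_span_subset kac_lin_linear U.subspace_U)
            (auto simp: \<phi>.diff kac_lin_tensor U.one_U U.E_U w0)
        ultimately show ?thesis by (auto simp: kac_ZZ2_grading_def intro: bexI[of _ "\<one>\<^bsub>G\<^esub>"])
      next
        assume "d = (2,1)" then show ?thesis
          using img[of "g \<otimes>\<^bsub>G\<^esub> h" "kap_x \<^bold>\<otimes> kap_x"] xx c by (simp add: kac_ZZ2_grading_def kac_lin_tensor)
      next
        assume "d = (-2,1)" then show ?thesis
          using img[of "inv\<^bsub>G\<^esub> g \<otimes>\<^bsub>G\<^esub> k" "kap_y \<^bold>\<otimes> kap_y"] yy c by (simp add: kac_ZZ2_grading_def kac_lin_tensor)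
      next
        assume "d = (0,1)" then show ?thesis
          using img[of "g \<otimes>\<^bsub>G\<^esub> k" "kap_x \<^bold>\<otimes> kap_y + kap_y \<^bold>\<otimes> kap_x"] xy c
          by (simp add: kac_ZZ2_grading_def \<phi>.add kac_lin_tensor)
      next
        assume "d = (1,0)" then show ?thesis
          using img[of g "kap_e \<^bold>\<otimes> kap_x + kap_x \<^bold>\<otimes> kap_e"] m c
          by (simp add: kac_ZZ2_grading_def \<phi>.add kac_lin_tensor kac_lift_def add.commute)
      next
        assume "d = (-1,0)" then show ?thesis
          using img[of "inv\<^bsub>G\<^esub> g" "kap_e \<^bold>\<otimes> kap_y + kap_y \<^bold>\<otimes> kap_e"] m c
          by (simp add: kac_ZZ2_grading_def \<phi>.add kac_lin_tensor kac_lift_def add.commute)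
      next
        assume "d = (1,1)" then show ?thesis
          using img[of h "kap_e \<^bold>\<otimes> kap_x - kap_x \<^bold>\<otimes> kap_e"] m' c
          by (simp add: kac_ZZ2_grading_def \<phi>.diff kac_lin_tensor)
      next
        assume "d = (-1,1)" then show ?thesis
          using img[of k "kap_e \<^bold>\<otimes> kap_y - kap_y \<^bold>\<otimes> kap_e"] m' c
          by (simp add: kac_ZZ2_grading_def \<phi>.diff kac_lin_tensor)
      qed
    qed
    then show ?thesis ..
  qed
qed

lemma not_equivalent:
  "\<not> equivalent_gradings ZZ_group (kac_ZZ_grading :: _ \<Rightarrow> 'a::field_char_0 kac set) ZZ2_group kac_ZZ2_grading"
proof
  let ?J1 = "kac_ZZ_grading :: _ \<Rightarrow> 'a kac set" and ?J2 = "kac_ZZ2_grading :: _ \<Rightarrow> 'a kac set"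
  assume "equivalent_gradings ZZ_group ?J1 ZZ2_group ?J2"
  then obtain \<sigma> where \<sigma>: "bij_betw \<sigma> (support ZZ_group ?J1) (support ZZ2_group ?J2)"
    unfolding equivalent_gradings_def by blast
  have "card (support ZZ_group ?J1) = 9" "card (support ZZ2_group ?J2) = 8"
    by (simp_all add: ZZ_support ZZ2_support)
  then show False using bij_betw_same_card[OF \<sigma>] by simp
qed

section \<open>The torus of diagonal automorphisms\<close>

fun kap_char :: "kap_index \<Rightarrow> 'a::field \<Rightarrow> 'a" where
  "kap_char Ie s = 1"
| "kap_char Ix s = s"
| "kap_char Iy s = inverse s"

text \<open>On \<open>split_torus 2\<close> this is the monomial in \<open>t 0\<close>,
  \<open>t 1\<close> with exponent vector \<open>ZZ_deg k\<close>.\<close>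

fun kac_char :: "(kap_index \<times> kap_index) option \<Rightarrow> (nat \<Rightarrow> 'a::field) \<Rightarrow> 'a" where
  "kac_char None t = 1"
| "kac_char (Some (i, j)) t = kap_char i (t 0) * kap_char j (t 1)"

definition torus_map :: "(nat \<Rightarrow> 'a::field) \<Rightarrow> 'a kac \<Rightarrow> 'a kac" where
  "torus_map t = kac_lin (t 0 *s kap_x) (inverse (t 0) *s kap_y) (t 1 *s kap_x) (inverse (t 1) *s kap_y)"

lemma torus_map_nth: "torus_map t v $ k = kac_char k t * v $ k"
proof -
  have "\<forall>k. torus_map t v $ k = kac_char k t * v $ k"
    unfolding kac_index_all torus_map_def kac_lin_def sum_UNIV_kap_index by simp
  then show ?thesis by blast
qed

lemma torus_map_axis: "torus_map t (axis k 1) = kac_char k t *s axis k 1"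
  by (simp add: vec_eq_iff torus_map_nth axis_nth_if)

lemma torus_map_Aut:
  fixes t :: "nat \<Rightarrow> 'a::field_char_0"
  assumes "t \<in> split_torus 2"
  shows "torus_map t \<in> kac_Aut"
  unfolding torus_map_def
proof (rule kac_lin_Aut)
  have "t 0 \<noteq> 0" "t 1 \<noteq> 0" using assms by (auto simp: split_torus_def)
  then show "kap_form (t 0 *s kap_x) (inverse (t 0) *s kap_y) = 1" "kap_form (t 1 *s kap_x) (inverse (t 1) *s kap_y) = 1"
    by (simp_all add: kap_form_def)
qed simp_all

lemma matrix_torus_map: "matrix (torus_map t) $ i $ j = (if i = j then kac_char i t else 0)"
  by (simp add: matrix_def torus_map_nth axis_nth_if)

lemma kac_char_deg:
  "\<forall>k l. ZZ_deg k = ZZ_deg l \<longrightarrow> kac_char k t = kac_char l t"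
  unfolding kac_index_all by simp

text \<open>This is \<open>p\<close> times \<open>p\<close> to the power
  \<open>kap_weight i\<close>. So \<open>kac_char_nat k\<close> is 6 times the value of
  \<open>kac_char k\<close> at the point (2, 3), with denominators cleared. Values for different
  degrees differ by unique factorisation, and characteristic zero carries this to the field.\<close>

fun kap_char_nat :: "kap_index \<Rightarrow> nat \<Rightarrow> nat" where
  "kap_char_nat Ie p = p"
| "kap_char_nat Ix p = p ^ 2"
| "kap_char_nat Iy p = 1"

fun kac_char_nat :: "(kap_index \<times> kap_index) option \<Rightarrow> nat" where
  "kac_char_nat None = 6"
| "kac_char_nat (Some (i, j)) = kap_char_nat i 2 * kap_char_nat j 3"

lemma kac_char_separates:
  defines "t \<equiv> \<lambda>i. if i = 0 then 2 else if i = 1 then 3 else 1 :: 'a::field_char_0"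
  assumes "kac_char k t = kac_char l t"
  shows "ZZ_deg k = ZZ_deg l"
proof -
  have "\<forall>k. of_nat (kac_char_nat k) = 6 * kac_char k t"
    unfolding kac_index_all by (simp add: t_def)
  then have "of_nat (kac_char_nat k) = (of_nat (kac_char_nat l) :: 'a)" using assms(2) by simp
  then have "kac_char_nat k = kac_char_nat l" by simp
  moreover have "\<forall>k l. kac_char_nat k = kac_char_nat l \<longrightarrow> ZZ_deg k = ZZ_deg l"
    unfolding kac_index_all by simp
  ultimately show ?thesis by blast
qed

lemma kac_char_eq_iff:
  "(\<forall>t\<in>split_torus 2. kac_char k t = (kac_char l t :: 'a::field_char_0)) \<longleftrightarrow> ZZ_deg k = ZZ_deg l"
proof
  let ?t = "\<lambda>i. if i = 0 then 2 else if i = 1 then 3 else 1 :: 'a"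
  assume "\<forall>t\<in>split_torus 2. kac_char k t = (kac_char l t :: 'a)"
  moreover have "?t \<in> split_torus 2" by (auto simp: split_torus_def)
  ultimately have "kac_char k ?t = kac_char l ?t" by blast
  then show "ZZ_deg k = ZZ_deg l" by (rule kac_char_separates)
next
  assume "ZZ_deg k = ZZ_deg l"
  then show "\<forall>t\<in>split_torus 2. kac_char k t = (kac_char l t :: 'a)" by (intro ballI kac_char_deg[rule_format])
qed

text \<open>Nonzero structure constants impose multiplicative relations on the diagonal entries.
  They leave only the entries at \<open>x \<otimes> e\<close> and \<open>e \<otimes> x\<close> free,
  and these become the torus coordinates.\<close>

lemma diagonal_Aut_torus_map:
  fixes f :: "'a::field_char_0 kac \<Rightarrow> 'a kac"
  assumes f: "f \<in> kac_Aut" and diag: "\<And>i j. i \<noteq> j \<Longrightarrow> matrix f $ i $ j = 0"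
  shows "\<exists>t\<in>split_torus 2. f = torus_map t"
proof -
  interpret f: Vector_Spaces.linear "(*s)" "(*s)" f using f by (simp add: kac_Aut_def)
  have hom: "f (kac_mult u v) = kac_mult (f u) (f v)" for u v using f by (simp add: kac_Aut_def)
  define d where "d k = f (axis k 1) $ k" for k
  have ax: "f (axis k 1) = d k *s axis k 1" for k
    using diag by (simp add: vec_eq_iff d_def matrix_def axis_nth_if)
  have nth: "f v $ k = d k * v $ k" for v k
  proof -
    have "f (\<Sum>l\<in>UNIV. v $ l *s axis l 1) = (\<Sum>l\<in>UNIV. v $ l *s (d l *s axis l 1))"
      by (simp only: f.sum f.scale ax)
    then have "f v = (\<Sum>l\<in>UNIV. v $ l *s (d l *s axis l 1))" by (simp only: basis_expansion)
    then have "f v $ k = (\<Sum>l\<in>UNIV. v $ l * (d l * (if k = l then 1 else 0)))" by (simp add: axis_nth_if mult.assoc)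
    also have "\<dots> = (\<Sum>l\<in>UNIV. if l = k then v $ k * d k else 0)" by (rule sum.cong) auto
    finally show ?thesis by (simp add: mult.commute)
  qed
  have rel: "d m * kac_mult (axis k 1) (axis l 1) $ m = d k * d l * kac_mult (axis k 1) (axis l 1) $ m" for k l m
  proof -
    have "d m * kac_mult (axis k 1) (axis l 1) $ m = f (kac_mult (axis k 1) (axis l 1)) $ m" by (simp only: nth)
    also have "\<dots> = d k * d l * kac_mult (axis k 1) (axis l 1) $ m"
      by (simp add: hom ax kac_mult_scale_left kac_mult_scale_right)
    finally show ?thesis .
  qed
  have "inj f" using f by (simp add: kac_Aut_def bij_def)
  have nz: "d k \<noteq> 0" for k
  proof
    assume "d k = 0"
    then have "f (axis k 1) = f 0" by (simp add: ax f.zero)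
    then have "axis k 1 = (0 :: 'a kac)" by (rule injD[OF \<open>inj f\<close>])
    then show False by (simp add: axis_eq_0_iff)
  qed
  have n: "d None = 1" using rel[of None None None] nz[of None] by (simp add: kac_mult_nth axis_nth_if)
  note r = kac_mult_nth axis_nth_if n
  \<comment> \<open>\<open>(x \<otimes> e)(y \<otimes> e)\<close> is \<open>E - 3/8\<close>: its
    unit coordinate gives this relation, and its \<open>E\<close>-coordinate then gives
    \<open>d (Some (Ie,Ie)) = 1\<close>.\<close>
  have x: "d (Some (Ix,Ie)) * d (Some (Iy,Ie)) = 1" using rel[of None "Some (Ix,Ie)" "Some (Iy,Ie)"] by (simp add: r)
  have y: "d (Some (Ie,Ix)) * d (Some (Ie,Iy)) = 1" using rel[of None "Some (Ie,Ix)" "Some (Ie,Iy)"] by (simp add: r)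
  have e: "d (Some (Ie,Ie)) = 1" using rel[of "Some (Ie,Ie)" "Some (Ix,Ie)" "Some (Iy,Ie)"] x by (simp add: r)
  have W: "d (Some (Ix,Ix)) = d (Some (Ix,Ie)) * d (Some (Ie,Ix))" "d (Some (Ix,Iy)) = d (Some (Ix,Ie)) * d (Some (Ie,Iy))"
    "d (Some (Iy,Ix)) = d (Some (Iy,Ie)) * d (Some (Ie,Ix))" "d (Some (Iy,Iy)) = d (Some (Iy,Ie)) * d (Some (Ie,Iy))"
    using rel[of "Some (Ix,Ix)" "Some (Ix,Ie)" "Some (Ie,Ix)"] rel[of "Some (Ix,Iy)" "Some (Ix,Ie)" "Some (Ie,Iy)"]
      rel[of "Some (Iy,Ix)" "Some (Iy,Ie)" "Some (Ie,Ix)"] rel[of "Some (Iy,Iy)" "Some (Iy,Ie)" "Some (Ie,Iy)"]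
    by (simp_all add: r)
  define t where "t i = (if i = 0 then d (Some (Ix,Ie)) else if i = 1 then d (Some (Ie,Ix)) else 1)" for i :: nat
  have "d (Some (Iy,Ie)) = inverse (t 0)" "d (Some (Ie,Iy)) = inverse (t 1)"
    using x y nz by (simp_all add: t_def inverse_unique)
  then have "\<forall>k. d k = kac_char k t"
    unfolding kac_index_all by (simp add: n e W t_def)
  then have "f v = torus_map t v" for v by (simp add: vec_eq_iff nth torus_map_nth)
  moreover have "t \<in> split_torus 2" using nz by (auto simp: split_torus_def t_def)
  ultimately show ?thesis by blast
qed

section \<open>Regular functions on the torus of diagonal automorphisms\<close>

lemma fun_algebra_prod: "finite A \<Longrightarrow> (\<And>k. k \<in> A \<Longrightarrow> p k \<in> fun_algebra S) \<Longrightarrow> (\<lambda>z. \<Prod>k\<in>A. p k z) \<in> fun_algebra S"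
  by (induction A rule: finite_induct) (simp_all add: fun_algebra.const fun_algebra.mult)

lemma kac_char_regular:
  "kac_char k \<in> (split_torus_regular 2 :: ((nat \<Rightarrow> 'a::field) \<Rightarrow> 'a) set)" "(\<lambda>t. inverse (kac_char k t)) \<in> (split_torus_regular 2 :: ((nat \<Rightarrow> 'a) \<Rightarrow> 'a) set)"
proof -
  have g: "(\<lambda>t. t i) \<in> (split_torus_regular 2 :: ((nat \<Rightarrow> 'a) \<Rightarrow> 'a) set)" "(\<lambda>t. inverse (t i)) \<in> (split_torus_regular 2 :: ((nat \<Rightarrow> 'a) \<Rightarrow> 'a) set)" if "i < 2" for i
    unfolding split_torus_regular_def using that by (auto intro!: fun_algebra.gen)
  have c: "(\<lambda>t. c) \<in> (split_torus_regular 2 :: ((nat \<Rightarrow> 'a) \<Rightarrow> 'a) set)" for c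
    unfolding split_torus_regular_def by (rule fun_algebra.const)
  have 1: "(\<lambda>t. kap_char i (t n)) \<in> (split_torus_regular 2 :: ((nat \<Rightarrow> 'a) \<Rightarrow> 'a) set)" "(\<lambda>t. inverse (kap_char i (t n))) \<in> (split_torus_regular 2 :: ((nat \<Rightarrow> 'a) \<Rightarrow> 'a) set)" if "n < 2" for i n
    by (cases i; simp add: g c that)+
  have m: "(\<lambda>t. p t * q t) \<in> (split_torus_regular 2 :: ((nat \<Rightarrow> 'a) \<Rightarrow> 'a) set)" if "p \<in> split_torus_regular 2" "q \<in> split_torus_regular 2" for p q
    using that unfolding split_torus_regular_def by (rule fun_algebra.mult)
  have e: "kac_char None = (\<lambda>t. 1 :: 'a)" "kac_char (Some (i, j)) = (\<lambda>t. kap_char i (t 0) * kap_char j (t 1) :: 'a)" for i j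
    by (rule ext, simp)+
  show "kac_char k \<in> (split_torus_regular 2 :: ((nat \<Rightarrow> 'a) \<Rightarrow> 'a) set)"
  proof (cases k)
    case None
    then show ?thesis using c[of 1] by (simp only: e)
  next
    case (Some ij)
    obtain i j where "ij = (i, j)" by (cases ij)
    then show ?thesis using m[OF 1(1) 1(1), of 0 1 i j] Some by (simp only: e)
  qed
  show "(\<lambda>t. inverse (kac_char k t)) \<in> (split_torus_regular 2 :: ((nat \<Rightarrow> 'a) \<Rightarrow> 'a) set)"
  proof (cases k)
    case None
    then show ?thesis using c[of 1] by (simp only: kac_char.simps inverse_1)
  next
    case (Some ij)
    obtain i j where "ij = (i, j)" by (cases ij)
    then show ?thesis using m[OF 1(2) 1(2), of 0 1 i j] Some
      by (simp only: kac_char.simps inverse_mult_distrib)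
  qed
qed

text \<open>\<open>torus_map\<close> is a morphism of varieties: matrix entries pull back to
  characters or 0, and \<open>1/det\<close> pulls back to a product of inverse characters.\<close>

lemma GL_regular_torus_map:
  assumes "q \<in> GL_regular"
  shows "\<exists>p\<in>split_torus_regular 2. \<forall>t. q (torus_map t) = (p t :: 'a::field_char_0)"
  using assms unfolding GL_regular_def
proof (induction rule: fun_algebra.induct)
  case (const c)
  show ?case unfolding split_torus_regular_def by (rule bexI[OF _ fun_algebra.const]) simp
next
  case (gen p)
  then consider i j where "p = (\<lambda>f. matrix f $ i $ j)" | "p = (\<lambda>f. inverse (det (matrix f)))" by blast
  then show ?case
  proof cases
    case (1 i j)
    show ?thesis
    proof (cases "i = j")
      case True
      then show ?thesis using kac_char_regular(1)[of i] by (intro bexI[of _ "kac_char i"]) (simp_all add: 1 matrix_torus_map)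
    next
      case False
      then show ?thesis unfolding split_torus_regular_def
        by (intro bexI[OF _ fun_algebra.const[of 0]]) (simp add: 1 matrix_torus_map)
    qed
  next
    case 2
    have "det (matrix (torus_map t)) = (\<Prod>k\<in>UNIV. kac_char k t)" for t :: "nat \<Rightarrow> 'a"
      by (subst det_diagonal) (simp_all add: matrix_torus_map)
    then have "p (torus_map t) = (\<Prod>k\<in>UNIV. inverse (kac_char k t))" for t :: "nat \<Rightarrow> 'a"
      by (simp add: 2 prod_inversef[symmetric] o_def)
    moreover have "(\<lambda>t. \<Prod>k\<in>UNIV. inverse (kac_char k t)) \<in> (split_torus_regular 2 :: ((nat \<Rightarrow> 'a) \<Rightarrow> 'a) set)"
      using kac_char_regular(2) unfolding split_torus_regular_def by (intro fun_algebra_prod) simp_all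
    ultimately show ?thesis by (intro bexI[of _ "\<lambda>t. \<Prod>k\<in>UNIV. inverse (kac_char k t)"] allI)
  qed
next
  case (add p q)
  then obtain p' q' where "p' \<in> split_torus_regular 2" "\<forall>t. p (torus_map t) = p' t"
    "q' \<in> split_torus_regular 2" "\<forall>t. q (torus_map t) = q' t" by blast
  then show ?case unfolding split_torus_regular_def by (intro bexI[OF _ fun_algebra.add[of p' _ q']]) simp_all
next
  case (mult p q)
  then obtain p' q' where "p' \<in> split_torus_regular 2" "\<forall>t. p (torus_map t) = p' t"
    "q' \<in> split_torus_regular 2" "\<forall>t. q (torus_map t) = q' t" by blast
  then show ?case unfolding split_torus_regular_def by (intro bexI[OF _ fun_algebra.mult[of p' _ q']]) simp_all
qed

lemma split_torus_regular_torus_map: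
  assumes "p \<in> split_torus_regular 2"
  shows "\<exists>q\<in>GL_regular. \<forall>t. q (torus_map t) = (p t :: 'a::field_char_0)"
  using assms unfolding split_torus_regular_def
proof (induction rule: fun_algebra.induct)
  case (const c)
  show ?case unfolding GL_regular_def by (rule bexI[OF _ fun_algebra.const]) simp
next
  case (gen p)
  have entry: "(\<lambda>f. matrix f $ k $ k) \<in> GL_regular" for k
    unfolding GL_regular_def by (intro fun_algebra.gen) blast
  from gen obtain i where i: "i < 2" "p = (\<lambda>t. t i) \<or> p = (\<lambda>t. inverse (t i))" by auto
  \<comment> \<open>Each torus coordinate and its inverse is itself a diagonal entry, at one of the
    four odd basis vectors.\<close>
  have "\<exists>k. \<forall>t. kac_char k t = p t"
  proof -
    have "i = 0 \<or> i = 1" using i(1) by auto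
    then have "(\<forall>t. kac_char (Some (Ix,Ie)) t = p t) \<or> (\<forall>t. kac_char (Some (Iy,Ie)) t = p t)
        \<or> (\<forall>t. kac_char (Some (Ie,Ix)) t = p t) \<or> (\<forall>t. kac_char (Some (Ie,Iy)) t = p t)"
      using i(2) by auto
    then show ?thesis by blast
  qed
  then obtain k where "\<forall>t. kac_char k t = p t" by blast
  then show ?case by (intro bexI[OF _ entry[of k]]) (simp add: matrix_torus_map)
next
  case (add p q)
  then obtain p' q' where "p' \<in> GL_regular" "\<forall>t. p' (torus_map t) = p t"
    "q' \<in> GL_regular" "\<forall>t. q' (torus_map t) = q t" by blast
  then show ?case unfolding GL_regular_def by (intro bexI[OF _ fun_algebra.add[of p' _ q']]) simp_all
next
  case (mult p q)
  then obtain p' q' where "p' \<in> GL_regular" "\<forall>t. p' (torus_map t) = p t"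
    "q' \<in> GL_regular" "\<forall>t. q' (torus_map t) = q t" by blast
  then show ?case unfolding GL_regular_def by (intro bexI[OF _ fun_algebra.mult[of p' _ q']]) simp_all
qed

text \<open>The torus is cut out of the automorphism group by the vanishing of the off-diagonal
  entries, since diagonal automorphisms are exactly the values of \<open>torus_map\<close> on
  \<open>split_torus 2\<close>.\<close>

lemma is_torus_torus_map: "is_torus (torus_map ` split_torus 2 :: ('a::field_char_0 kac \<Rightarrow> 'a kac) set)"
  unfolding is_torus_def
proof (intro conjI exI)
  let ?T = "torus_map ` split_torus 2 :: ('a kac \<Rightarrow> 'a kac) set"
  let ?P = "{\<lambda>f :: 'a kac \<Rightarrow> 'a kac. matrix f $ i $ j | i j. i \<noteq> j}"
  have "?P \<subseteq> GL_regular"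
  proof
    fix p assume "p \<in> ?P"
    then show "p \<in> GL_regular" unfolding GL_regular_def by (intro fun_algebra.gen) blast
  qed
  moreover have "?T = {f \<in> kac_Aut. \<forall>p\<in>?P. p f = 0}"
  proof
    show "?T \<subseteq> {f \<in> kac_Aut. \<forall>p\<in>?P. p f = 0}"
      using torus_map_Aut by (auto simp: matrix_torus_map)
    show "{f \<in> kac_Aut. \<forall>p\<in>?P. p f = 0} \<subseteq> ?T"
    proof
      fix f assume f: "f \<in> {f \<in> kac_Aut. \<forall>p\<in>?P. p f = 0}"
      have "matrix f $ i $ j = 0" if "i \<noteq> j" for i j
      proof -
        have "(\<lambda>f. matrix f $ i $ j) \<in> ?P" using that by blast
        moreover have "\<forall>p\<in>?P. p f = 0" using f by simp
        ultimately show ?thesis by (rule bspec[rotated])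
      qed
      moreover have "f \<in> kac_Aut" using f by simp
      ultimately obtain t where "t \<in> split_torus 2" "f = torus_map t" using diagonal_Aut_torus_map by blast
      then show "f \<in> ?T" by simp
    qed
  qed
  ultimately show "zariski_closed_in_Aut ?T" unfolding zariski_closed_in_Aut_def by blast
  have "inj_on torus_map (split_torus 2 :: (nat \<Rightarrow> 'a) set)"
  proof (rule inj_onI)
    fix s t :: "nat \<Rightarrow> 'a"
    assume st: "s \<in> split_torus 2" "t \<in> split_torus 2" "torus_map s = torus_map t"
    have "kac_char k s = kac_char k t" for k
      using arg_cong[OF st(3), of "\<lambda>f. f (axis k 1) $ k"] by (simp add: torus_map_nth axis_nth_if)
    from this[of "Some (Ix,Ie)"] this[of "Some (Ie,Ix)"] have "s 0 = t 0" "s 1 = t 1" by simp_all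
    moreover have "s i = t i" if "i \<ge> 2" for i using st that by (simp add: split_torus_def)
    ultimately show "s = t" by (intro ext) (metis less_2_cases not_less One_nat_def)
  qed
  then show "bij_betw torus_map (split_torus 2) ?T" by (rule inj_on_imp_bij_betw)
  have "\<forall>k. kac_char k (\<lambda>i. s i * t i) = kac_char k s * kac_char k t" for s t :: "nat \<Rightarrow> 'a"
    unfolding kac_index_all by (simp add: mult_ac)
  then show "\<forall>s\<in>split_torus 2. \<forall>t\<in>split_torus 2. torus_map (\<lambda>i. s i * t i) = torus_map s \<circ> (torus_map t :: 'a kac \<Rightarrow> 'a kac)"
    by (simp add: fun_eq_iff vec_eq_iff torus_map_nth mult.assoc)
  show "\<forall>q\<in>GL_regular. \<exists>p\<in>split_torus_regular 2. \<forall>t\<in>split_torus 2. q (torus_map t) = (p t :: 'a)"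
    using GL_regular_torus_map by blast
  show "\<forall>p\<in>split_torus_regular 2. \<exists>q\<in>GL_regular. \<forall>t\<in>split_torus 2. q (torus_map t) = (p t :: 'a)"
    using split_torus_regular_torus_map by blast
qed

text \<open>\<open>c\<close> is the eigenvalue function of the basis vector with index
  \<open>k\<close>. Another basis vector has the same one exactly when the characters agree on the
  torus, that is, when the degrees in Z x Z coincide.\<close>

lemma torus_eigenspace:
  fixes k defines "c \<equiv> \<lambda>f. f (axis k 1) $ k"
  shows "simultaneous_eigenspace (torus_map ` split_torus 2) c = (ZZ.U (ZZ_deg k) :: 'a::field_char_0 kac set)"
proof -
  have c: "c (torus_map t) = kac_char k t" for t by (simp add: c_def torus_map_nth axis_nth_if)
  have "v \<in> simultaneous_eigenspace (torus_map ` split_torus 2) c \<longleftrightarrow>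
      (\<forall>l. v $ l \<noteq> 0 \<longrightarrow> (\<forall>t\<in>split_torus 2. kac_char l t = (kac_char k t :: 'a)))" for v :: "'a kac"
    by (simp add: simultaneous_eigenspace_def vec_eq_iff torus_map_nth c) blast
  then show ?thesis unfolding kac_char_eq_iff ZZ.U_def by blast
qed

lemma produced_by_torus: "produced_by (torus_map ` split_torus 2) ZZ_group (kac_ZZ_grading :: _ \<Rightarrow> 'a::field_char_0 kac set)"
  unfolding produced_by_def ZZ_U[symmetric]
proof (intro conjI ballI)
  let ?T = "torus_map ` split_torus 2 :: ('a kac \<Rightarrow> 'a kac) set"
  show "?T \<subseteq> kac_Aut" using torus_map_Aut by blast
  show "diagonalizable f" if f: "f \<in> ?T" for f
    unfolding diagonalizable_def
  proof (rule exI[of _ "range ZZ_basis"], intro conjI ballI)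
    show "vec.independent (range (ZZ_basis :: _ \<Rightarrow> 'a kac))" by (rule ZZ.independent_B)
    show "vec.span (range (ZZ_basis :: _ \<Rightarrow> 'a kac)) = UNIV"
    proof (intro Set.set_eqI iffI)
      fix v :: "'a kac"
      have "(\<Sum>k\<in>UNIV. v $ k *s axis k 1) \<in> vec.span (range ZZ_basis)"
        by (intro vec.span_sum vec.span_scale vec.span_base) simp
      then show "v \<in> vec.span (range ZZ_basis)" by (simp add: basis_expansion)
    qed simp
    show "\<exists>c. f v = c *s v" if "v \<in> range (ZZ_basis :: _ \<Rightarrow> 'a kac)" for v using that f by (auto simp: torus_map_axis)
  qed
  show "f \<circ> g = g \<circ> f" if "f \<in> ?T" "g \<in> ?T" for f g
    using that by (auto simp: fun_eq_iff vec_eq_iff torus_map_nth)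
  show "ZZ.U ` support ZZ_group ZZ.U = {E. E \<noteq> {0} \<and> (\<exists>c. E = simultaneous_eigenspace ?T c)}"
  proof (intro Set.set_eqI iffI)
    fix E :: "'a kac set" assume "E \<in> ZZ.U ` support ZZ_group ZZ.U"
    then obtain k where k: "E = ZZ.U (ZZ_deg k)" unfolding ZZ.support_U by blast
    then have "E \<noteq> {0}" using ZZ.U_nonzero by blast
    then show "E \<in> {E. E \<noteq> {0} \<and> (\<exists>c. E = simultaneous_eigenspace ?T c)}"
      using k torus_eigenspace[of k] by blast
  next
    fix E :: "'a kac set" assume "E \<in> {E. E \<noteq> {0} \<and> (\<exists>c. E = simultaneous_eigenspace ?T c)}"
    then obtain c where c: "E \<noteq> {0}" "E = simultaneous_eigenspace ?T c" by blast
    have "0 \<in> E" unfolding c(2) by (auto simp: simultaneous_eigenspace_def vec_eq_iff torus_map_nth)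
    then obtain v where v: "v \<in> E" "v \<noteq> 0" using c(1) by blast
    then obtain k where k: "v $ k \<noteq> 0" by (auto simp: vec_eq_iff)
    \<comment> \<open>The torus acts diagonally, so a single nonzero coordinate of one eigenvector
      already determines \<open>c\<close> on the torus.\<close>
    have "c f = f (axis k 1) $ k" if "f \<in> ?T" for f
    proof -
      from that obtain t where t: "f = torus_map t" by blast
      have "f v = c f *s v" using v(1) that unfolding c(2) simultaneous_eigenspace_def by blast
      then have "kac_char k t * v $ k = c f * v $ k" by (metis t torus_map_nth vector_smult_component)
      then show ?thesis using k by (simp add: t torus_map_nth axis_nth_if)
    qed
    then have "E = simultaneous_eigenspace ?T (\<lambda>f. f (axis k 1) $ k)"
      unfolding c(2) simultaneous_eigenspace_def by auto
    then have "E = ZZ.U (ZZ_deg k)" by (simp add: torus_eigenspace)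
    then show "E \<in> ZZ.U ` support ZZ_group ZZ.U" unfolding ZZ.support_U by blast
  qed
qed

lemma ZZ_toral: "toral ZZ_group (kac_ZZ_grading :: _ \<Rightarrow> 'a::field_char_0 kac set)"
  unfolding toral_def
  by (rule exI[of _ "torus_map ` split_torus 2"], rule exI[of _ "torus_map ` split_torus 2"])
    (simp add: is_torus_torus_map produced_by_torus)

section \<open>The second grading is not toral\<close>

text \<open>The two halves of the odd part are permuted by every automorphism, because their elements can be
  characterised in terms of the product.\<close>

definition kac_pure :: "'a::field kac \<Rightarrow> bool" where
  "kac_pure m \<longleftrightarrow> m \<in> kac_odd \<and> m \<noteq> 0 \<and> (\<forall>n\<in>kac_odd. \<exists>c. kac_mult (kac_mult m n) m = c *s m)"

text \<open>For pure elements this detects different halves: their product is then a nonzero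
  multiple of some \<open>a \<otimes> b\<close>, which squares to 0. Within one half the product is
  a multiple of \<open>kac_K\<close>, whose square is nonzero.\<close>

definition kac_opposite :: "'a::field kac \<Rightarrow> 'a kac \<Rightarrow> bool" where
  "kac_opposite u v \<longleftrightarrow> kac_mult u v \<noteq> 0 \<and> kac_mult (kac_mult u v) (kac_mult u v) = 0"

lemma kac_Aut_pure:
  assumes g: "g \<in> kac_Aut" and m: "kac_pure m"
  shows "kac_pure (g m)"
proof -
  interpret g: Vector_Spaces.linear "(*s)" "(*s)" g using g by (simp add: kac_Aut_def)
  have inj: "inj g" and hom: "g (kac_mult u v) = kac_mult (g u) (g v)" and odd: "g ` kac_odd = kac_odd" for u v
    using g by (auto simp: kac_Aut_def bij_def)
  have "\<exists>c. kac_mult (kac_mult (g m) n) (g m) = c *s g m" if "n \<in> kac_odd" for n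
  proof -
    from that odd obtain n' where n': "n' \<in> kac_odd" "n = g n'" by blast
    then obtain c where "kac_mult (kac_mult m n') m = c *s m" using m by (auto simp: kac_pure_def)
    then have "g (kac_mult (kac_mult m n') m) = c *s g m" by (simp add: g.scale)
    then show ?thesis by (auto simp: hom n')
  qed
  moreover have "g m \<noteq> 0" using m injD[OF inj, of m 0] by (auto simp: kac_pure_def g.zero)
  moreover have "g m \<in> kac_odd" using m odd by (auto simp: kac_pure_def)
  ultimately show ?thesis by (simp add: kac_pure_def)
qed

lemma kac_Aut_opposite:
  assumes g: "g \<in> kac_Aut"
  shows "kac_opposite (g u) (g v) \<longleftrightarrow> kac_opposite u v"
proof -
  interpret g: Vector_Spaces.linear "(*s)" "(*s)" g using g by (simp add: kac_Aut_def)
  have hom: "kac_mult (g u) (g v) = g (kac_mult u v)" for u v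
    using g by (simp add: kac_Aut_def)
  have "inj g" using g by (simp add: kac_Aut_def bij_def)
  then have "g u = 0 \<longleftrightarrow> u = 0" for u using injD[of g u 0] by (auto simp: g.zero)
  then show ?thesis by (simp add: kac_opposite_def hom)
qed

lemma kac_K_mult_lift:
  fixes a b :: "'a::field_char_0 kap"
  assumes "a $ Ie = 0" "b $ Ie = 0"
  shows "kac_mult kac_K (kac_lift a b) = (1/8) *s kac_lift a b"
  using assms by (simp add: kac_eq_iff kac_mult_nth kac_lift_nth kac_K_nth field_simps)

text \<open>The first term comes from \<open>kac_K\<close>, which acts on odd elements by 1/2 - 3/8
  = 1/8. The second comes from the \<open>V \<otimes> V\<close>-part of the inner product, with
  factor 1/4 * 1/2.\<close>

lemma kac_lift_sandwich:
  fixes a b c d :: "'a::field_char_0 kap"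
  assumes V: "a $ Ie = 0" "b $ Ie = 0" "c $ Ie = 0" "d $ Ie = 0"
  shows "kac_mult (kac_mult (kac_lift a b) (kac_lift c d)) (kac_lift a b) =
    ((kap_form a c + kap_form b d) / 8) *s kac_lift a b
    + (1/8) *s kac_lift (kap_form d b *s a) (kap_form c a *s b)"
proof -
  have "kac_mult (a \<^bold>\<otimes> d - c \<^bold>\<otimes> b) (kac_lift a b) =
      kac_mult (a \<^bold>\<otimes> d) (kac_lift a b) + (-1) *s kac_mult (c \<^bold>\<otimes> b) (kac_lift a b)"
    by (simp flip: kac_mult_scale_left kac_mult_add_left)
  also have "\<dots> = (1/2) *s kac_lift (kap_form d b *s a) (kap_form c a *s b)"
    using V by (simp add: kac_tensor_mult_lift kac_lift_linear kap_form_self vector_smult_assoc)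
  finally show ?thesis
    by (simp add: kac_lift_mult V kac_mult_add_left kac_mult_scale_left kac_K_mult_lift vector_smult_assoc)
qed

text \<open>If \<open>b\<close> is nonzero, test \<open>kac_lift a b\<close> against
  \<open>e \<otimes> d\<close> with \<open>(d|b)\<close> nonzero. The result scales the right half
  by \<open>(b|d)/8\<close> and the left half by 0, as \<open>(b|d) + (d|b) = 0\<close>. It is a
  multiple of the element only if \<open>a = 0\<close>.\<close>

lemma kac_pure_iff:
  fixes m :: "'a::field_char_0 kac"
  shows "kac_pure m \<longleftrightarrow> (\<exists>a. a $ Ie = 0 \<and> a \<noteq> 0 \<and> (m = kac_lift a 0 \<or> m = kac_lift 0 a))"
proof
  assume m: "kac_pure m"
  then obtain a b where ab: "a $ Ie = 0" "b $ Ie = 0" "m = kac_lift a b"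
    using kac_oddE unfolding kac_pure_def by metis
  have "a = 0" if "b \<noteq> 0"
  proof -
    obtain d where d: "d $ Ie = 0" "kap_form d b \<noteq> 0"
    proof (cases "b $ Ix = 0")
      case True
      then have "b $ Iy \<noteq> 0" using \<open>b \<noteq> 0\<close> ab by (auto simp: kap_eq_iff)
      then show ?thesis by (intro that[of kap_x]) (simp_all add: kap_form_def)
    next
      case False
      then show ?thesis by (intro that[of kap_y]) (simp_all add: kap_form_def)
    qed
    obtain c where "kac_mult (kac_mult m (kac_lift 0 d)) m = c *s m"
      using m d kac_lift_odd[of 0 d] by (auto simp: kac_pure_def)
    then have "kac_lift ((kap_form b d / 8) *s a + (kap_form d b / 8) *s a) ((kap_form b d / 8) *s b) = kac_lift (c *s a) (c *s b)"
      using ab d by (simp add: kac_lift_sandwich kap_form_linear kac_lift_linear vector_smult_assoc)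
    then have e: "(kap_form b d / 8) *s a + (kap_form d b / 8) *s a = c *s a" "(kap_form b d / 8) *s b = c *s b"
      using kac_lift_inject ab by (simp_all add: kac_lift_inject)
    from e(2) have "c = kap_form b d / 8" using \<open>b \<noteq> 0\<close> by simp
    with e(1) have "(kap_form d b / 8) *s a = 0" by simp
    then show "a = 0" using d by simp
  qed
  moreover have "m \<noteq> 0" using m by (simp add: kac_pure_def)
  moreover have "kac_lift 0 0 = (0 :: 'a kac)" by (simp add: kac_lift_def kac_tensor_linear)
  ultimately show "\<exists>a. a $ Ie = 0 \<and> a \<noteq> 0 \<and> (m = kac_lift a 0 \<or> m = kac_lift 0 a)"
    using ab by (cases "b = 0") auto
next
  assume "\<exists>a. a $ Ie = 0 \<and> a \<noteq> 0 \<and> (m = kac_lift a 0 \<or> m = kac_lift 0 a)"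
  then obtain a where a: "a $ Ie = 0" "a \<noteq> 0" "m = kac_lift a 0 \<or> m = kac_lift 0 a" by blast
  have z: "(0 :: 'a kap) $ Ie = 0" by simp
  have "kac_lift 0 0 = (0 :: 'a kac)" by (simp add: kac_lift_def kac_tensor_linear)
  then have l: "kac_lift a 0 \<noteq> 0" "kac_lift 0 a \<noteq> 0"
    using kac_lift_inject[of a 0 0 0] kac_lift_inject[of 0 a 0 0] a by auto
  have "\<exists>c. kac_mult (kac_mult m n) m = c *s m" if n: "n \<in> kac_odd" for n
  proof -
    obtain c d where cd: "c $ Ie = 0" "d $ Ie = 0" "n = kac_lift c d" by (rule kac_oddE[OF n])
    from a(3) show ?thesis
    proof
      assume "m = kac_lift a 0"
      then show ?thesis
        using a cd by (intro exI[of _ "kap_form a c / 8"])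
          (simp add: kac_lift_sandwich[OF a(1) z] kap_form_linear \<open>kac_lift 0 0 = 0\<close>)
    next
      assume "m = kac_lift 0 a"
      then show ?thesis
        using a cd by (intro exI[of _ "kap_form a d / 8"])
          (simp add: kac_lift_sandwich[OF z a(1)] kap_form_linear \<open>kac_lift 0 0 = 0\<close>)
    qed
  qed
  moreover have "m \<in> kac_odd" using a by (auto simp: kac_lift_odd)
  ultimately show "kac_pure m" using a l by (auto simp: kac_pure_def)
qed

lemma kac_opposite_lift:
  fixes a b :: "'a::field_char_0 kap"
  assumes "a $ Ie = 0" "b $ Ie = 0" "a \<noteq> 0" "b \<noteq> 0"
  shows "kac_opposite (kac_lift a 0) (kac_lift 0 b)" "kac_opposite (kac_lift 0 b) (kac_lift a 0)"
    "\<not> kac_opposite (kac_lift a 0) (kac_lift b 0)" "\<not> kac_opposite (kac_lift 0 a) (kac_lift 0 b)"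
proof -
  have ab: "a \<^bold>\<otimes> b \<noteq> 0" using assms by (auto simp: kac_eq_iff kap_eq_iff)
  have sq: "kac_mult (a \<^bold>\<otimes> b) (a \<^bold>\<otimes> b) = 0" "kac_mult (- (a \<^bold>\<otimes> b)) (- (a \<^bold>\<otimes> b)) = 0"
    using assms by (simp_all add: kac_eq_iff kac_mult_nth algebra_simps)
  have K: "kac_mult kac_K (kac_K :: 'a kac) \<noteq> 0"
    by (simp add: kac_eq_iff kac_mult_nth kac_K_nth)
  show "kac_opposite (kac_lift a 0) (kac_lift 0 b)" "kac_opposite (kac_lift 0 b) (kac_lift a 0)"
    using assms ab sq
    by (simp_all add: kac_opposite_def kac_lift_mult kap_form_linear kac_tensor_linear kac_mult_scale_left
        kac_mult_scale_right flip: vec.scale_minus_right)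
  show "\<not> kac_opposite (kac_lift a 0) (kac_lift b 0)" "\<not> kac_opposite (kac_lift 0 a) (kac_lift 0 b)"
    using assms K
    by (auto simp: kac_opposite_def kac_lift_mult kap_form_linear kac_tensor_linear kac_mult_scale_left
        kac_mult_scale_right)
qed

text \<open>Whether \<open>g\<close> changes the half is the same question for \<open>u\<close> and
  for \<open>g u\<close>, because \<open>g\<close> preserves being opposite. So two applications
  change the half twice or not at all.\<close>

lemma kac_Aut_square_left:
  fixes g :: "'a::field_char_0 kac \<Rightarrow> 'a kac"
  assumes g: "g \<in> kac_Aut"
  shows "\<exists>a. a $ Ie = 0 \<and> g (g (kac_lift kap_x 0)) = kac_lift a 0"
proof -
  let ?u = "kac_lift kap_x 0 :: 'a kac"
  have x: "kap_x $ Ie = (0 :: 'a)" "kap_x \<noteq> (0 :: 'a kap)" by (simp_all add: kap_eq_iff)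
  then have "kac_pure ?u" unfolding kac_pure_iff by blast
  then have p: "kac_pure (g ?u)" "kac_pure (g (g ?u))" using kac_Aut_pure[OF g] by blast+
  have opp: "kac_opposite (g ?u) (g (g ?u)) \<longleftrightarrow> kac_opposite ?u (g ?u)" by (rule kac_Aut_opposite[OF g])
  obtain a where a: "a $ Ie = 0" "a \<noteq> 0" "g ?u = kac_lift a 0 \<or> g ?u = kac_lift 0 a"
    using p(1) unfolding kac_pure_iff by blast
  obtain b where b: "b $ Ie = 0" "b \<noteq> 0" "g (g ?u) = kac_lift b 0 \<or> g (g ?u) = kac_lift 0 b"
    using p(2) unfolding kac_pure_iff by blast
  have "g (g ?u) = kac_lift b 0"
    using a(3) b(3)
  proof (elim disjE)
    assume h: "g ?u = kac_lift a 0" "g (g ?u) = kac_lift 0 b"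
    have "kac_opposite (g ?u) (g (g ?u))" unfolding h(2) unfolding h(1) by (rule kac_opposite_lift(1)[OF a(1) b(1) a(2) b(2)])
    moreover have "\<not> kac_opposite ?u (g ?u)" unfolding h(1) by (rule kac_opposite_lift(3)[OF x(1) a(1) x(2) a(2)])
    ultimately show ?thesis using opp by blast
  next
    assume h: "g ?u = kac_lift 0 a" "g (g ?u) = kac_lift 0 b"
    have "\<not> kac_opposite (g ?u) (g (g ?u))" unfolding h(2) unfolding h(1) by (rule kac_opposite_lift(4)[OF a(1) b(1) a(2) b(2)])
    moreover have "kac_opposite ?u (g ?u)" unfolding h(1) by (rule kac_opposite_lift(1)[OF x(1) a(1) x(2) a(2)])
    ultimately show ?thesis using opp by blast
  qed
  then show ?thesis using b by blast
qed

text \<open>Square roots are taken coordinatewise in \<open>split_torus m\<close>; they exist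
  because the field is algebraically closed.\<close>

lemma torus_square_root:
  fixes T :: "('a::{alg_closed_field, field_char_0} kac \<Rightarrow> 'a kac) set"
  assumes T: "is_torus T" and f: "f \<in> T"
  shows "\<exists>g\<in>T. f = g \<circ> g"
proof -
  obtain m and \<rho> :: "(nat \<Rightarrow> 'a) \<Rightarrow> 'a kac \<Rightarrow> 'a kac" where bij: "bij_betw \<rho> (split_torus m) T"
    and hom: "\<forall>s\<in>split_torus m. \<forall>t\<in>split_torus m. \<rho> (\<lambda>i. s i * t i) = \<rho> s \<circ> \<rho> t"
    using T unfolding is_torus_def by blast
  obtain t where t: "t \<in> split_torus m" "f = \<rho> t" using bij f by (auto simp: bij_betw_def)
  have "\<exists>y. y ^ 2 = t i" for i using nth_root_exists[of 2 "t i"] by auto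
  then obtain r where r: "\<And>i. r i ^ 2 = t i" by metis
  \<comment> \<open>From position \<open>m\<close> on the padding must be 1, whereas the chosen root
    of 1 could be -1.\<close>
  define s where "s i = (if i < m then r i else 1)" for i
  have st: "s i * s i = t i" for i
    using r[of i] t(1) by (auto simp: s_def split_torus_def power2_eq_square)
  moreover have s: "s \<in> split_torus m"
    unfolding split_torus_def
  proof safe
    fix i assume "i < m" "s i = 0"
    then show False using st[of i] t(1) by (simp add: split_torus_def)
  qed (simp add: s_def)
  ultimately have "f = \<rho> s \<circ> \<rho> s" using hom t(2) by (metis (no_types, lifting) ext)
  moreover have "\<rho> s \<in> T" using bij s by (auto simp: bij_betw_def)
  ultimately show ?thesis by blast
qed

text \<open>In a torus every element is a square, hence maps \<open>x \<otimes> e\<close> into \<open>\<langle>x, y\<rangle> \<otimes> e\<close>. So it has the same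
  eigenvalue on the eigenvectors \<open>e \<otimes> x + x \<otimes> e\<close> and \<open>e \<otimes> x - x \<otimes> e\<close>.\<close>
lemma ZZ2_not_toral:
  "\<not> toral ZZ2_group (kac_ZZ2_grading :: _ \<Rightarrow> 'a::{alg_closed_field, field_char_0} kac set)"
proof
  let ?J = "kac_ZZ2_grading :: _ \<Rightarrow> 'a kac set"
  assume "toral ZZ2_group ?J"
  then obtain T S where T: "is_torus T" and ST: "S \<subseteq> T" and S: "produced_by S ZZ2_group ?J"
    unfolding toral_def by blast
  have "zariski_closed_in_Aut T" using T by (simp only: is_torus_def)
  then have TA: "T \<subseteq> kac_Aut" by (auto simp: zariski_closed_in_Aut_def)
  let ?p = "ZZ2_basis (Some (Ie, Ix)) :: 'a kac" and ?m = "ZZ2_basis (Some (Ix, Ie)) :: 'a kac"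
  have img: "?J ` support ZZ2_group ?J = {E. E \<noteq> {0} \<and> (\<exists>c. E = simultaneous_eigenspace S c)}"
    using S by (simp only: produced_by_def)
  have "?J (1, 0) \<in> ?J ` support ZZ2_group ?J" "?J (1, 1) \<in> ?J ` support ZZ2_group ?J"
    by (intro imageI, simp add: ZZ2_support)+
  then obtain c c' where c: "?J (1, 0) = simultaneous_eigenspace S c" "?J (1, 1) = simultaneous_eigenspace S c'"
    unfolding img by blast
  have "?p \<in> ZZ2.U (1, 0)" "?m \<in> ZZ2.U (1, 1)"
    using ZZ2.B_in[where 'a = 'a, of "Some (Ie, Ix)"] ZZ2.B_in[where 'a = 'a, of "Some (Ix, Ie)"] by simp_all
  then have pm: "?p \<in> ?J (1, 0)" "?m \<in> ?J (1, 1)" unfolding ZZ2_U .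
  have cc: "c f = c' f" if f: "f \<in> S" for f
  proof -
    interpret f: Vector_Spaces.linear "(*s)" "(*s)" f using f ST TA by (auto simp: kac_Aut_def)
    obtain g where "g \<in> T" "f = g \<circ> g" using torus_square_root[OF T] f ST by blast
    then obtain a where a: "a $ Ie = 0" "f (kac_lift kap_x 0) = kac_lift a 0"
      using kac_Aut_square_left[of g] TA by auto
    have "f ?p = c f *s ?p" using pm(1) f unfolding c simultaneous_eigenspace_def by blast
    moreover have "f ?m = c' f *s ?m" using pm(2) f unfolding c simultaneous_eigenspace_def by blast
    moreover have "2 *s kac_lift kap_x 0 = ?p - ?m" by (simp add: kac_eq_iff kac_lift_def)
    then have "2 *s f (kac_lift kap_x 0) = f ?p - f ?m" by (simp only: flip: f.scale f.diff)
    ultimately have "2 *s kac_lift a 0 = c f *s ?p - c' f *s ?m" by (simp only: a)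
    \<comment> \<open>The \<open>e \<otimes> x\<close> coordinate is 0 on the left and 1 in both
      \<open>?p\<close> and \<open>?m\<close>.\<close>
    from arg_cong[OF this, of "\<lambda>v. v $ Some (Ie, Ix)"] show ?thesis
      using a by (simp add: kac_lift_nth)
  qed
  then have "?J (1, 0) = ?J (1, 1)" unfolding c simultaneous_eigenspace_def by auto
  then have "?p \<in> ZZ2.U (1, 1)" using pm unfolding ZZ2_U by simp
  then have "ZZ2_coord (Some (Ie, Ix)) ?p \<noteq> 0 \<longrightarrow> ZZ2_deg (Some (Ie, Ix)) = (1, 1)"
    unfolding ZZ2.U_def by blast
  then show False by simp
qed

theorem corollary2:
  fixes J1 J2 :: "int \<times> int \<Rightarrow> 'a::{alg_closed_field, field_char_0} kac set"
  defines "J1 \<equiv> kac_ZZ_grading" and "J2 \<equiv> kac_ZZ2_grading"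
  shows "(fine_grading ZZ_group J1 \<and> toral ZZ_group J1 \<and> grading_type ZZ_group J1 [8, 1]) \<and>
         (fine_grading ZZ2_group J2 \<and> \<not> toral ZZ2_group J2 \<and> grading_type ZZ2_group J2 [7, 0, 1]) \<and>
         \<not> equivalent_gradings ZZ_group J1 ZZ2_group J2 \<and>
         (\<forall>(G :: ('g, 'm) monoid_scheme) (U :: 'g \<Rightarrow> 'a kac set). fine_grading G U \<longrightarrow>
            equivalent_gradings G U ZZ_group J1 \<or> equivalent_gradings G U ZZ2_group J2)"
  unfolding J1_def J2_def
  by (intro conjI allI impI ZZ_fine ZZ_toral ZZ_type ZZ2_fine ZZ2_not_toral ZZ2_type not_equivalent
      fine_grading_equivalent)

end
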